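(* Let $\omega$ be a free ultrafilter on $\mathbb{N}$. There exist a second countable locally compact Hausdorff abelian group $G$, a C*-algebra $\mathcal{A}$ and a continuous action $\alpha$ of $G$ on $\mathcal{A}$ such that $$\mathcal{A}^{\omega}_{\alpha}\rtimes_{\alpha^{\omega}}G\neq(\mathcal{A}\rtimes_{\alpha}G)^{\omega}_{\hat{\alpha}},$$ where $\mathcal{A}^{\omega}_{\alpha}\rtimes_{\alpha^{\omega}}G$ is regarded as a C*-subalgebra of $(\mathcal{A}\rtimes_{\alpha}G)^{\omega}_{\hat{\alpha}}$ via the canonical embedding $\Phi$; that is, $\Phi(\mathcal{A}^{\omega}_{\alpha}\rtimes_{\alpha^{\omega}}G)\subsetneq(\mathcal{A}\rtimes_{\alpha}G)^{\omega}_{\hat{\alpha}}$.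
   Context: For a C*-algebra $\mathcal{B}$, $\ell^{\infty}(\mathbb{N},\mathcal{B})$ is the C*-algebra of bounded sequences in $\mathcal{B}$, $C^{\omega}(\mathcal{B})=\{x\in\ell^{\infty}(\mathbb{N},\mathcal{B}):\lim_{n\to\omega}\|x(n)\|=0\}$, and $\mathcal{B}^{\omega}=\ell^{\infty}(\mathbb{N},\mathcal{B})/C^{\omega}(\mathcal{B})$; the class of $(x_n)_n$ is written $[(x_n)_n]_{\omega}$. For a continuous action $\beta$ of a topological group $H$ on $\mathcal{B}$, let $\bar{\beta}_s((x_n)_n)=(\beta_s(x_n))_n$ on $\ell^{\infty}(\mathbb{N},\mathcal{B})$ and $\beta^{\omega}_s([(x_n)_n]_{\omega})=[(\beta_s(x_n))_n]_{\omega}$ on $\mathcal{B}^{\omega}$. The continuous part $\mathcal{B}^{\omega}_{\beta}\subset\mathcal{B}^{\omega}$ is the image in $\mathcal{B}^{\omega}$ of $\{x\in\ell^{\infty}(\mathbb{N},\mathcal{B}):s\mapsto\bar{\beta}_s(x)\text{ is norm continuous on }H\}$; $\beta^{\omega}$ restricts to a continuous action on it. For a C*-dynamical system $(\mathcal{B},G,\beta)$, $\mathcal{B}\rtimes_{\beta}G$ is the (full) crossed product, the completion of the convolution $*$-algebra $C_c(G,\mathcal{B})$ in the universal norm. For $b\in\mathcal{B}$, $f\in C_c(G)$, $bf$ denotes the function $s\mapsto f(s)b$ in $C_c(G,\mathcal{B})$. For $G$ abelian with dual group $\hat{G}$, the dual action $\hat{\alpha}$ of $\hat{G}$ on $\mathcal{A}\rtimes_{\alpha}G$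 is the extension of $\hat{\alpha}_{\gamma}(x)(s)=\overline{\langle s,\gamma\rangle}x(s)$, $x\in C_c(G,\mathcal{A})$. For $G$ abelian, $\Phi:\mathcal{A}^{\omega}_{\alpha}\rtimes_{\alpha^{\omega}}G\to(\mathcal{A}\rtimes_{\alpha}G)^{\omega}$ is the canonical injective $*$-homomorphism determined by $\Phi(af)=[(a_nf)_n]_{\omega}$ for $f\in C_c(G)$, $a=[(a_n)_n]_{\omega}\in\mathcal{A}^{\omega}_{\alpha}$; its range lies in $(\mathcal{A}\rtimes_{\alpha}G)^{\omega}_{\hat{\alpha}}$. *)

theory Defs
  imports "HOL-Analysis.Analysis" "HOL-Algebra.Group"
begin

text \<open>
  The statement quantifies existentially over groups and C*-algebras, and it iterates quotients and
  completions of C*-algebras, so all structures are carrier based.  Functions on a group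
  are extensional, so that equality of functions is equality on the carrier.
\<close>

definition free_ultrafilter :: "nat filter \<Rightarrow> bool" where
  "free_ultrafilter \<omega> \<longleftrightarrow>
     \<omega> \<noteq> bot \<and>
     (\<forall>P. eventually P \<omega> \<or> eventually (\<lambda>n. \<not> P n) \<omega>) \<and>
     (\<forall>m. eventually (\<lambda>n. n \<noteq> m) \<omega>)"


section \<open>Normed *-algebras and C*-algebras\<close>

record 'a star_alg = "'a partial_object" +
  aadd :: "'a \<Rightarrow> 'a \<Rightarrow> 'a"
  azero :: 'a
  amult :: "'a \<Rightarrow> 'a \<Rightarrow> 'a"
  ascale :: "complex \<Rightarrow> 'a \<Rightarrow> 'a"
  astar :: "'a \<Rightarrow> 'a"
  anorm :: "'a \<Rightarrow> real"

text \<open>The value outside the carrier is fixed because \<^locale>\<open>Metric_space\<close> requires a distance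
  function that is symmetric and nonnegative on the whole type.\<close>
definition adist :: "'a star_alg \<Rightarrow> 'a \<Rightarrow> 'a \<Rightarrow> real" where
  "adist B x y =
     (if x \<in> carrier B \<and> y \<in> carrier B then anorm B (aadd B x (ascale B (-1) y)) else 0)"

definition atopology :: "'a star_alg \<Rightarrow> 'a topology" where
  "atopology B = Metric_space.mtopology (carrier B) (adist B)"

locale cstar_algebra =
  fixes B :: "'a star_alg"
  assumes add_group: "comm_group \<lparr>carrier = carrier B, monoid.mult = aadd B, one = azero B\<rparr>"
    and scale_closed: "x \<in> carrier B \<Longrightarrow> ascale B c x \<in> carrier B"
    and scale_add_right: "\<lbrakk>x \<in> carrier B; y \<in> carrier B\<rbrakk>
          \<Longrightarrow> ascale B c (aadd B x y) = aadd B (ascale B c x) (ascale B c y)"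
    and scale_add_left: "x \<in> carrier B
          \<Longrightarrow> ascale B (c + d) x = aadd B (ascale B c x) (ascale B d x)"
    and scale_scale: "x \<in> carrier B \<Longrightarrow> ascale B c (ascale B d x) = ascale B (c * d) x"
    and scale_one: "x \<in> carrier B \<Longrightarrow> ascale B 1 x = x"
    and mult_closed: "\<lbrakk>x \<in> carrier B; y \<in> carrier B\<rbrakk> \<Longrightarrow> amult B x y \<in> carrier B"
    and mult_assoc: "\<lbrakk>x \<in> carrier B; y \<in> carrier B; z \<in> carrier B\<rbrakk>
          \<Longrightarrow> amult B (amult B x y) z = amult B x (amult B y z)"
    and mult_add_left: "\<lbrakk>x \<in> carrier B; y \<in> carrier B; z \<in> carrier B\<rbrakk>
          \<Longrightarrow> amult B (aadd B x y) z = aadd B (amult B x z) (amult B y z)"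
    and mult_add_right: "\<lbrakk>x \<in> carrier B; y \<in> carrier B; z \<in> carrier B\<rbrakk>
          \<Longrightarrow> amult B x (aadd B y z) = aadd B (amult B x y) (amult B x z)"
    and mult_scale_left: "\<lbrakk>x \<in> carrier B; y \<in> carrier B\<rbrakk>
          \<Longrightarrow> amult B (ascale B c x) y = ascale B c (amult B x y)"
    and mult_scale_right: "\<lbrakk>x \<in> carrier B; y \<in> carrier B\<rbrakk>
          \<Longrightarrow> amult B x (ascale B c y) = ascale B c (amult B x y)"
    and star_closed: "x \<in> carrier B \<Longrightarrow> astar B x \<in> carrier B"
    and star_star: "x \<in> carrier B \<Longrightarrow> astar B (astar B x) = x"
    and star_add: "\<lbrakk>x \<in> carrier B; y \<in> carrier B\<rbrakk>
          \<Longrightarrow> astar B (aadd B x y) = aadd B (astar B x) (astar B y)"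
    and star_scale: "x \<in> carrier B \<Longrightarrow> astar B (ascale B c x) = ascale B (cnj c) (astar B x)"
    and star_mult: "\<lbrakk>x \<in> carrier B; y \<in> carrier B\<rbrakk>
          \<Longrightarrow> astar B (amult B x y) = amult B (astar B y) (astar B x)"
    and norm_nonneg: "x \<in> carrier B \<Longrightarrow> 0 \<le> anorm B x"
    and norm_eq_0: "x \<in> carrier B \<Longrightarrow> anorm B x = 0 \<longleftrightarrow> x = azero B"
    and norm_triangle: "\<lbrakk>x \<in> carrier B; y \<in> carrier B\<rbrakk>
          \<Longrightarrow> anorm B (aadd B x y) \<le> anorm B x + anorm B y"
    and norm_scale: "x \<in> carrier B \<Longrightarrow> anorm B (ascale B c x) = cmod c * anorm B x"
    and norm_mult: "\<lbrakk>x \<in> carrier B; y \<in> carrier B\<rbrakk>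
          \<Longrightarrow> anorm B (amult B x y) \<le> anorm B x * anorm B y"
    and cstar_identity: "x \<in> carrier B \<Longrightarrow> anorm B (amult B (astar B x) x) = (anorm B x)\<^sup>2"
    and complete: "Metric_space.mcomplete (carrier B) (adist B)"

definition star_hom :: "'a star_alg \<Rightarrow> 'b star_alg \<Rightarrow> ('a \<Rightarrow> 'b) \<Rightarrow> bool" where
  "star_hom A B h \<longleftrightarrow>
     h \<in> carrier A \<rightarrow> carrier B \<and>
     (\<forall>x\<in>carrier A. \<forall>y\<in>carrier A. h (aadd A x y) = aadd B (h x) (h y)) \<and>
     (\<forall>x\<in>carrier A. \<forall>y\<in>carrier A. h (amult A x y) = amult B (h x) (h y)) \<and>
     (\<forall>x\<in>carrier A. \<forall>c. h (ascale A c x) = ascale B c (h x)) \<and>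
     (\<forall>x\<in>carrier A. h (astar A x) = astar B (h x))"


subsection \<open>Quotients and completions\<close>

definition coset :: "'a star_alg \<Rightarrow> 'a set \<Rightarrow> 'a \<Rightarrow> 'a set" where
  "coset B I x = {aadd B x i | i. i \<in> I}"

text \<open>When \<open>I\<close> is an ideal (or \<open>F\<close> maps \<open>I\<close>-cosets into \<open>I\<close>-cosets) the unions below are unions
  of equal sets, namely the coset of the result for any choice of representatives.\<close>
definition quot_map :: "'a star_alg \<Rightarrow> 'a set \<Rightarrow> ('a \<Rightarrow> 'a) \<Rightarrow> 'a set \<Rightarrow> 'a set" where
  "quot_map B I F X = (\<Union>x\<in>X. coset B I (F x))"

definition quot :: "'a star_alg \<Rightarrow> 'a set \<Rightarrow> 'a set star_alg" where
  "quot B I =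
     \<lparr>carrier = coset B I ` carrier B,
      aadd = (\<lambda>X Y. \<Union>x\<in>X. \<Union>y\<in>Y. coset B I (aadd B x y)),
      azero = coset B I (azero B),
      amult = (\<lambda>X Y. \<Union>x\<in>X. \<Union>y\<in>Y. coset B I (amult B x y)),
      ascale = (\<lambda>c. quot_map B I (ascale B c)),
      astar = quot_map B I (astar B),
      anorm = (\<lambda>X. INF x\<in>X. anorm B x)\<rparr>"

definition cauchy_alg :: "'a star_alg \<Rightarrow> (nat \<Rightarrow> 'a) star_alg" where
  "cauchy_alg B =
     \<lparr>carrier = {x. Metric_space.MCauchy (carrier B) (adist B) x},
      aadd = (\<lambda>x y n. aadd B (x n) (y n)),
      azero = (\<lambda>n. azero B),
      amult = (\<lambda>x y n. amult B (x n) (y n)),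
      ascale = (\<lambda>c x n. ascale B c (x n)),
      astar = (\<lambda>x n. astar B (x n)),
      anorm = (\<lambda>x. lim (\<lambda>n. anorm B (x n)))\<rparr>"

definition cauchy_null :: "'a star_alg \<Rightarrow> (nat \<Rightarrow> 'a) set" where
  "cauchy_null B = {x \<in> carrier (cauchy_alg B). (\<lambda>n. anorm B (x n)) \<longlonglongrightarrow> 0}"

definition completion :: "'a star_alg \<Rightarrow> (nat \<Rightarrow> 'a) set star_alg" where
  "completion B = quot (cauchy_alg B) (cauchy_null B)"

definition completion_incl :: "'a star_alg \<Rightarrow> 'a \<Rightarrow> (nat \<Rightarrow> 'a) set" where
  "completion_incl B b = coset (cauchy_alg B) (cauchy_null B) (\<lambda>_. b)"

text \<open>The extension of an isometric linear self-map \<open>F\<close> of \<open>B\<close> to the completion.\<close>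
definition completion_map :: "'a star_alg \<Rightarrow> ('a \<Rightarrow> 'a) \<Rightarrow> (nat \<Rightarrow> 'a) set \<Rightarrow> (nat \<Rightarrow> 'a) set" where
  "completion_map B F = quot_map (cauchy_alg B) (cauchy_null B) (\<lambda>x n. F (x n))"


subsection \<open>Ultrapowers\<close>

definition linf :: "'a star_alg \<Rightarrow> (nat \<Rightarrow> 'a) star_alg" where
  "linf B =
     \<lparr>carrier = {x. (\<forall>n. x n \<in> carrier B) \<and> bdd_above (range (\<lambda>n. anorm B (x n)))},
      aadd = (\<lambda>x y n. aadd B (x n) (y n)),
      azero = (\<lambda>n. azero B),
      amult = (\<lambda>x y n. amult B (x n) (y n)),
      ascale = (\<lambda>c x n. ascale B c (x n)),
      astar = (\<lambda>x n. astar B (x n)),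
      anorm = (\<lambda>x. SUP n. anorm B (x n))\<rparr>"

definition null_ideal :: "nat filter \<Rightarrow> 'a star_alg \<Rightarrow> (nat \<Rightarrow> 'a) set" where
  "null_ideal \<omega> B = {x \<in> carrier (linf B). ((\<lambda>n. anorm B (x n)) \<longlongrightarrow> 0) \<omega>}"

definition ultrapower :: "nat filter \<Rightarrow> 'a star_alg \<Rightarrow> (nat \<Rightarrow> 'a) set star_alg" where
  "ultrapower \<omega> B = quot (linf B) (null_ideal \<omega> B)"

definition uclass :: "nat filter \<Rightarrow> 'a star_alg \<Rightarrow> (nat \<Rightarrow> 'a) \<Rightarrow> (nat \<Rightarrow> 'a) set" where
  "uclass \<omega> B x = coset (linf B) (null_ideal \<omega> B) x"

definition ultra_action ::
  "nat filter \<Rightarrow> 'a star_alg \<Rightarrow> ('h \<Rightarrow> 'a \<Rightarrow> 'a) \<Rightarrow> 'h \<Rightarrow> (nat \<Rightarrow> 'a) set \<Rightarrow> (nat \<Rightarrow> 'a) set" where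
  "ultra_action \<omega> B \<beta> s = quot_map (linf B) (null_ideal \<omega> B) (\<lambda>x n. \<beta> s (x n))"

text \<open>The continuous part of the ultrapower for an action \<open>\<beta>\<close> of a topological group; only the
  underlying topological space \<open>H\<close> of the group matters.\<close>
definition continuous_part ::
  "nat filter \<Rightarrow> 'h topology \<Rightarrow> 'a star_alg \<Rightarrow> ('h \<Rightarrow> 'a \<Rightarrow> 'a) \<Rightarrow> (nat \<Rightarrow> 'a) set star_alg" where
  "continuous_part \<omega> H B \<beta> =
     (ultrapower \<omega> B)
       \<lparr>carrier := uclass \<omega> B `
          {x \<in> carrier (linf B). continuous_map H (atopology (linf B)) (\<lambda>s n. \<beta> s (x n))}\<rparr>"


section \<open>Locally compact abelian groups\<close>

record 'g top_group = "'g monoid" +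
  gtop :: "'g topology"

locale sc_lca_group = comm_group G for G :: "'g top_group" (structure) +
  assumes topspace_gtop: "topspace (gtop G) = carrier G"
    and continuous_mult:
      "continuous_map (prod_topology (gtop G) (gtop G)) (gtop G) (\<lambda>(x, y). x \<otimes> y)"
    and continuous_inv: "continuous_map (gtop G) (gtop G) (\<lambda>x. inv x)"
    and Hausdorff: "Hausdorff_space (gtop G)"
    and locally_compact: "locally_compact_space (gtop G)"
    and second_countable: "second_countable (gtop G)"

text \<open>No regularity is demanded: on a second countable locally compact Hausdorff space every Borel
  measure that is finite on compact sets is a Radon measure.\<close>
definition haar_measure :: "'g top_group \<Rightarrow> 'g measure \<Rightarrow> bool" where
  "haar_measure G \<mu> \<longleftrightarrow>
     space \<mu> = carrier G \<and>
     sets \<mu> = sigma_sets (carrier G) {U. openin (gtop G) U} \<and>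
     (\<forall>K. compactin (gtop G) K \<longrightarrow> emeasure \<mu> K < \<infinity>) \<and>
     (\<forall>s\<in>carrier G. \<forall>E\<in>sets \<mu>. emeasure \<mu> ((\<lambda>r. s \<otimes>\<^bsub>G\<^esub> r) ` E) = emeasure \<mu> E) \<and>
     emeasure \<mu> (carrier G) \<noteq> 0"

definition characters :: "'g top_group \<Rightarrow> ('g \<Rightarrow> complex) set" where
  "characters G =
     {\<gamma> \<in> extensional (carrier G).
        (\<forall>s\<in>carrier G. cmod (\<gamma> s) = 1) \<and>
        (\<forall>s\<in>carrier G. \<forall>t\<in>carrier G. \<gamma> (s \<otimes>\<^bsub>G\<^esub> t) = \<gamma> s * \<gamma> t) \<and>
        continuous_map (gtop G) euclidean \<gamma>}"

text \<open>The space underlying the dual group, i.e. the characters with the compact-open topology.\<close>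
definition dual_space :: "'g top_group \<Rightarrow> ('g \<Rightarrow> complex) topology" where
  "dual_space G =
     topology_generated_by
       {{\<gamma> \<in> characters G. \<gamma> ` K \<subseteq> U} | K U. compactin (gtop G) K \<and> open U}"

definition cont_action :: "'g top_group \<Rightarrow> 'a star_alg \<Rightarrow> ('g \<Rightarrow> 'a \<Rightarrow> 'a) \<Rightarrow> bool" where
  "cont_action G B \<beta> \<longleftrightarrow>
     (\<forall>s\<in>carrier G. star_hom B B (\<beta> s) \<and> bij_betw (\<beta> s) (carrier B) (carrier B)) \<and>
     (\<forall>s\<in>carrier G. \<forall>t\<in>carrier G. \<forall>b\<in>carrier B. \<beta> (s \<otimes>\<^bsub>G\<^esub> t) b = \<beta> s (\<beta> t b)) \<and>
     (\<forall>b\<in>carrier B. continuous_map (gtop G) (atopology B) (\<lambda>s. \<beta> s b))"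


section \<open>Covariant representations\<close>

definition ell2 :: "('x \<Rightarrow> complex) set" where
  "ell2 = {\<xi>. (\<lambda>x. (cmod (\<xi> x))\<^sup>2) summable_on UNIV}"

definition ell2_inner :: "('x \<Rightarrow> complex) \<Rightarrow> ('x \<Rightarrow> complex) \<Rightarrow> complex" where
  "ell2_inner \<xi> \<eta> = (\<Sum>\<^sub>\<infinity>x. \<xi> x * cnj (\<eta> x))"

definition ell2_norm :: "('x \<Rightarrow> complex) \<Rightarrow> real" where
  "ell2_norm \<xi> = sqrt (\<Sum>\<^sub>\<infinity>x. (cmod (\<xi> x))\<^sup>2)"

definition ell2_topology :: "('x \<Rightarrow> complex) topology" where
  "ell2_topology =
     Metric_space.mtopology ell2
       (\<lambda>\<xi> \<eta>. if \<xi> \<in> ell2 \<and> \<eta> \<in> ell2 then ell2_norm (\<lambda>x. \<xi> x - \<eta> x) else 0)"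

type_synonym 'x op = "('x \<Rightarrow> complex) \<Rightarrow> ('x \<Rightarrow> complex)"

definition bounded_op :: "'x op \<Rightarrow> bool" where
  "bounded_op S \<longleftrightarrow>
     S \<in> ell2 \<rightarrow> ell2 \<and>
     (\<forall>\<xi>\<in>ell2. \<forall>\<eta>\<in>ell2. \<forall>c. S (\<lambda>x. c * \<xi> x + \<eta> x) = (\<lambda>x. c * S \<xi> x + S \<eta> x)) \<and>
     (\<exists>K. \<forall>\<xi>\<in>ell2. ell2_norm (S \<xi>) \<le> K * ell2_norm \<xi>)"

definition op_norm :: "'x op \<Rightarrow> real" where
  "op_norm S = Sup {ell2_norm (S \<xi>) | \<xi>. \<xi> \<in> ell2 \<and> ell2_norm \<xi> \<le> 1}"

text \<open>A (possibly degenerate) covariant representation of \<open>(B, G, \<beta>)\<close> on \<open>\<ell>\<^sup>2('x)\<close>: a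
  *-representation \<open>\<pi>\<close> of \<open>B\<close> and a strongly continuous unitary representation \<open>u\<close> of \<open>G\<close> with
  \<open>\<pi>(\<beta>\<^sub>s(b)) u\<^sub>s = u\<^sub>s \<pi>(b)\<close>.\<close>
definition covariant_rep ::
  "'g top_group \<Rightarrow> 'b star_alg \<Rightarrow> ('g \<Rightarrow> 'b \<Rightarrow> 'b) \<Rightarrow> ('b \<Rightarrow> 'x op) \<Rightarrow> ('g \<Rightarrow> 'x op) \<Rightarrow> bool" where
  "covariant_rep G B \<beta> \<pi> u \<longleftrightarrow>
     (\<forall>b\<in>carrier B. bounded_op (\<pi> b)) \<and>
     (\<forall>a\<in>carrier B. \<forall>b\<in>carrier B. \<forall>\<xi>\<in>ell2. \<pi> (aadd B a b) \<xi> = (\<lambda>x. \<pi> a \<xi> x + \<pi> b \<xi> x)) \<and>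
     (\<forall>b\<in>carrier B. \<forall>c. \<forall>\<xi>\<in>ell2. \<pi> (ascale B c b) \<xi> = (\<lambda>x. c * \<pi> b \<xi> x)) \<and>
     (\<forall>a\<in>carrier B. \<forall>b\<in>carrier B. \<forall>\<xi>\<in>ell2. \<pi> (amult B a b) \<xi> = \<pi> a (\<pi> b \<xi>)) \<and>
     (\<forall>b\<in>carrier B. \<forall>\<xi>\<in>ell2. \<forall>\<eta>\<in>ell2.
        ell2_inner (\<pi> (astar B b) \<xi>) \<eta> = ell2_inner \<xi> (\<pi> b \<eta>)) \<and>
     (\<forall>s\<in>carrier G. bounded_op (u s) \<and> u s ` ell2 = ell2 \<and>
        (\<forall>\<xi>\<in>ell2. \<forall>\<eta>\<in>ell2. ell2_inner (u s \<xi>) (u s \<eta>) = ell2_inner \<xi> \<eta>)) \<and>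
     (\<forall>s\<in>carrier G. \<forall>t\<in>carrier G. \<forall>\<xi>\<in>ell2. u (s \<otimes>\<^bsub>G\<^esub> t) \<xi> = u s (u t \<xi>)) \<and>
     (\<forall>\<xi>\<in>ell2. continuous_map (gtop G) ell2_topology (\<lambda>s. u s \<xi>)) \<and>
     (\<forall>s\<in>carrier G. \<forall>b\<in>carrier B. \<forall>\<xi>\<in>ell2. \<pi> (\<beta> s b) (u s \<xi>) = u s (\<pi> b \<xi>))"

text \<open>The integrated form \<open>\<integral> \<pi>(f(s)) u\<^sub>s d\<mu>(s)\<close>; the coordinates of a vector-valued integral in
  \<open>\<ell>\<^sup>2('x)\<close> are the integrals of the coordinates.\<close>
definition integrated_form ::
  "'g measure \<Rightarrow> ('b \<Rightarrow> 'x op) \<Rightarrow> ('g \<Rightarrow> 'x op) \<Rightarrow> ('g \<Rightarrow> 'b) \<Rightarrow> 'x op" where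
  "integrated_form \<mu> \<pi> u f = (\<lambda>\<xi> x. \<integral>s. \<pi> (f s) (u s \<xi>) x \<partial>\<mu>)"

text \<open>The supremum over all covariant representations on all Hilbert spaces.  It suffices to use the
  single Hilbert space \<open>\<ell>\<^sup>2('g \<Rightarrow> 'b)\<close>: the norm is already attained as the supremum over cyclic
  representations of \<open>C\<^sub>c(G, B)\<close>, whose spaces have a dense subset indexed by \<open>C\<^sub>c(G, B)\<close>, hence an
  orthonormal basis indexed by a subset of the type \<open>'g \<Rightarrow> 'b\<close>; on the orthogonal
  complement one puts \<open>\<pi> = 0\<close> and \<open>u = 1\<close>, which does not change the norm.\<close>
definition universal_norm ::
  "'g top_group \<Rightarrow> 'g measure \<Rightarrow> 'b star_alg \<Rightarrow> ('g \<Rightarrow> 'b \<Rightarrow> 'b) \<Rightarrow> ('g \<Rightarrow> 'b) \<Rightarrow> real" where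
  "universal_norm G \<mu> B \<beta> f =
     Sup {op_norm (integrated_form \<mu> \<pi> u f) |
            (\<pi> :: 'b \<Rightarrow> ('g \<Rightarrow> 'b) op) (u :: 'g \<Rightarrow> ('g \<Rightarrow> 'b) op). covariant_rep G B \<beta> \<pi> u}"


section \<open>Crossed products\<close>

definition bounded_functionals :: "'b star_alg \<Rightarrow> ('b \<Rightarrow> complex) set" where
  "bounded_functionals B =
     {\<phi>. (\<forall>x\<in>carrier B. \<forall>y\<in>carrier B. \<phi> (aadd B x y) = \<phi> x + \<phi> y) \<and>
          (\<forall>x\<in>carrier B. \<forall>c. \<phi> (ascale B c x) = c * \<phi> x) \<and>
          (\<exists>K. \<forall>x\<in>carrier B. cmod (\<phi> x) \<le> K * anorm B x)}"

text \<open>The \<open>B\<close>-valued integral, which for integrands in \<open>C\<^sub>c(G, B)\<close> exists and is characterised by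
  commuting with bounded linear functionals.\<close>
definition alg_integral :: "'b star_alg \<Rightarrow> 'g measure \<Rightarrow> ('g \<Rightarrow> 'b) \<Rightarrow> 'b" where
  "alg_integral B \<mu> h =
     (THE b. b \<in> carrier B \<and> (\<forall>\<phi>\<in>bounded_functionals B. \<phi> b = (\<integral>s. \<phi> (h s) \<partial>\<mu>)))"

definition Cc :: "'g top_group \<Rightarrow> 'b topology \<Rightarrow> 'b \<Rightarrow> ('g \<Rightarrow> 'b) set" where
  "Cc G Y z =
     {f \<in> extensional (carrier G).
        continuous_map (gtop G) Y f \<and>
        compactin (gtop G) (gtop G closure_of {s \<in> carrier G. f s \<noteq> z})}"

text \<open>The convolution *-algebra \<open>C\<^sub>c(G, B)\<close> with the universal norm.  The group is abelian, hence
  unimodular, so no modular function occurs in the involution.\<close>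
definition conv_alg ::
  "'g top_group \<Rightarrow> 'g measure \<Rightarrow> 'b star_alg \<Rightarrow> ('g \<Rightarrow> 'b \<Rightarrow> 'b) \<Rightarrow> ('g \<Rightarrow> 'b) star_alg" where
  "conv_alg G \<mu> B \<beta> =
     \<lparr>carrier = Cc G (atopology B) (azero B),
      aadd = (\<lambda>f g. \<lambda>s\<in>carrier G. aadd B (f s) (g s)),
      azero = (\<lambda>s\<in>carrier G. azero B),
      amult = (\<lambda>f g. \<lambda>s\<in>carrier G.
         alg_integral B \<mu> (\<lambda>r. amult B (f r) (\<beta> r (g (inv\<^bsub>G\<^esub> r \<otimes>\<^bsub>G\<^esub> s))))),
      ascale = (\<lambda>c f. \<lambda>s\<in>carrier G. ascale B c (f s)),
      astar = (\<lambda>f. \<lambda>s\<in>carrier G. \<beta> s (astar B (f (inv\<^bsub>G\<^esub> s)))),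
      anorm = universal_norm G \<mu> B \<beta>\<rparr>"

definition crossed_product ::
  "'g top_group \<Rightarrow> 'g measure \<Rightarrow> 'b star_alg \<Rightarrow> ('g \<Rightarrow> 'b \<Rightarrow> 'b) \<Rightarrow> (nat \<Rightarrow> 'g \<Rightarrow> 'b) set star_alg" where
  "crossed_product G \<mu> B \<beta> = completion (conv_alg G \<mu> B \<beta>)"

text \<open>The image in the crossed product of the function \<open>bf\<close>, that is \<open>s \<mapsto> f(s)b\<close>.\<close>
definition elem ::
  "'g top_group \<Rightarrow> 'g measure \<Rightarrow> 'b star_alg \<Rightarrow> ('g \<Rightarrow> 'b \<Rightarrow> 'b) \<Rightarrow> 'b \<Rightarrow> ('g \<Rightarrow> complex)
     \<Rightarrow> (nat \<Rightarrow> 'g \<Rightarrow> 'b) set" where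
  "elem G \<mu> B \<beta> b f = completion_incl (conv_alg G \<mu> B \<beta>) (\<lambda>s\<in>carrier G. ascale B (f s) b)"

definition dual_action ::
  "'g top_group \<Rightarrow> 'g measure \<Rightarrow> 'b star_alg \<Rightarrow> ('g \<Rightarrow> 'b \<Rightarrow> 'b) \<Rightarrow> ('g \<Rightarrow> complex)
     \<Rightarrow> (nat \<Rightarrow> 'g \<Rightarrow> 'b) set \<Rightarrow> (nat \<Rightarrow> 'g \<Rightarrow> 'b) set" where
  "dual_action G \<mu> B \<beta> \<gamma> =
     completion_map (conv_alg G \<mu> B \<beta>) (\<lambda>f. \<lambda>s\<in>carrier G. ascale B (cnj (\<gamma> s)) (f s))"


section \<open>The two algebras and the canonical embedding\<close>

definition cp_of_continuous_part ::
  "nat filter \<Rightarrow> 'g top_group \<Rightarrow> 'g measure \<Rightarrow> 'a star_alg \<Rightarrow> ('g \<Rightarrow> 'a \<Rightarrow> 'a)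
     \<Rightarrow> (nat \<Rightarrow> 'g \<Rightarrow> (nat \<Rightarrow> 'a) set) set star_alg" where
  "cp_of_continuous_part \<omega> G \<mu> A \<alpha> =
     crossed_product G \<mu> (continuous_part \<omega> (gtop G) A \<alpha>) (ultra_action \<omega> A \<alpha>)"

definition continuous_part_of_cp ::
  "nat filter \<Rightarrow> 'g top_group \<Rightarrow> 'g measure \<Rightarrow> 'a star_alg \<Rightarrow> ('g \<Rightarrow> 'a \<Rightarrow> 'a)
     \<Rightarrow> (nat \<Rightarrow> (nat \<Rightarrow> 'g \<Rightarrow> 'a) set) set star_alg" where
  "continuous_part_of_cp \<omega> G \<mu> A \<alpha> =
     continuous_part \<omega> (dual_space G) (crossed_product G \<mu> A \<alpha>) (dual_action G \<mu> A \<alpha>)"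

text \<open>The formula determines \<open>\<Phi>\<close>: *-homomorphisms of C*-algebras are contractive and the elements
  \<open>af\<close> span a dense subspace of the crossed product.\<close>
definition canonical_embedding ::
  "nat filter \<Rightarrow> 'g top_group \<Rightarrow> 'g measure \<Rightarrow> 'a star_alg \<Rightarrow> ('g \<Rightarrow> 'a \<Rightarrow> 'a)
     \<Rightarrow> ((nat \<Rightarrow> 'g \<Rightarrow> (nat \<Rightarrow> 'a) set) set \<Rightarrow> (nat \<Rightarrow> (nat \<Rightarrow> 'g \<Rightarrow> 'a) set) set) \<Rightarrow> bool" where
  "canonical_embedding \<omega> G \<mu> A \<alpha> \<Phi> \<longleftrightarrow>
     star_hom (cp_of_continuous_part \<omega> G \<mu> A \<alpha>) (ultrapower \<omega> (crossed_product G \<mu> A \<alpha>)) \<Phi> \<and>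
     inj_on \<Phi> (carrier (cp_of_continuous_part \<omega> G \<mu> A \<alpha>)) \<and>
     (\<forall>a\<in>carrier (linf A). \<forall>f\<in>Cc G euclidean 0.
        uclass \<omega> A a \<in> carrier (continuous_part \<omega> (gtop G) A \<alpha>) \<longrightarrow>
        \<Phi> (elem G \<mu> (continuous_part \<omega> (gtop G) A \<alpha>) (ultra_action \<omega> A \<alpha>) (uclass \<omega> A a) f) =
          uclass \<omega> (crossed_product G \<mu> A \<alpha>) (\<lambda>n. elem G \<mu> A \<alpha> (a n) f))"

end

theory Submission
  imports Defs
begin

text \<open>
  The example is the circle group \<open>T\<close> acting trivially on the complex numbers.  Fourier coefficients
  identify the crossed product of \<open>\<complex>\<close> by \<open>T\<close> with \<open>c\<^sub>0(\<int>)\<close>.  A bounded sequence of complex numbers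
  converges along \<open>\<omega>\<close>, so the ultrapower of \<open>\<complex>\<close> is \<open>\<complex>\<close> again and the smaller algebra is \<open>c\<^sub>0(\<int>)\<close>
  as well; the embedding \<open>\<Phi>\<close> sends an element to the class of the corresponding constant sequence.  On
  the other side, the dual group of \<open>T\<close> is discrete, so every element of the ultrapower of \<open>c\<^sub>0(\<int>)\<close>
  has a continuous orbit and the continuous part is everything.  The characters \<open>s \<mapsto> s\<^sup>n\<close>, seen
  as elements of the convolution algebra, have mutual distance at least one.  Since \<open>\<omega>\<close> is free,
  the sequence that they form is not equivalent to a constant one, and its class is outside the range
  of \<open>\<Phi>\<close> (lemma \<open>diag_range\<close>).

  The analytic point is that the universal norm of a function on \<open>T\<close> is the supremum of the moduli of
  its Fourier coefficients (lemma \<open>universal_norm_eq\<close>).  A character acting by scalars is a covariant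
  representation in which the norm of the integrated form is one such modulus, so the supremum is a
  lower bound.  For the upper bound, a vector \<open>\<eta>\<close> moves under a unitary representation along
  a curve \<open>s \<mapsto> u\<^sub>s \<eta>\<close> whose inner products are invariant under translation.  The Fourier
  components of such a curve are orthogonal and satisfy Bessel's inequality, which gives the estimate
  for trigonometric polynomials; Stone-Weierstrass gives it for all continuous functions (lemma
  \<open>V_norm_le\<close>).

  Quotients, completions and ultrapowers are handled through faithful representations as algebras
  of bounded functions with the supremum norm (locale \<open>function_alg\<close>): there, all identities and
  estimates are pointwise.  Ultrapowers and completions are the same construction for two
  filters on the natural numbers (locale \<open>seq_quotient\<close>).  The completion of a
  function algebra is its uniform closure (lemma \<open>hbar_image_completion\<close>), so the
  two crossed products, both completions of the algebra of Fourier transforms of continuous functions,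
  are represented by the same functions.
\<close>

section \<open>Algebras of bounded functions\<close>

definition sup_norm :: "('i \<Rightarrow> complex) \<Rightarrow> real" where
  "sup_norm f = (SUP i. cmod (f i))"

lemma sup_norm_ge: "bounded (range f) \<Longrightarrow> cmod (f i) \<le> sup_norm f"
  unfolding sup_norm_def
  by (rule cSUP_upper) (auto simp: bounded_iff bdd_above_def)

lemma sup_norm_le: "(\<And>i. cmod (f i) \<le> K) \<Longrightarrow> sup_norm f \<le> K"
  unfolding sup_norm_def by (rule cSUP_least) auto

lemma sup_norm_nonneg: "bounded (range f) \<Longrightarrow> 0 \<le> sup_norm f"
  using sup_norm_ge[of f undefined] norm_ge_zero[of "f undefined"] by linarith

lemma bounded_range_le: "(\<And>i. cmod (f i) \<le> K) \<Longrightarrow> bounded (range f)"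
  by (auto simp: bounded_iff)

text \<open>The scalars, the convolution algebra on the circle (by Fourier coefficients), its completion and the
  algebras of bounded sequences are all commutative and embed into bounded functions.  The map \<open>h\<close>
  records such an embedding.  Its image need not be uniformly closed, because the convolution algebra is not
  complete.\<close>
locale function_alg =
  fixes B :: "'a star_alg" and h :: "'a \<Rightarrow> 'i \<Rightarrow> complex"
  assumes h_inj: "inj_on h (carrier B)"
    and h_bounded: "x \<in> carrier B \<Longrightarrow> bounded (range (h x))"
    and zero_closed: "azero B \<in> carrier B"
    and h_zero: "h (azero B) = (\<lambda>i. 0)"
    and add_closed: "\<lbrakk>x \<in> carrier B; y \<in> carrier B\<rbrakk> \<Longrightarrow> aadd B x y \<in> carrier B"
    and h_add: "\<lbrakk>x \<in> carrier B; y \<in> carrier B\<rbrakk> \<Longrightarrow> h (aadd B x y) = (\<lambda>i. h x i + h y i)"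
    and mult_closed: "\<lbrakk>x \<in> carrier B; y \<in> carrier B\<rbrakk> \<Longrightarrow> amult B x y \<in> carrier B"
    and h_mult: "\<lbrakk>x \<in> carrier B; y \<in> carrier B\<rbrakk> \<Longrightarrow> h (amult B x y) = (\<lambda>i. h x i * h y i)"
    and scale_closed: "x \<in> carrier B \<Longrightarrow> ascale B c x \<in> carrier B"
    and h_scale: "x \<in> carrier B \<Longrightarrow> h (ascale B c x) = (\<lambda>i. c * h x i)"
    and star_closed: "x \<in> carrier B \<Longrightarrow> astar B x \<in> carrier B"
    and h_star: "x \<in> carrier B \<Longrightarrow> h (astar B x) = (\<lambda>i. cnj (h x i))"
    and norm_eq: "x \<in> carrier B \<Longrightarrow> anorm B x = sup_norm (h x)"
begin

lemma eqI: "\<lbrakk>x \<in> carrier B; y \<in> carrier B; \<And>i. h x i = h y i\<rbrakk> \<Longrightarrow> x = y"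
  using h_inj by (simp add: fun_eq_iff inj_on_eq_iff[symmetric])

lemma norm_nonneg: "x \<in> carrier B \<Longrightarrow> 0 \<le> anorm B x"
  by (simp add: norm_eq sup_norm_nonneg h_bounded)

lemma cmod_h_le: "x \<in> carrier B \<Longrightarrow> cmod (h x i) \<le> anorm B x"
  by (simp add: norm_eq sup_norm_ge h_bounded)

lemma norm_leI: "x \<in> carrier B \<Longrightarrow> (\<And>i. cmod (h x i) \<le> K) \<Longrightarrow> anorm B x \<le> K"
  by (simp add: norm_eq sup_norm_le)

lemma dist_eq:
  assumes "x \<in> carrier B" "y \<in> carrier B"
  shows "adist B x y = sup_norm (\<lambda>i. h x i - h y i)"
  using assms by (simp add: adist_def norm_eq add_closed scale_closed h_add h_scale)

lemma cmod_h_diff_le: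
  "\<lbrakk>x \<in> carrier B; y \<in> carrier B\<rbrakk> \<Longrightarrow> cmod (h x i - h y i) \<le> adist B x y"
  using sup_norm_ge[OF bounded_minus_comp[OF h_bounded[of x] h_bounded[of y]]]
  by (simp add: dist_eq)

lemma dist_leI:
  "\<lbrakk>x \<in> carrier B; y \<in> carrier B; \<And>i. cmod (h x i - h y i) \<le> K\<rbrakk> \<Longrightarrow> adist B x y \<le> K"
  by (simp add: dist_eq sup_norm_le)

lemma dist_nonneg: "0 \<le> adist B x y"
proof (cases "x \<in> carrier B \<and> y \<in> carrier B")
  case True
  then show ?thesis
    using cmod_h_diff_le[of x y undefined] norm_ge_zero[of "h x undefined - h y undefined"] by linarith
qed (auto simp: adist_def)

lemma metric: "Metric_space (carrier B) (adist B)"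
proof
  show "0 \<le> adist B x y" for x y by (rule dist_nonneg)
  show "adist B x y = adist B y x" for x y
  proof (cases "x \<in> carrier B \<and> y \<in> carrier B")
    case True
    then show ?thesis by (simp add: dist_eq sup_norm_def norm_minus_commute)
  qed (auto simp: adist_def)
  show "(adist B x y = 0) = (x = y)" if "x \<in> carrier B" "y \<in> carrier B" for x y
  proof
    assume "adist B x y = 0"
    then have "h x i = h y i" for i using cmod_h_diff_le[OF that, of i] by simp
    then show "x = y" by (rule eqI[OF that])
  next
    assume "x = y"
    then show "adist B x y = 0" using that by (simp add: dist_eq sup_norm_def)
  qed
  show "adist B x z \<le> adist B x y + adist B y z"
    if "x \<in> carrier B" "y \<in> carrier B" "z \<in> carrier B" for x y z
  proof (rule dist_leI)
    fix i
    have "cmod (h x i - h z i) \<le> cmod (h x i - h y i) + cmod (h y i - h z i)"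
      by (metis norm_triangle_ineq diff_add_cancel add_diff_eq)
    then show "cmod (h x i - h z i) \<le> adist B x y + adist B y z"
      using cmod_h_diff_le[OF that(1,2), of i] cmod_h_diff_le[OF that(2,3), of i] by linarith
  qed (use that in auto)
qed

sublocale M: Metric_space "carrier B" "adist B"
  by (rule metric)

lemma topspace_atopology [simp]: "topspace (atopology B) = carrier B"
  by (simp add: atopology_def)

lemma norm_eq_dist: "x \<in> carrier B \<Longrightarrow> anorm B x = adist B x (azero B)"
  by (simp add: dist_eq zero_closed h_zero norm_eq)

text \<open>These Lipschitz estimates, for each of the operations, are the reason that the operations pass to
  sequences modulo null sequences and preserve Cauchy sequences.\<close>
lemma dist_add:
  assumes "x \<in> carrier B" "y \<in> carrier B" "x' \<in> carrier B" "y' \<in> carrier B"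
  shows "adist B (aadd B x y) (aadd B x' y') \<le> adist B x x' + adist B y y'"
proof (rule dist_leI)
  fix i
  have "cmod (h (aadd B x y) i - h (aadd B x' y') i) = cmod ((h x i - h x' i) + (h y i - h y' i))"
    using assms by (simp add: h_add algebra_simps)
  also have "\<dots> \<le> cmod (h x i - h x' i) + cmod (h y i - h y' i)" by (rule norm_triangle_ineq)
  also have "\<dots> \<le> adist B x x' + adist B y y'"
    using assms by (intro add_mono cmod_h_diff_le)
  finally show "cmod (h (aadd B x y) i - h (aadd B x' y') i) \<le> adist B x x' + adist B y y'" .
qed (use assms in \<open>auto intro: add_closed\<close>)

lemma dist_mult:
  assumes "x \<in> carrier B" "y \<in> carrier B" "x' \<in> carrier B" "y' \<in> carrier B"
  shows "adist B (amult B x y) (amult B x' y')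
    \<le> anorm B x * adist B y y' + adist B x x' * anorm B y'"
proof (rule dist_leI)
  fix i
  have "cmod (h (amult B x y) i - h (amult B x' y') i)
      = cmod (h x i * (h y i - h y' i) + (h x i - h x' i) * h y' i)"
    using assms by (simp add: h_mult algebra_simps)
  also have "\<dots> \<le> cmod (h x i) * cmod (h y i - h y' i) + cmod (h x i - h x' i) * cmod (h y' i)"
    by (metis norm_triangle_ineq norm_mult)
  also have "\<dots> \<le> anorm B x * adist B y y' + adist B x x' * anorm B y'"
    using assms by (intro add_mono mult_mono cmod_h_diff_le cmod_h_le norm_nonneg dist_nonneg) auto
  finally show "cmod (h (amult B x y) i - h (amult B x' y') i)
    \<le> anorm B x * adist B y y' + adist B x x' * anorm B y'" .
qed (use assms in \<open>auto intro: mult_closed\<close>)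

lemma dist_scale:
  assumes "x \<in> carrier B" "x' \<in> carrier B"
  shows "adist B (ascale B c x) (ascale B c x') \<le> cmod c * adist B x x'"
proof (rule dist_leI)
  fix i
  show "cmod (h (ascale B c x) i - h (ascale B c x') i) \<le> cmod c * adist B x x'"
    using assms cmod_h_diff_le[OF assms, of i]
    by (simp add: h_scale mult_left_mono norm_mult flip: right_diff_distrib)
qed (use assms in \<open>auto intro: scale_closed\<close>)

lemma dist_star:
  assumes "x \<in> carrier B" "x' \<in> carrier B"
  shows "adist B (astar B x) (astar B x') \<le> adist B x x'"
proof (rule dist_leI)
  fix i
  show "cmod (h (astar B x) i - h (astar B x') i) \<le> adist B x x'"
    using assms cmod_h_diff_le[OF assms, of i]
    by (simp add: h_star flip: complex_cnj_diff)
qed (use assms in \<open>auto intro: star_closed\<close>)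

lemma norm_zero: "anorm B (azero B) = 0"
  by (simp add: norm_eq zero_closed h_zero sup_norm_def)

lemma norm_add:
  assumes "x \<in> carrier B" "y \<in> carrier B"
  shows "anorm B (aadd B x y) \<le> anorm B x + anorm B y"
proof (rule norm_leI)
  fix i
  show "cmod (h (aadd B x y) i) \<le> anorm B x + anorm B y"
    using assms norm_triangle_ineq[of "h x i" "h y i"] cmod_h_le[of x i] cmod_h_le[of y i]
    by (simp add: h_add)
qed (use assms in \<open>auto intro: add_closed\<close>)

lemma norm_mult_le:
  assumes "x \<in> carrier B" "y \<in> carrier B"
  shows "anorm B (amult B x y) \<le> anorm B x * anorm B y"
proof (rule norm_leI)
  fix i
  show "cmod (h (amult B x y) i) \<le> anorm B x * anorm B y"
    using assms by (simp add: h_mult norm_mult mult_mono cmod_h_le norm_nonneg)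
qed (use assms in \<open>auto intro: mult_closed\<close>)

lemma norm_scale_le:
  assumes "x \<in> carrier B"
  shows "anorm B (ascale B c x) \<le> cmod c * anorm B x"
proof (rule norm_leI)
  fix i
  show "cmod (h (ascale B c x) i) \<le> cmod c * anorm B x"
    using assms by (simp add: h_scale norm_mult mult_left_mono cmod_h_le)
qed (use assms in \<open>auto intro: scale_closed\<close>)

lemma norm_star_le:
  assumes "x \<in> carrier B"
  shows "anorm B (astar B x) \<le> anorm B x"
proof (rule norm_leI)
  fix i
  show "cmod (h (astar B x) i) \<le> anorm B x"
    using assms by (simp add: h_star cmod_h_le)
qed (use assms in \<open>auto intro: star_closed\<close>)

lemma linf_carrier:
  "x \<in> carrier (linf B) \<longleftrightarrow> (\<forall>n. x n \<in> carrier B) \<and> (\<exists>K. \<forall>n. anorm B (x n) \<le> K)"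
  by (auto simp: linf_def bdd_above_def)

text \<open>A sequence of functions on \<open>'i\<close> is a function on \<open>nat \<times> 'i\<close>, and the supremum norms agree.\<close>
lemma linf_function_alg: "function_alg (linf B) (\<lambda>x p. h (x (fst p)) (snd p))"
proof (rule function_alg.intro)
  let ?h = "\<lambda>x p. h (x (fst p)) (snd p)"
  show "inj_on ?h (carrier (linf B))"
  proof (rule inj_onI)
    fix x y assume xy: "x \<in> carrier (linf B)" "y \<in> carrier (linf B)" and eq: "?h x = ?h y"
    show "x = y"
    proof
      fix n
      have "h (x n) i = h (y n) i" for i using fun_cong[OF eq, of "(n, i)"] by simp
      moreover have "x n \<in> carrier B" "y n \<in> carrier B" using xy by (simp_all add: linf_carrier)
      ultimately show "x n = y n" by (rule eqI[rotated 2])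
    qed
  qed
  show bdd: "bounded (range (?h x))" if x: "x \<in> carrier (linf B)" for x
  proof -
    obtain K where K: "\<And>n. anorm B (x n) \<le> K" using x by (auto simp: linf_carrier)
    have "x n \<in> carrier B" for n using x by (simp add: linf_carrier)
    then have "cmod (?h x p) \<le> K" for p
      using K[of "fst p"] cmod_h_le[of "x (fst p)" "snd p"] order_trans by blast
    then show ?thesis by (rule bounded_range_le)
  qed
  show "anorm (linf B) x = sup_norm (?h x)" if x: "x \<in> carrier (linf B)" for x
  proof (rule antisym)
    have xn: "x n \<in> carrier B" for n using x by (auto simp: linf_carrier)
    show "anorm (linf B) x \<le> sup_norm (?h x)"
    proof -
      have "anorm B (x n) \<le> sup_norm (?h x)" for n
        using sup_norm_ge[OF bdd[OF x], of "(n, _)"] by (intro norm_leI xn) simp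
      then show ?thesis by (simp add: linf_def cSUP_least)
    qed
    show "sup_norm (?h x) \<le> anorm (linf B) x"
    proof (rule sup_norm_le)
      fix p :: "nat \<times> 'i"
      have "anorm B (x (fst p)) \<le> anorm (linf B) x"
        using x by (auto simp: linf_def intro: cSUP_upper)
      then show "cmod (?h x p) \<le> anorm (linf B) x"
        using cmod_h_le[OF xn[of "fst p"], of "snd p"] by linarith
    qed
  qed
  show "azero (linf B) \<in> carrier (linf B)"
    by (simp add: linf_def zero_closed)
  show "aadd (linf B) x y \<in> carrier (linf B)"
    if "x \<in> carrier (linf B)" "y \<in> carrier (linf B)" for x y
  proof -
    from that obtain K L where KL: "\<And>n. anorm B (x n) \<le> K" "\<And>n. anorm B (y n) \<le> L"
      and mem: "\<And>n. x n \<in> carrier B" "\<And>n. y n \<in> carrier B"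
      by (auto simp: linf_carrier)
    have "anorm B (aadd B (x n) (y n)) \<le> K + L" for n
      using norm_add[OF mem(1)[of n] mem(2)[of n]] KL[of n] by linarith
    with mem show ?thesis unfolding linf_carrier by (auto simp: linf_def intro!: add_closed)
  qed
  show "amult (linf B) x y \<in> carrier (linf B)"
    if "x \<in> carrier (linf B)" "y \<in> carrier (linf B)" for x y
  proof -
    from that obtain K L where KL: "\<And>n. anorm B (x n) \<le> K" "\<And>n. anorm B (y n) \<le> L"
      and mem: "\<And>n. x n \<in> carrier B" "\<And>n. y n \<in> carrier B"
      by (auto simp: linf_carrier)
    have "anorm B (amult B (x n) (y n)) \<le> K * L" for n
    proof (rule order_trans[OF norm_mult_le[OF mem]])
      show "anorm B (x n) * anorm B (y n) \<le> K * L"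
        using KL[of n] norm_nonneg[OF mem(1)[of n]] norm_nonneg[OF mem(2)[of n]]
        by (intro mult_mono) auto
    qed
    with mem show ?thesis unfolding linf_carrier by (auto simp: linf_def intro!: mult_closed)
  qed
  show "ascale (linf B) c x \<in> carrier (linf B)" if "x \<in> carrier (linf B)" for c x
  proof -
    from that obtain K where K: "\<And>n. anorm B (x n) \<le> K" and mem: "\<And>n. x n \<in> carrier B"
      by (auto simp: linf_carrier)
    have "anorm B (ascale B c (x n)) \<le> cmod c * K" for n
      using norm_scale_le[OF mem[of n], of c] mult_left_mono[OF K[of n], of "cmod c"] by simp
    with mem show ?thesis unfolding linf_carrier by (auto simp: linf_def intro!: scale_closed)
  qed
  show "astar (linf B) x \<in> carrier (linf B)" if "x \<in> carrier (linf B)" for x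
  proof -
    from that obtain K where K: "\<And>n. anorm B (x n) \<le> K" and mem: "\<And>n. x n \<in> carrier B"
      by (auto simp: linf_carrier)
    have "anorm B (astar B (x n)) \<le> K" for n
      using norm_star_le[OF mem[of n]] K[of n] by linarith
    with mem show ?thesis unfolding linf_carrier by (auto simp: linf_def intro!: star_closed)
  qed
qed (simp_all add: linf_def h_zero h_add h_mult h_scale h_star)

end

section \<open>Quotients of sequence algebras\<close>

lemma (in function_alg) dist_add_right:
  assumes "x \<in> carrier B" "i \<in> carrier B"
  shows "adist B x (aadd B x i) = anorm B i"
  using assms by (simp add: dist_eq add_closed h_add norm_eq sup_norm_def)

lemma (in function_alg) norm_diff:
  assumes "x \<in> carrier B" "z \<in> carrier B"
  shows "anorm B (aadd B z (ascale B (-1) x)) = adist B x z"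
  using assms by (simp add: M.commute[of x z]) (simp add: adist_def)

lemma (in function_alg) add_diff_cancel:
  assumes "x \<in> carrier B" "z \<in> carrier B"
  shows "aadd B x (aadd B z (ascale B (-1) x)) = z"
  using assms by (intro eqI) (simp_all add: h_add h_scale add_closed scale_closed)

lemma (in function_alg) norm_le_norm_add_dist:
  assumes "x \<in> carrier B" "y \<in> carrier B"
  shows "anorm B x \<le> anorm B y + adist B x y"
  using assms M.triangle[of x y "azero B"] by (simp add: norm_eq_dist zero_closed)

text \<open>An ultrapower and a completion are both quotients of an algebra \<open>D\<close> of bounded sequences in \<open>B\<close> by
  the sequences whose norms tend to zero along a filter: the ultrafilter in the first case, the
  filter of cofinite sets in the second.\<close>
locale seq_quotient = function_alg B h for B :: "'a star_alg" and h :: "'a \<Rightarrow> 'i \<Rightarrow> complex" +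
  fixes D :: "(nat \<Rightarrow> 'a) star_alg" and I :: "(nat \<Rightarrow> 'a) set" and F :: "nat filter"
  assumes D_mem: "x \<in> carrier D \<Longrightarrow> x n \<in> carrier B"
    and D_bdd: "x \<in> carrier D \<Longrightarrow> \<exists>K. \<forall>n. anorm B (x n) \<le> K"
    and D_add: "aadd D = (\<lambda>x y n. aadd B (x n) (y n))"
    and D_zero: "azero D = (\<lambda>n. azero B)"
    and D_mult: "amult D = (\<lambda>x y n. amult B (x n) (y n))"
    and D_scale: "ascale D = (\<lambda>c x n. ascale B c (x n))"
    and D_star: "astar D = (\<lambda>x n. astar B (x n))"
    and D_zero_closed: "(\<lambda>n. azero B) \<in> carrier D"
    and D_add_closed: "\<lbrakk>x \<in> carrier D; y \<in> carrier D\<rbrakk> \<Longrightarrow> (\<lambda>n. aadd B (x n) (y n)) \<in> carrier D"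
    and D_mult_closed: "\<lbrakk>x \<in> carrier D; y \<in> carrier D\<rbrakk> \<Longrightarrow> (\<lambda>n. amult B (x n) (y n)) \<in> carrier D"
    and D_scale_closed: "x \<in> carrier D \<Longrightarrow> (\<lambda>n. ascale B c (x n)) \<in> carrier D"
    and D_star_closed: "x \<in> carrier D \<Longrightarrow> (\<lambda>n. astar B (x n)) \<in> carrier D"
    and I_eq: "I = {x \<in> carrier D. ((\<lambda>n. anorm B (x n)) \<longlongrightarrow> 0) F}"
begin

definition sim :: "(nat \<Rightarrow> 'a) \<Rightarrow> (nat \<Rightarrow> 'a) \<Rightarrow> bool" where
  "sim x y \<longleftrightarrow> ((\<lambda>n. adist B (x n) (y n)) \<longlongrightarrow> 0) F"

lemma simI:
  assumes "(f \<longlongrightarrow> 0) F" "\<And>n. adist B (x n) (y n) \<le> f n"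
  shows "sim x y"
  unfolding sim_def
  by (rule tendsto_sandwich[OF _ _ tendsto_const assms(1)]) (auto simp: assms(2))

lemma sim_refl: "x \<in> carrier D \<Longrightarrow> sim x x"
  by (simp add: sim_def D_mem)

lemma sim_sym: "sim x y \<Longrightarrow> sim y x"
  by (simp add: sim_def M.commute)

lemma sim_trans:
  assumes "x \<in> carrier D" "y \<in> carrier D" "z \<in> carrier D" "sim x y" "sim y z"
  shows "sim x z"
proof (rule simI)
  show "((\<lambda>n. adist B (x n) (y n) + adist B (y n) (z n)) \<longlongrightarrow> 0) F"
    using tendsto_add[OF assms(4,5)[unfolded sim_def]] by simp
qed (use assms in \<open>simp add: M.triangle D_mem\<close>)

text \<open>If \<open>z\<close> is equivalent to \<open>x\<close>, the difference \<open>z - x\<close> is a null sequence in \<open>D\<close>, and \<open>z\<close> is the sum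
  of \<open>x\<close> and this difference because \<open>h\<close> is injective.\<close>
lemma coset_iff:
  assumes x: "x \<in> carrier D"
  shows "z \<in> coset D I x \<longleftrightarrow> z \<in> carrier D \<and> sim x z"
proof
  assume "z \<in> coset D I x"
  then obtain i where i: "i \<in> carrier D" "((\<lambda>n. anorm B (i n)) \<longlongrightarrow> 0) F"
    and z: "z = (\<lambda>n. aadd B (x n) (i n))"
    by (auto simp: coset_def I_eq D_add)
  show "z \<in> carrier D \<and> sim x z"
    using i x by (simp add: z D_add_closed sim_def dist_add_right D_mem)
next
  assume z: "z \<in> carrier D \<and> sim x z"
  define i where "i = (\<lambda>n. aadd B (z n) (ascale B (-1) (x n)))"
  have "i \<in> carrier D" unfolding i_def using x z by (intro D_add_closed D_scale_closed) auto
  moreover have "((\<lambda>n. anorm B (i n)) \<longlongrightarrow> 0) F"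
    using z x by (simp add: i_def norm_diff D_mem sim_def)
  moreover have "z = aadd D x i"
    using z x by (simp add: i_def add_diff_cancel D_mem D_add)
  ultimately show "z \<in> coset D I x" unfolding coset_def I_eq by blast
qed

lemma coset_eq_iff:
  assumes "x \<in> carrier D" "y \<in> carrier D"
  shows "coset D I x = coset D I y \<longleftrightarrow> sim x y"
proof
  assume "coset D I x = coset D I y"
  then show "sim x y" using assms coset_iff sim_refl by blast
next
  assume xy: "sim x y"
  have "sim x z \<longleftrightarrow> sim y z" if z: "z \<in> carrier D" for z
    using sim_trans[OF assms z xy] sim_trans[OF assms(2,1) z sim_sym[OF xy]] by blast
  then show "coset D I x = coset D I y"
    using coset_iff[OF assms(1)] coset_iff[OF assms(2)] by blast
qed

text \<open>The unions that define the operations of a quotient run over equal cosets whenever the operation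
  respects equivalence of sequences.  The next two lemmas are this for one and for two arguments.\<close>
lemma UN_coset_eq:
  assumes "x \<in> carrier D" "f x \<in> carrier D"
    and "\<And>z. z \<in> carrier D \<Longrightarrow> sim x z \<Longrightarrow> f z \<in> carrier D \<and> sim (f x) (f z)"
  shows "quot_map D I f (coset D I x) = coset D I (f x)"
proof -
  have "coset D I (f z) = coset D I (f x)" if "z \<in> coset D I x" for z
  proof -
    have z: "z \<in> carrier D" "sim x z"
      using that by (simp_all add: coset_iff assms)
    show ?thesis
      using coset_eq_iff[OF assms(2), of "f z"] assms(3)[OF z] by simp
  qed
  moreover have "x \<in> coset D I x" using assms by (simp add: coset_iff sim_refl)
  ultimately show ?thesis unfolding quot_map_def by blast
qed

lemma UN_coset_eq2:
  assumes "x \<in> carrier D" "y \<in> carrier D"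
    and "\<And>z w. z \<in> carrier D \<Longrightarrow> w \<in> carrier D \<Longrightarrow> f z w \<in> carrier D"
    and "\<And>z w. \<lbrakk>z \<in> carrier D; w \<in> carrier D; sim x z; sim y w\<rbrakk> \<Longrightarrow> sim (f x y) (f z w)"
  shows "(\<Union>z\<in>coset D I x. \<Union>w\<in>coset D I y. coset D I (f z w)) = coset D I (f x y)"
proof -
  have "coset D I (f z w) = coset D I (f x y)" if "z \<in> coset D I x" "w \<in> coset D I y" for z w
  proof -
    have zw: "z \<in> carrier D" "w \<in> carrier D" "sim x z" "sim y w"
      using that by (simp_all add: coset_iff assms)
    show ?thesis
      using coset_eq_iff[OF assms(3)[OF assms(1,2)] assms(3)[OF zw(1,2)]] assms(4)[OF zw] by simp
  qed
  moreover have "x \<in> coset D I x" "y \<in> coset D I y" using assms by (simp_all add: coset_iff sim_refl)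
  ultimately show ?thesis by blast
qed

lemma quot_add:
  assumes "x \<in> carrier D" "y \<in> carrier D"
  shows "aadd (quot D I) (coset D I x) (coset D I y) = coset D I (\<lambda>n. aadd B (x n) (y n))"
proof -
  have "(\<Union>z\<in>coset D I x. \<Union>w\<in>coset D I y. coset D I (aadd D z w)) = coset D I (aadd D x y)"
  proof (rule UN_coset_eq2[OF assms])
    fix z w assume zw: "z \<in> carrier D" "w \<in> carrier D" "sim x z" "sim y w"
    show "sim (aadd D x y) (aadd D z w)"
    proof (rule simI)
      show "((\<lambda>n. adist B (x n) (z n) + adist B (y n) (w n)) \<longlongrightarrow> 0) F"
        using tendsto_add[OF zw(3,4)[unfolded sim_def]] by simp
    qed (use assms zw in \<open>simp add: D_add dist_add D_mem\<close>)
  qed (simp add: D_add D_add_closed)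
  then show ?thesis by (simp add: quot_def D_add)
qed

lemma quot_mult:
  assumes "x \<in> carrier D" "y \<in> carrier D"
  shows "amult (quot D I) (coset D I x) (coset D I y) = coset D I (\<lambda>n. amult B (x n) (y n))"
proof -
  obtain K where K: "\<And>n. anorm B (x n) \<le> K" using D_bdd[OF assms(1)] by blast
  have "(\<Union>z\<in>coset D I x. \<Union>w\<in>coset D I y. coset D I (amult D z w)) = coset D I (amult D x y)"
  proof (rule UN_coset_eq2[OF assms])
    fix z w assume zw: "z \<in> carrier D" "w \<in> carrier D" "sim x z" "sim y w"
    obtain L where L: "\<And>n. anorm B (w n) \<le> L" using D_bdd[OF zw(2)] by blast
    show "sim (amult D x y) (amult D z w)"
    proof (rule simI)
      show "((\<lambda>n. K * adist B (y n) (w n) + adist B (x n) (z n) * L) \<longlongrightarrow> 0) F"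
        using zw(3,4) unfolding sim_def by (auto intro!: tendsto_eq_intros)
      fix n
      have "adist B (amult D x y n) (amult D z w n)
          \<le> anorm B (x n) * adist B (y n) (w n) + adist B (x n) (z n) * anorm B (w n)"
        using assms zw by (simp add: D_mult dist_mult D_mem)
      also have "\<dots> \<le> K * adist B (y n) (w n) + adist B (x n) (z n) * L"
        using K[of n] L[of n] by (intro add_mono mult_left_mono mult_right_mono) auto
      finally show "adist B (amult D x y n) (amult D z w n)
          \<le> K * adist B (y n) (w n) + adist B (x n) (z n) * L" .
    qed
  qed (simp add: D_mult D_mult_closed)
  then show ?thesis by (simp add: quot_def D_mult)
qed

lemma quot_scale:
  assumes "x \<in> carrier D"
  shows "ascale (quot D I) c (coset D I x) = coset D I (\<lambda>n. ascale B c (x n))"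
proof -
  have "quot_map D I (ascale D c) (coset D I x) = coset D I (ascale D c x)"
  proof (rule UN_coset_eq)
    fix z assume z: "z \<in> carrier D" "sim x z"
    have "sim (ascale D c x) (ascale D c z)"
    proof (rule simI)
      show "((\<lambda>n. cmod c * adist B (x n) (z n)) \<longlongrightarrow> 0) F"
        using z(2) unfolding sim_def by (auto intro!: tendsto_eq_intros)
    qed (use assms z in \<open>simp add: D_scale dist_scale D_mem\<close>)
    then show "ascale D c z \<in> carrier D \<and> sim (ascale D c x) (ascale D c z)"
      using z by (simp add: D_scale D_scale_closed)
  qed (use assms in \<open>auto simp: D_scale D_scale_closed\<close>)
  then show ?thesis by (simp add: quot_def D_scale)
qed

lemma quot_star:
  assumes "x \<in> carrier D"
  shows "astar (quot D I) (coset D I x) = coset D I (\<lambda>n. astar B (x n))"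
proof -
  have "quot_map D I (astar D) (coset D I x) = coset D I (astar D x)"
  proof (rule UN_coset_eq)
    fix z assume z: "z \<in> carrier D" "sim x z"
    have "sim (astar D x) (astar D z)"
      by (rule simI[OF z(2)[unfolded sim_def]]) (use assms z in \<open>simp add: D_star dist_star D_mem\<close>)
    then show "astar D z \<in> carrier D \<and> sim (astar D x) (astar D z)"
      using z by (simp add: D_star D_star_closed)
  qed (use assms in \<open>auto simp: D_star D_star_closed\<close>)
  then show ?thesis by (simp add: quot_def D_star)
qed

lemma quot_zero: "azero (quot D I) = coset D I (\<lambda>n. azero B)"
  by (simp add: quot_def D_zero)

lemma quot_carrier: "carrier (quot D I) = coset D I ` carrier D"
  by (simp add: quot_def)

end

context function_alg
begin

lemma ultrapower_quotient: "seq_quotient B h (linf B) (null_ideal \<omega> B) \<omega>"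
proof -
  interpret L: function_alg "linf B" "\<lambda>x p. h (x (fst p)) (snd p)"
    by (rule linf_function_alg)
  show ?thesis
    using L.add_closed L.mult_closed L.scale_closed L.star_closed L.zero_closed
    by unfold_locales (simp_all add: linf_carrier null_ideal_def, simp_all add: linf_def)
qed

lemma MCauchy_bounded:
  assumes "M.MCauchy x" shows "\<exists>K. \<forall>n. anorm B (x n) \<le> K"
proof -
  have mem: "x n \<in> carrier B" for n using assms by (auto simp: M.MCauchy_def)
  obtain N where N: "\<And>n n'. N \<le> n \<Longrightarrow> N \<le> n' \<Longrightarrow> adist B (x n) (x n') < 1"
    using assms unfolding M.MCauchy_def by (meson zero_less_one)
  have "anorm B (x n) \<le> 1 + (\<Sum>m\<le>N. anorm B (x m))" for n
  proof (cases "n \<le> N")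
    case True
    then have "anorm B (x n) \<le> (\<Sum>m\<le>N. anorm B (x m))"
      by (intro member_le_sum) (auto simp: norm_nonneg mem)
    then show ?thesis by simp
  next
    case False
    have "anorm B (x N) \<le> (\<Sum>m\<le>N. anorm B (x m))"
      by (intro member_le_sum) (auto simp: norm_nonneg mem)
    then show ?thesis
      using norm_le_norm_add_dist[OF mem[of n] mem[of N]] N[of n N] False by simp
  qed
  then show ?thesis by blast
qed

lemma MCauchyI:
  assumes "\<And>n. y n \<in> carrier B"
    and "\<And>e. e > 0 \<Longrightarrow> \<exists>N. \<forall>n\<ge>N. \<forall>n'\<ge>N. adist B (y n) (y n') < e"
  shows "M.MCauchy y"
  using assms unfolding M.MCauchy_def by blast

lemma MCauchyD:
  assumes "M.MCauchy y" "e > 0"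
  obtains N where "\<And>n n'. n \<ge> N \<Longrightarrow> n' \<ge> N \<Longrightarrow> adist B (y n) (y n') < e"
  using assms unfolding M.MCauchy_def by meson

lemma MCauchy_mem: "M.MCauchy y \<Longrightarrow> y n \<in> carrier B"
  unfolding M.MCauchy_def by blast

lemma MCauchy_lipschitz:
  assumes x: "M.MCauchy x" and y: "\<And>n. y n \<in> carrier B"
    and le: "\<And>n m. adist B (y n) (y m) \<le> K * adist B (x n) (x m)"
  shows "M.MCauchy y"
proof (rule MCauchyI[OF y])
  fix e :: real assume e: "e > 0"
  obtain N where N: "\<And>n n'. n \<ge> N \<Longrightarrow> n' \<ge> N \<Longrightarrow> adist B (x n) (x n') < e / (\<bar>K\<bar> + 1)"
    using MCauchyD[OF x, of "e / (\<bar>K\<bar> + 1)"] e by auto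
  have "adist B (y n) (y n') < e" if "n \<ge> N" "n' \<ge> N" for n n'
  proof -
    have "adist B (y n) (y n') \<le> (\<bar>K\<bar> + 1) * adist B (x n) (x n')"
      by (rule order_trans[OF le]) (simp add: mult_right_mono)
    also have "\<dots> < e" using N[OF that] by (simp add: field_simps)
    finally show ?thesis .
  qed
  then show "\<exists>N. \<forall>n\<ge>N. \<forall>n'\<ge>N. adist B (y n) (y n') < e" by blast
qed

lemma MCauchy_combine:
  assumes x: "M.MCauchy x" and y: "M.MCauchy y" and z: "\<And>n. z n \<in> carrier B"
    and le: "\<And>n m. adist B (z n) (z m) \<le> K * adist B (x n) (x m) + K * adist B (y n) (y m)"
  shows "M.MCauchy z"
proof (rule MCauchyI[OF z])
  fix e :: real assume e: "e > 0"
  define d where "d = e / (2 * (\<bar>K\<bar> + 1))"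
  have d: "d > 0" using e by (simp add: d_def)
  obtain N1 where N1: "\<And>n n'. n \<ge> N1 \<Longrightarrow> n' \<ge> N1 \<Longrightarrow> adist B (x n) (x n') < d"
    using MCauchyD[OF x d] by auto
  obtain N2 where N2: "\<And>n n'. n \<ge> N2 \<Longrightarrow> n' \<ge> N2 \<Longrightarrow> adist B (y n) (y n') < d"
    using MCauchyD[OF y d] by auto
  have "adist B (z n) (z n') < e" if "n \<ge> max N1 N2" "n' \<ge> max N1 N2" for n n'
  proof -
    have "adist B (z n) (z n') \<le> (\<bar>K\<bar> + 1) * adist B (x n) (x n') + (\<bar>K\<bar> + 1) * adist B (y n) (y n')"
      by (rule order_trans[OF le]) (simp add: add_mono mult_right_mono)
    also have "\<dots> < (\<bar>K\<bar> + 1) * d + (\<bar>K\<bar> + 1) * d"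
      using N1[of n n'] N2[of n n'] that by (intro add_strict_mono mult_strict_left_mono) auto
    also have "\<dots> = 2 * (\<bar>K\<bar> + 1) * d" by (simp add: algebra_simps)
    also have "\<dots> = e" unfolding d_def by simp
    finally show ?thesis .
  qed
  then show "\<exists>N. \<forall>n\<ge>N. \<forall>n'\<ge>N. adist B (z n) (z n') < e" by blast
qed

lemma cauchy_carrier: "x \<in> carrier (cauchy_alg B) \<longleftrightarrow> M.MCauchy x"
  by (simp add: cauchy_alg_def)

lemma completion_quotient:
  "seq_quotient B h (cauchy_alg B) (cauchy_null B) sequentially"
proof
  show "(\<lambda>n. aadd B (x n) (y n)) \<in> carrier (cauchy_alg B)"
    if "x \<in> carrier (cauchy_alg B)" "y \<in> carrier (cauchy_alg B)" for x y
    unfolding cauchy_carrier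
    by (rule MCauchy_combine[of x y _ 1]) (use that dist_add in \<open>auto simp: cauchy_carrier add_closed MCauchy_mem\<close>)
  show "(\<lambda>n. amult B (x n) (y n)) \<in> carrier (cauchy_alg B)"
    if "x \<in> carrier (cauchy_alg B)" "y \<in> carrier (cauchy_alg B)" for x y
  proof -
    have xy: "M.MCauchy x" "M.MCauchy y" using that by (simp_all add: cauchy_carrier)
    obtain K L where KL: "\<And>n. anorm B (x n) \<le> K" "\<And>n. anorm B (y n) \<le> L"
      using MCauchy_bounded xy by meson
    show ?thesis unfolding cauchy_carrier
    proof (rule MCauchy_combine[OF xy, of _ "max K L"])
      fix n m
      have "adist B (amult B (x n) (y n)) (amult B (x m) (y m))
          \<le> anorm B (x n) * adist B (y n) (y m) + adist B (x n) (x m) * anorm B (y m)"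
        by (intro dist_mult MCauchy_mem xy)
      also have "\<dots> \<le> max K L * adist B (y n) (y m) + adist B (x n) (x m) * max K L"
        using KL by (intro add_mono mult_right_mono mult_left_mono) (auto simp: le_max_iff_disj)
      finally show "adist B (amult B (x n) (y n)) (amult B (x m) (y m))
          \<le> max K L * adist B (x n) (x m) + max K L * adist B (y n) (y m)" by (simp add: mult.commute)
    qed (simp add: mult_closed MCauchy_mem xy)
  qed
  show "(\<lambda>n. ascale B c (x n)) \<in> carrier (cauchy_alg B)" if "x \<in> carrier (cauchy_alg B)" for c x
    unfolding cauchy_carrier
    by (rule MCauchy_lipschitz[of x _ "cmod c"]) (use that in \<open>auto simp: cauchy_carrier scale_closed MCauchy_mem dist_scale\<close>)
  show "(\<lambda>n. astar B (x n)) \<in> carrier (cauchy_alg B)" if "x \<in> carrier (cauchy_alg B)" for x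
    unfolding cauchy_carrier
    by (rule MCauchy_lipschitz[of x _ 1]) (use that in \<open>auto simp: cauchy_carrier star_closed MCauchy_mem dist_star\<close>)
  show "\<exists>K. \<forall>n. anorm B (x n) \<le> K" if "x \<in> carrier (cauchy_alg B)" for x
    using that MCauchy_bounded by (simp add: cauchy_carrier)
  show "x n \<in> carrier B" if "x \<in> carrier (cauchy_alg B)" for x n
    using that by (simp add: cauchy_carrier MCauchy_mem)
qed (auto simp: cauchy_carrier zero_closed cauchy_null_def, auto simp: cauchy_alg_def)

end

section \<open>Completions\<close>

context function_alg
begin

interpretation C: seq_quotient B h "cauchy_alg B" "cauchy_null B" sequentially
  by (rule completion_quotient)

text \<open>Along a Cauchy sequence the represented functions converge uniformly, so that the limit again
  is a bounded function.\<close>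
definition hlim :: "(nat \<Rightarrow> 'a) \<Rightarrow> 'i \<Rightarrow> complex" where
  "hlim x i = lim (\<lambda>n. h (x n) i)"

text \<open>The representation of the completion.  The choice of a representative does not matter, since equivalent
  Cauchy sequences have the same limit function.\<close>
definition hbar :: "(nat \<Rightarrow> 'a) set \<Rightarrow> 'i \<Rightarrow> complex" where
  "hbar X = hlim (SOME x. x \<in> X)"

lemma hlim_tendsto:
  assumes x: "M.MCauchy x"
  shows "(\<lambda>n. h (x n) i) \<longlonglongrightarrow> hlim x i"
proof -
  have "Cauchy (\<lambda>n. h (x n) i)"
  proof (rule metric_CauchyI)
    fix e :: real assume "e > 0"
    then obtain N where N: "\<And>n n'. n \<ge> N \<Longrightarrow> n' \<ge> N \<Longrightarrow> adist B (x n) (x n') < e"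
      using MCauchyD[OF x] by meson
    have "dist (h (x n) i) (h (x n') i) < e" if "n \<ge> N" "n' \<ge> N" for n n'
      using cmod_h_diff_le[OF MCauchy_mem[OF x] MCauchy_mem[OF x], of n i n'] N[OF that]
      by (simp add: dist_norm)
    then show "\<exists>N. \<forall>m\<ge>N. \<forall>n\<ge>N. dist (h (x m) i) (h (x n) i) < e" by blast
  qed
  then show ?thesis
    unfolding hlim_def using convergent_LIMSEQ_iff Cauchy_convergent_iff by blast
qed

lemma hlim_eqI: "(\<And>i. (\<lambda>n. h (x n) i) \<longlonglongrightarrow> g i) \<Longrightarrow> hlim x = g"
  unfolding hlim_def by (rule ext) (rule limI)

lemma hlim_uniform:
  assumes x: "M.MCauchy x" and e: "e > 0"
  shows "\<exists>N. \<forall>n\<ge>N. \<forall>i. cmod (h (x n) i - hlim x i) \<le> e"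
proof -
  obtain N where N: "\<And>n n'. n \<ge> N \<Longrightarrow> n' \<ge> N \<Longrightarrow> adist B (x n) (x n') < e"
    using MCauchyD[OF x e] by meson
  have "cmod (h (x n) i - hlim x i) \<le> e" if n: "n \<ge> N" for n i
  proof (rule LIMSEQ_le_const2)
    show "(\<lambda>m. cmod (h (x n) i - h (x m) i)) \<longlonglongrightarrow> cmod (h (x n) i - hlim x i)"
      by (intro tendsto_intros hlim_tendsto x)
    have "cmod (h (x n) i - h (x m) i) \<le> e" if "m \<ge> N" for m
      using cmod_h_diff_le[OF MCauchy_mem[OF x] MCauchy_mem[OF x], of n i m] N[OF n that] by simp
    then show "\<exists>N. \<forall>m\<ge>N. cmod (h (x n) i - h (x m) i) \<le> e" by blast
  qed
  then show ?thesis by blast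
qed

lemma hlim_bounded:
  assumes x: "M.MCauchy x"
  shows "bounded (range (hlim x))"
proof -
  obtain N where N: "\<And>i. cmod (h (x N) i - hlim x i) \<le> 1"
    using hlim_uniform[OF x, of 1] by auto
  have "cmod (hlim x i) \<le> anorm B (x N) + 1" for i
    using N[of i] cmod_h_le[OF MCauchy_mem[OF x], of N i]
      norm_triangle_ineq4[of "h (x N) i" "h (x N) i - hlim x i"] by simp
  then show ?thesis by (rule bounded_range_le)
qed

text \<open>The limit function determines the coset: this is both the independence of representatives
  and the injectivity of the representation of the completion.\<close>
lemma sim_iff_hlim:
  assumes x: "M.MCauchy x" and y: "M.MCauchy y"
  shows "C.sim x y \<longleftrightarrow> hlim x = hlim y"
proof
  assume "C.sim x y"
  then have 0: "(\<lambda>n. adist B (x n) (y n)) \<longlonglongrightarrow> 0" by (simp add: C.sim_def)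
  show "hlim x = hlim y"
  proof
    fix i
    have "(\<lambda>n. h (x n) i - h (y n) i) \<longlonglongrightarrow> 0"
      by (rule Lim_null_comparison[OF always_eventually 0])
        (auto intro!: cmod_h_diff_le MCauchy_mem x y)
    moreover have "(\<lambda>n. h (x n) i - h (y n) i) \<longlonglongrightarrow> hlim x i - hlim y i"
      by (intro tendsto_intros hlim_tendsto x y)
    ultimately show "hlim x i = hlim y i"
      using LIMSEQ_unique by fastforce
  qed
next
  assume eq: "hlim x = hlim y"
  show "C.sim x y"
    unfolding C.sim_def
  proof (rule LIMSEQ_I)
    fix r :: real assume r: "r > 0"
    obtain N1 where N1: "\<And>n i. n \<ge> N1 \<Longrightarrow> cmod (h (x n) i - hlim x i) \<le> r / 3"
      using hlim_uniform[OF x, of "r / 3"] r by auto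
    obtain N2 where N2: "\<And>n i. n \<ge> N2 \<Longrightarrow> cmod (h (y n) i - hlim y i) \<le> r / 3"
      using hlim_uniform[OF y, of "r / 3"] r by auto
    have "norm (adist B (x n) (y n) - 0) < r" if "n \<ge> max N1 N2" for n
    proof -
      have "adist B (x n) (y n) \<le> r / 3 + r / 3"
      proof (rule dist_leI)
        fix i
        have "cmod (h (x n) i - h (y n) i)
            = cmod ((h (x n) i - hlim x i) - (h (y n) i - hlim y i))" by (simp add: eq)
        also have "\<dots> \<le> cmod (h (x n) i - hlim x i) + cmod (h (y n) i - hlim y i)"
          by (rule norm_triangle_ineq4)
        also have "\<dots> \<le> r / 3 + r / 3" using N1[of n i] N2[of n i] that by auto
        finally show "cmod (h (x n) i - h (y n) i) \<le> r / 3 + r / 3" .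
      qed (use x y in \<open>auto intro: MCauchy_mem\<close>)
      then show ?thesis using r by simp
    qed
    then show "\<exists>N. \<forall>n\<ge>N. norm (adist B (x n) (y n) - 0) < r" by blast
  qed
qed

lemma norm_tendsto:
  assumes x: "M.MCauchy x"
  shows "(\<lambda>n. anorm B (x n)) \<longlonglongrightarrow> sup_norm (hlim x)"
proof (rule LIMSEQ_I)
  fix r :: real assume r: "r > 0"
  obtain N where N: "\<And>n i. n \<ge> N \<Longrightarrow> cmod (h (x n) i - hlim x i) \<le> r / 2"
    using hlim_uniform[OF x, of "r / 2"] r by auto
  have "norm (anorm B (x n) - sup_norm (hlim x)) < r" if n: "n \<ge> N" for n
  proof -
    have "anorm B (x n) \<le> sup_norm (hlim x) + r / 2"
    proof (rule norm_leI[OF MCauchy_mem[OF x]])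
      fix i
      show "cmod (h (x n) i) \<le> sup_norm (hlim x) + r / 2"
        using N[OF n, of i] sup_norm_ge[OF hlim_bounded[OF x], of i]
          norm_triangle_ineq[of "h (x n) i - hlim x i" "hlim x i"] by simp
    qed
    moreover have "sup_norm (hlim x) \<le> anorm B (x n) + r / 2"
    proof (rule sup_norm_le)
      fix i
      show "cmod (hlim x i) \<le> anorm B (x n) + r / 2"
        using N[OF n, of i] cmod_h_le[OF MCauchy_mem[OF x], of n i]
          norm_triangle_ineq4[of "h (x n) i" "h (x n) i - hlim x i"] by simp
    qed
    ultimately show ?thesis using r by (simp add: abs_le_iff)
  qed
  then show "\<exists>N. \<forall>n\<ge>N. norm (anorm B (x n) - sup_norm (hlim x)) < r" by blast
qed

abbreviation ccl :: "(nat \<Rightarrow> 'a) \<Rightarrow> (nat \<Rightarrow> 'a) set" where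
  "ccl x \<equiv> coset (cauchy_alg B) (cauchy_null B) x"

lemma hbar_ccl:
  assumes x: "M.MCauchy x"
  shows "hbar (ccl x) = hlim x"
proof -
  have "x \<in> ccl x" using x by (simp add: C.coset_iff C.sim_refl cauchy_carrier)
  then have "(SOME z. z \<in> ccl x) \<in> ccl x" by (rule someI[where P = "\<lambda>z. z \<in> ccl x"])
  then have "M.MCauchy (SOME z. z \<in> ccl x)" "C.sim x (SOME z. z \<in> ccl x)"
    using C.coset_iff[of x] x unfolding cauchy_carrier by blast+
  then show ?thesis
    using x sim_iff_hlim by (metis hbar_def)
qed

lemma completion_carrierE:
  assumes "X \<in> carrier (completion B)"
  obtains x where "M.MCauchy x" "X = ccl x"
  using assms by (auto simp: completion_def C.quot_carrier cauchy_carrier)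

lemma ccl_in_completion: "M.MCauchy x \<Longrightarrow> ccl x \<in> carrier (completion B)"
  by (auto simp: completion_def C.quot_carrier cauchy_carrier)

lemma completion_norm:
  assumes x: "M.MCauchy x"
  shows "anorm (completion B) (ccl x) = sup_norm (hlim x)"
proof -
  have const: "lim (\<lambda>n. anorm B (z n)) = sup_norm (hlim x)" if "z \<in> ccl x" for z
    using that x norm_tendsto[of z] sim_iff_hlim[of x z]
    by (auto simp: C.coset_iff cauchy_carrier intro: limI)
  have "x \<in> ccl x" using x by (simp add: C.coset_iff C.sim_refl cauchy_carrier)
  moreover have "(\<lambda>z. lim (\<lambda>n. anorm B (z n))) ` ccl x = (\<lambda>z. sup_norm (hlim x)) ` ccl x"
    by (intro image_cong refl const)
  ultimately have "(\<lambda>z. lim (\<lambda>n. anorm B (z n))) ` ccl x = {sup_norm (hlim x)}"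
    by (simp add: image_constant)
  then show ?thesis by (simp add: completion_def quot_def cauchy_alg_def)
qed

lemma completion_function_alg: "function_alg (completion B) hbar"
proof
  show "inj_on hbar (carrier (completion B))"
  proof (rule inj_onI)
    fix X Y assume "X \<in> carrier (completion B)" "Y \<in> carrier (completion B)" and eq: "hbar X = hbar Y"
    then obtain x y where x: "M.MCauchy x" "X = ccl x" and y: "M.MCauchy y" "Y = ccl y"
      by (meson completion_carrierE)
    then have "C.sim x y" using eq by (simp add: hbar_ccl sim_iff_hlim)
    then show "X = Y" using x y by (simp add: C.coset_eq_iff cauchy_carrier)
  qed
  show "bounded (range (hbar X))" if "X \<in> carrier (completion B)" for X
    using that by (elim completion_carrierE) (simp add: hbar_ccl hlim_bounded)
  have zc: "M.MCauchy (\<lambda>n. azero B)" using C.D_zero_closed by (simp add: cauchy_carrier)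
  have z: "azero (completion B) = ccl (\<lambda>n. azero B)"
    by (simp add: completion_def C.quot_zero)
  show "azero (completion B) \<in> carrier (completion B)"
    unfolding z by (rule ccl_in_completion[OF zc])
  show "hbar (azero (completion B)) = (\<lambda>i. 0)"
    unfolding z hbar_ccl[OF zc] by (rule hlim_eqI) (simp add: h_zero)
  show "anorm (completion B) X = sup_norm (hbar X)" if "X \<in> carrier (completion B)" for X
    using that by (elim completion_carrierE) (simp add: hbar_ccl completion_norm)
  show "aadd (completion B) X Y \<in> carrier (completion B)"
    "hbar (aadd (completion B) X Y) = (\<lambda>i. hbar X i + hbar Y i)"
    "amult (completion B) X Y \<in> carrier (completion B)"
    "hbar (amult (completion B) X Y) = (\<lambda>i. hbar X i * hbar Y i)"
    if XY: "X \<in> carrier (completion B)" "Y \<in> carrier (completion B)" for X Y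
  proof -
    obtain x y where x: "M.MCauchy x" "X = ccl x" and y: "M.MCauchy y" "Y = ccl y"
      using XY by (meson completion_carrierE)
    have a: "aadd (completion B) X Y = ccl (\<lambda>n. aadd B (x n) (y n))"
      using x y by (simp add: completion_def C.quot_add cauchy_carrier)
    have m: "amult (completion B) X Y = ccl (\<lambda>n. amult B (x n) (y n))"
      using x y by (simp add: completion_def C.quot_mult cauchy_carrier)
    have ac: "M.MCauchy (\<lambda>n. aadd B (x n) (y n))" and mc: "M.MCauchy (\<lambda>n. amult B (x n) (y n))"
      using C.D_add_closed C.D_mult_closed x y by (simp_all add: cauchy_carrier)
    show "aadd (completion B) X Y \<in> carrier (completion B)"
      "amult (completion B) X Y \<in> carrier (completion B)"
      unfolding a m using ac mc by (simp_all add: ccl_in_completion)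
    show "hbar (aadd (completion B) X Y) = (\<lambda>i. hbar X i + hbar Y i)"
      unfolding a hbar_ccl[OF ac] using x y
      by (intro hlim_eqI) (auto simp: hbar_ccl h_add MCauchy_mem intro!: tendsto_intros hlim_tendsto)
    show "hbar (amult (completion B) X Y) = (\<lambda>i. hbar X i * hbar Y i)"
      unfolding m hbar_ccl[OF mc] using x y
      by (intro hlim_eqI) (auto simp: hbar_ccl h_mult MCauchy_mem intro!: tendsto_intros hlim_tendsto)
  qed
  show "ascale (completion B) c X \<in> carrier (completion B)"
    "hbar (ascale (completion B) c X) = (\<lambda>i. c * hbar X i)"
    "astar (completion B) X \<in> carrier (completion B)"
    "hbar (astar (completion B) X) = (\<lambda>i. cnj (hbar X i))"
    if X: "X \<in> carrier (completion B)" for c X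
  proof -
    obtain x where x: "M.MCauchy x" "X = ccl x" using X by (meson completion_carrierE)
    have a: "ascale (completion B) c X = ccl (\<lambda>n. ascale B c (x n))"
      using x by (simp add: completion_def C.quot_scale cauchy_carrier)
    have m: "astar (completion B) X = ccl (\<lambda>n. astar B (x n))"
      using x by (simp add: completion_def C.quot_star cauchy_carrier)
    have ac: "M.MCauchy (\<lambda>n. ascale B c (x n))" and mc: "M.MCauchy (\<lambda>n. astar B (x n))"
      using C.D_scale_closed C.D_star_closed x by (simp_all add: cauchy_carrier)
    show "ascale (completion B) c X \<in> carrier (completion B)"
      "astar (completion B) X \<in> carrier (completion B)"
      unfolding a m using ac mc by (simp_all add: ccl_in_completion)
    show "hbar (ascale (completion B) c X) = (\<lambda>i. c * hbar X i)"
      unfolding a hbar_ccl[OF ac] using x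
      by (intro hlim_eqI) (auto simp: hbar_ccl h_scale MCauchy_mem intro!: tendsto_intros hlim_tendsto)
    show "hbar (astar (completion B) X) = (\<lambda>i. cnj (hbar X i))"
      unfolding m hbar_ccl[OF mc] using x
      by (intro hlim_eqI) (auto simp: hbar_ccl h_star MCauchy_mem intro!: tendsto_intros hlim_tendsto)
  qed
qed

lemma MCauchy_const: "b \<in> carrier B \<Longrightarrow> M.MCauchy (\<lambda>_. b)"
  by simp

lemma completion_incl_closed: "b \<in> carrier B \<Longrightarrow> completion_incl B b \<in> carrier (completion B)"
  unfolding completion_incl_def by (rule ccl_in_completion[OF MCauchy_const])

lemma hbar_completion_incl: "b \<in> carrier B \<Longrightarrow> hbar (completion_incl B b) = h b"
  unfolding completion_incl_def by (subst hbar_ccl) (auto intro: hlim_eqI)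

text \<open>The completion is the uniform closure of the represented algebra.  In particular, algebras with the same
  image have completions with the same image, which is how two crossed products over different
  types are compared.\<close>
lemma hbar_image_completion:
  "hbar ` carrier (completion B)
    = {g. \<exists>s. (\<forall>n. s n \<in> h ` carrier B) \<and> uniform_limit UNIV s g sequentially}"
proof (intro Set.set_eqI iffI)
  fix g assume "g \<in> hbar ` carrier (completion B)"
  then obtain x where x: "M.MCauchy x" and g: "g = hlim x"
    by (auto elim!: completion_carrierE simp: hbar_ccl)
  have "uniform_limit UNIV (\<lambda>n. h (x n)) g sequentially"
  proof (rule uniform_limitI)
    fix e :: real assume "e > 0"
    then obtain N where N: "\<And>n i. n \<ge> N \<Longrightarrow> cmod (h (x n) i - hlim x i) \<le> e / 2"
      using hlim_uniform[OF x, of "e / 2"] by auto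
    have "dist (h (x n) i) (g i) < e" if "n \<ge> N" for n i
      using \<open>e > 0\<close> N[OF that, of i] by (simp add: g dist_norm)
    then show "\<forall>\<^sub>F n in sequentially. \<forall>i\<in>UNIV. dist (h (x n) i) (g i) < e"
      by (intro eventually_sequentiallyI[of N]) simp
  qed
  then show "g \<in> {g. \<exists>s. (\<forall>n. s n \<in> h ` carrier B) \<and> uniform_limit UNIV s g sequentially}"
    using MCauchy_mem[OF x] by (intro CollectI exI[of _ "\<lambda>n. h (x n)"]) simp
next
  fix g assume "g \<in> {g. \<exists>s. (\<forall>n. s n \<in> h ` carrier B) \<and> uniform_limit UNIV s g sequentially}"
  then obtain s where s: "\<And>n. s n \<in> h ` carrier B" and lim: "uniform_limit UNIV s g sequentially"
    by auto
  then have "\<forall>n. \<exists>b. b \<in> carrier B \<and> s n = h b" by blast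
  then obtain x where x: "\<And>n. x n \<in> carrier B" and sx: "\<And>n. s n = h (x n)" by metis
  have "M.MCauchy x"
  proof (rule MCauchyI[OF x])
    fix e :: real assume e: "e > 0"
    then obtain N where N: "\<And>n i. n \<ge> N \<Longrightarrow> dist (s n i) (g i) < e / 3"
      using uniform_limitD[OF lim, of "e / 3"] by (auto simp: eventually_sequentially)
    have "adist B (x n) (x n') < e" if "n \<ge> N" "n' \<ge> N" for n n'
    proof -
      have "adist B (x n) (x n') \<le> e / 3 + e / 3"
      proof (rule dist_leI[OF x x])
        fix i
        show "cmod (h (x n) i - h (x n') i) \<le> e / 3 + e / 3"
          using N[OF that(1), of i] N[OF that(2), of i] dist_triangle2[of "s n i" "s n' i" "g i"]
          by (simp add: sx dist_norm)
      qed
      then show ?thesis using e by simp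
    qed
    then show "\<exists>N. \<forall>n\<ge>N. \<forall>n'\<ge>N. adist B (x n) (x n') < e" by blast
  qed
  moreover have "hlim x = g"
    using tendsto_uniform_limitI[OF lim] by (intro hlim_eqI) (auto simp: sx)
  ultimately show "g \<in> hbar ` carrier (completion B)"
    by (metis hbar_ccl ccl_in_completion image_eqI)
qed

lemma completion_map_ccl:
  assumes F: "\<And>x. x \<in> carrier B \<Longrightarrow> F x \<in> carrier B"
    and F_dist: "\<And>x y. x \<in> carrier B \<Longrightarrow> y \<in> carrier B \<Longrightarrow> adist B (F x) (F y) \<le> adist B x y"
    and x: "M.MCauchy x"
  shows "M.MCauchy (\<lambda>n. F (x n))" and "completion_map B F (ccl x) = ccl (\<lambda>n. F (x n))"
proof -
  have FC: "M.MCauchy (\<lambda>n. F (z n))" if "M.MCauchy z" for z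
    by (rule MCauchy_lipschitz[OF that, of _ 1]) (use that in \<open>auto intro: F F_dist MCauchy_mem\<close>)
  then show "M.MCauchy (\<lambda>n. F (x n))" using x .
  show "completion_map B F (ccl x) = ccl (\<lambda>n. F (x n))"
    unfolding completion_map_def
  proof (rule C.UN_coset_eq)
    fix z assume z: "z \<in> carrier (cauchy_alg B)" "C.sim x z"
    have "C.sim (\<lambda>n. F (x n)) (\<lambda>n. F (z n))"
      by (rule C.simI[OF z(2)[unfolded C.sim_def]])
        (use z x in \<open>auto intro!: F_dist simp: cauchy_carrier MCauchy_mem\<close>)
    then show "(\<lambda>n. F (z n)) \<in> carrier (cauchy_alg B) \<and> C.sim (\<lambda>n. F (x n)) (\<lambda>n. F (z n))"
      using z FC by (simp add: cauchy_carrier)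
  qed (use x FC in \<open>simp_all add: cauchy_carrier\<close>)
qed

lemma completion_map_norm_le:
  assumes F: "\<And>x. x \<in> carrier B \<Longrightarrow> F x \<in> carrier B"
    and F_dist: "\<And>x y. x \<in> carrier B \<Longrightarrow> y \<in> carrier B \<Longrightarrow> adist B (F x) (F y) \<le> adist B x y"
    and F_norm: "\<And>x. x \<in> carrier B \<Longrightarrow> anorm B (F x) \<le> anorm B x"
    and X: "X \<in> carrier (completion B)"
  shows "completion_map B F X \<in> carrier (completion B)"
    and "anorm (completion B) (completion_map B F X) \<le> anorm (completion B) X"
proof -
  obtain x where x: "M.MCauchy x" "X = ccl x" using X by (rule completion_carrierE)
  have Fx: "M.MCauchy (\<lambda>n. F (x n))" "completion_map B F (ccl x) = ccl (\<lambda>n. F (x n))"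
    by (rule completion_map_ccl; use F F_dist x in blast)+
  show "completion_map B F X \<in> carrier (completion B)"
    unfolding x Fx(2) by (rule ccl_in_completion[OF Fx(1)])
  have "sup_norm (hlim (\<lambda>n. F (x n))) \<le> sup_norm (hlim x)"
    by (rule LIMSEQ_le[OF norm_tendsto[OF Fx(1)] norm_tendsto[OF x(1)]])
      (auto intro!: F_norm MCauchy_mem x)
  then show "anorm (completion B) (completion_map B F X) \<le> anorm (completion B) X"
    unfolding x Fx(2) by (simp add: completion_norm x Fx(1))
qed

end

section \<open>The circle group and its Haar measure\<close>

abbreviation S1 :: "complex set" where "S1 \<equiv> sphere 0 1"

definition circle :: "complex top_group" where
  "circle = \<lparr>carrier = S1, monoid.mult = (*), one = 1, gtop = top_of_set S1\<rparr>"

lemma circle_simps [simp]: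
  "carrier circle = S1" "monoid.mult circle = (*)" "one circle = 1" "gtop circle = top_of_set S1"
  by (simp_all add: circle_def)

lemma circle_comm_group: "comm_group circle"
proof (rule comm_groupI)
  show "\<exists>y\<in>carrier circle. y \<otimes>\<^bsub>circle\<^esub> x = \<one>\<^bsub>circle\<^esub>" if "x \<in> carrier circle" for x
  proof -
    have "x \<noteq> 0" "cmod x = 1" using that by auto
    then show ?thesis by (intro bexI[of _ "inverse x"]) (simp_all add: norm_inverse)
  qed
qed (auto simp: norm_mult)

lemma circle_inv: "s \<in> S1 \<Longrightarrow> inv\<^bsub>circle\<^esub> s = inverse s"
proof -
  interpret comm_group circle by (rule circle_comm_group)
  assume s: "s \<in> S1"
  then have "s \<noteq> 0" by auto
  then show ?thesis using s by (intro inv_equality) (auto simp: norm_inverse)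
qed

lemma second_countable_euclidean: "second_countable (euclidean :: 'a::second_countable_topology topology)"
proof -
  obtain \<B> :: "'a set set" where "countable \<B>" "topological_basis \<B>"
    using ex_countable_basis by blast
  then show ?thesis
    unfolding second_countable_def by (metis open_openin topological_basisE topological_basis_open)
qed

lemma circle_sc_lca_group: "sc_lca_group circle"
proof -
  interpret comm_group circle by (rule circle_comm_group)
  show ?thesis
  proof
    show "continuous_map (prod_topology (gtop circle) (gtop circle)) (gtop circle) (\<lambda>(x, y). x \<otimes>\<^bsub>circle\<^esub> y)"
      by (auto simp: case_prod_beta norm_mult intro!: continuous_intros)
    have "continuous_map (top_of_set S1) (top_of_set S1) inverse"
      by (auto simp: norm_inverse intro!: continuous_intros)
    then show "continuous_map (gtop circle) (gtop circle) (\<lambda>x. inv\<^bsub>circle\<^esub> x)"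
      unfolding circle_simps by (rule continuous_map_eq) (simp add: circle_inv)
    show "locally_compact_space (gtop circle)"
      by (rule compact_imp_locally_compact_space) (simp add: compact_space_subtopology)
    show "second_countable (gtop circle)"
      by (simp add: second_countable_subtopology second_countable_euclidean)
  qed (auto simp: Hausdorff_space_subtopology)
qed

definition ang :: "real \<Rightarrow> complex" where
  "ang t = cis (2 * pi * t)"

lemma ang_add: "ang (s + t) = ang s * ang t"
  by (simp add: ang_def cis_mult distrib_left)

lemma ang_1 [simp]: "ang 1 = 1"
  by (simp add: ang_def)

lemma ang_mem [simp]: "ang t \<in> S1"
  by (simp add: ang_def)

lemma norm_ang [simp]: "norm (ang t) = 1"
  by (simp add: ang_def)

lemma continuous_ang [continuous_intros]: "continuous_on A ang"
  unfolding ang_def by (auto intro!: continuous_intros)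

lemma ang_surj:
  assumes "s \<in> S1"
  obtains t where "0 \<le> t" "t < 1" "s = ang t"
proof -
  obtain u where u: "s = ang u"
    using assms complex_unimodular_polar[of s] unfolding ang_def
    by (metis cis_conv_exp dist_0_norm mem_sphere mult.commute nonzero_mult_div_cancel_left
        times_divide_eq_right zero_neq_numeral pi_neq_zero mult_eq_0_iff cis.ctr)
  have "ang u = ang (frac u + of_int \<lfloor>u\<rfloor>)" by (simp add: frac_def)
  also have "\<dots> = ang (frac u)"
    unfolding ang_add by (simp add: ang_def cis_multiple_2pi)
  finally have "s = ang (frac u)" using u by simp
  then show ?thesis using that[of "frac u"] by (simp add: frac_lt_1)
qed

text \<open>Normalised arc length, the image of Lebesgue measure on the unit interval.\<close>
definition circ :: "complex measure" where
  "circ = distr (restrict_space lborel {0..<1}) (restrict_space borel S1) ang"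

lemma space_circ [simp]: "space circ = S1"
  by (simp add: circ_def space_restrict_space)

lemma sets_circ: "sets circ = sets (restrict_space borel S1)"
  by (simp add: circ_def)

lemma sets_circ_iff: "E \<in> sets circ \<longleftrightarrow> E \<in> sets borel \<and> E \<subseteq> S1"
  by (auto simp: sets_circ sets_restrict_space_iff borel_closed)
    
lemma ang_measurable: "ang \<in> borel_measurable borel"
  by (intro borel_measurable_continuous_onI continuous_ang)

lemma ang_measurable': "ang \<in> measurable (restrict_space lborel {0..<1}) (restrict_space borel S1)"
  by (rule measurable_restrict_space2)
    (auto intro!: measurable_restrict_space1 simp: ang_measurable)

lemma emeasure_circ:
  assumes "E \<in> sets circ"
  shows "emeasure circ E = emeasure lborel ({0..<1} \<inter> ang -` E)"
proof -
  have "emeasure circ E = emeasure (restrict_space lborel {0..<1}) (ang -` E \<inter> {0..<1})"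
    using assms unfolding circ_def
    by (subst emeasure_distr[OF ang_measurable']) (simp_all add: space_restrict_space)
  also have "\<dots> = emeasure lborel (ang -` E \<inter> {0..<1})"
    by (rule emeasure_restrict_space) auto
  finally show ?thesis by (simp add: Int_commute)
qed

lemma circ_prob: "emeasure circ S1 = 1"
proof -
  have "S1 \<in> sets circ" by (simp add: sets_circ_iff borel_closed)
  moreover have "{0..<1} \<inter> ang -` S1 = {0..<1::real}" by auto
  ultimately show ?thesis by (simp add: emeasure_circ)
qed

interpretation circ: finite_measure circ
  by standard (simp add: circ_prob)

lemma emeasure_lborel_translate:
  fixes P :: "real set"
  assumes "P \<in> sets borel"
  shows "emeasure lborel ((\<lambda>t. t + a) -` P) = emeasure lborel P"
proof -
  have "emeasure lborel P = emeasure (distr lborel borel ((+) a)) P"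
    by (simp add: lborel_distr_plus)
  also have "\<dots> = emeasure lborel ((\<lambda>t. t + a) -` P)"
    using assms by (subst emeasure_distr) (auto simp: vimage_def add.commute)
  finally show ?thesis ..
qed

text \<open>Translation turns the fundamental domain \<open>[0, 1)\<close> into \<open>[-a, 1 - a)\<close>; moving its part to the left
  of \<open>0\<close> by one period restores \<open>[0, 1)\<close>.\<close>
lemma emeasure_periodic:
  fixes P :: "real set"
  assumes P: "P \<in> sets borel" and per: "\<And>t. t + 1 \<in> P \<longleftrightarrow> t \<in> P" and a: "0 \<le> a" "a \<le> 1"
  shows "emeasure lborel ({0..<1} \<inter> (\<lambda>t. t - a) -` P) = emeasure lborel ({0..<1} \<inter> P)"
proof -
  have "emeasure lborel ({0..<1} \<inter> (\<lambda>t. t - a) -` P)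
      = emeasure lborel ((\<lambda>t. t + (-a)) -` ({-a..<1-a} \<inter> P))"
    by (rule arg_cong[where f = "emeasure lborel"]) auto
  also have "\<dots> = emeasure lborel ({-a..<1-a} \<inter> P)"
    using P by (intro emeasure_lborel_translate) auto
  also have "{-a..<1-a} \<inter> P = ({-a..<0} \<inter> P) \<union> ({0..<1-a} \<inter> P)"
    using a by auto
  also have "emeasure lborel \<dots> = emeasure lborel ({-a..<0} \<inter> P) + emeasure lborel ({0..<1-a} \<inter> P)"
    using P by (intro plus_emeasure[symmetric]) auto
  also have "{-a..<0} \<inter> P = (\<lambda>t. t + 1) -` ({1-a..<1} \<inter> P)"
    using per by auto
  also have "emeasure lborel \<dots> = emeasure lborel ({1-a..<1} \<inter> P)"
    using P by (intro emeasure_lborel_translate) auto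
  also have "emeasure lborel ({1-a..<1} \<inter> P) + emeasure lborel ({0..<1-a} \<inter> P)
      = emeasure lborel (({1-a..<1} \<inter> P) \<union> ({0..<1-a} \<inter> P))"
    using P by (intro plus_emeasure) auto
  also have "({1-a..<1} \<inter> P) \<union> ({0..<1-a} \<inter> P) = {0..<1} \<inter> P"
    using a by auto
  finally show ?thesis .
qed

lemma rotate_measurable:
  assumes "s \<in> S1" shows "(\<lambda>r. s * r) \<in> measurable circ circ"
proof -
  have "(\<lambda>r. s * r) \<in> measurable (restrict_space borel S1) (restrict_space borel S1)"
    using assms by (intro measurable_restrict_space3) (auto simp: norm_mult)
  then show ?thesis by (simp add: measurable_cong_sets[OF sets_circ sets_circ])
qed

lemma rotate_image:
  assumes "s \<in> S1" "E \<subseteq> S1"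
  shows "(\<lambda>r. s * r) ` E = (\<lambda>r. inverse s * r) -` E \<inter> S1"
proof -
  have s: "s \<noteq> 0" "cmod s = 1" using assms by auto
  show ?thesis
  proof (intro equalityI subsetI)
    fix x assume "x \<in> (\<lambda>r. s * r) ` E"
    then obtain r where "x = s * r" "r \<in> E" by blast
    then show "x \<in> (\<lambda>r. inverse s * r) -` E \<inter> S1"
      using s assms(2) by (auto simp: norm_mult mult.assoc[symmetric])
  next
    fix x assume x: "x \<in> (\<lambda>r. inverse s * r) -` E \<inter> S1"
    have "x = s * (inverse s * x)" using s by (simp add: mult.assoc[symmetric])
    then show "x \<in> (\<lambda>r. s * r) ` E" using x by blast
  qed
qed

lemma circ_invariant:
  assumes s: "s \<in> S1" and E: "E \<in> sets circ"
  shows "emeasure circ ((\<lambda>r. s * r) ` E) = emeasure circ E"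
proof -
  have ES: "E \<subseteq> S1" "E \<in> sets borel" using E by (auto simp: sets_circ_iff)
  obtain a where a: "0 \<le> a" "a < 1" "s = ang a" using ang_surj[OF s] .
  have sE: "(\<lambda>r. s * r) ` E \<in> sets circ"
    using measurable_sets[OF rotate_measurable E, of "inverse s"] s
    by (simp add: rotate_image[OF s ES(1)] norm_inverse)
  have "s \<noteq> 0" using s by auto
  then have "ang (t - a) = inverse s * ang t" for t
    using ang_add[of "t - a" a] a by (simp add: field_simps)
  then have eq: "ang -` ((\<lambda>r. s * r) ` E) = (\<lambda>t. t - a) -` (ang -` E)"
    unfolding rotate_image[OF s ES(1)] by (auto simp del: mem_sphere)
  have "ang -` E \<in> sets borel"
    using measurable_sets[OF ang_measurable ES(2)] by simp
  moreover have "t + 1 \<in> ang -` E \<longleftrightarrow> t \<in> ang -` E" for t by (simp add: ang_add)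
  ultimately show ?thesis
    unfolding emeasure_circ[OF E] emeasure_circ[OF sE] eq
    using a by (intro emeasure_periodic) auto
qed

lemma sets_circ_sigma: "sets circ = sigma_sets S1 {U. openin (top_of_set S1) U}"
proof -
  have "sets circ = (\<inter>) S1 ` sigma_sets UNIV {S. open S}"
    by (simp add: sets_circ sets_restrict_space borel_def)
  also have "\<dots> = sigma_sets S1 ((\<inter>) S1 ` {S. open S})"
    using borel_closed[of S1] by (intro sigma_sets_Int) (simp_all add: borel_def)
  also have "(\<inter>) S1 ` {S. open S} = {U. openin (top_of_set S1) U}"
    by (auto simp: openin_open)
  finally show ?thesis .
qed

lemma circ_haar: "haar_measure circle circ"
proof -
  have "emeasure circ K < \<infinity>" for K
    using circ.emeasure_finite[of K] by (simp add: less_top[symmetric])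
  then show ?thesis
    unfolding haar_measure_def using circ_invariant circ_prob by (simp add: sets_circ_sigma)
qed

section \<open>Fourier coefficients on the circle\<close>


interpretation circ2: pair_sigma_finite circ circ ..

lemma continuous_circ_measurable:
  "continuous_on S1 f \<Longrightarrow> (f :: complex \<Rightarrow> 'b::topological_space) \<in> borel_measurable circ"
  using borel_measurable_continuous_on_restrict[of S1 f]
  by (simp add: measurable_cong_sets[OF sets_circ refl])

lemma continuous_S1_bounded:
  assumes "continuous_on S1 (f :: complex \<Rightarrow> 'b::real_normed_vector)"
  obtains K where "K \<ge> 0" "\<And>s. s \<in> S1 \<Longrightarrow> norm (f s) \<le> K"
proof -
  have "bounded (f ` S1)"
    by (intro compact_imp_bounded compact_continuous_image assms) simp
  then obtain K where K: "\<And>s. s \<in> S1 \<Longrightarrow> norm (f s) \<le> K" unfolding bounded_iff by blast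
  then have "norm (f 1) \<le> K" by simp
  then have "K \<ge> 0" using norm_ge_zero[of "f 1"] by linarith
  then show ?thesis using K that by blast
qed

lemma bounded_circ_integrable:
  fixes f :: "complex \<Rightarrow> 'b::{banach,second_countable_topology}"
  assumes "f \<in> borel_measurable circ" "\<And>s. s \<in> S1 \<Longrightarrow> norm (f s) \<le> K"
  shows "integrable circ f"
  by (rule circ.integrable_const_bound[of _ K]) (use assms in auto)

lemma continuous_circ_integrable:
  fixes f :: "complex \<Rightarrow> 'b::{banach,second_countable_topology}"
  assumes "continuous_on S1 f"
  shows "integrable circ f"
proof -
  obtain K where "\<And>s. s \<in> S1 \<Longrightarrow> norm (f s) \<le> K" using continuous_S1_bounded[OF assms] by blast
  then show ?thesis using continuous_circ_measurable[OF assms] bounded_circ_integrable by blast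
qed

lemma measure_circ [simp]: "measure circ S1 = 1"
  by (simp add: measure_def circ_prob)

lemma circ_integral_norm_le:
  fixes f :: "complex \<Rightarrow> 'b::{banach,second_countable_topology}"
  assumes "integrable circ f" "\<And>s. s \<in> S1 \<Longrightarrow> norm (f s) \<le> K"
  shows "norm (\<integral>s. f s \<partial>circ) \<le> K"
proof -
  have "norm (\<integral>s. f s \<partial>circ) \<le> (\<integral>s. norm (f s) \<partial>circ)"
    by (rule integral_norm_bound)
  also have "\<dots> \<le> (\<integral>s. K \<partial>circ)"
    by (intro integral_mono) (use assms in auto)
  finally show ?thesis by simp
qed

lemma distr_rotate:
  assumes s: "s \<in> S1" shows "distr circ circ (\<lambda>r. s * r) = circ"
proof (rule measure_eqI)
  fix E assume "E \<in> sets (distr circ circ (\<lambda>r. s * r))"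
  then have E: "E \<in> sets circ" by simp
  have inv_mem: "inverse s \<in> S1" using s by (simp add: norm_inverse)
  have ES: "E \<subseteq> S1" using E by (simp add: sets_circ_iff)
  have "emeasure (distr circ circ (\<lambda>r. s * r)) E = emeasure circ ((\<lambda>r. s * r) -` E \<inter> S1)"
    using E rotate_measurable[OF s] by (simp add: emeasure_distr)
  also have "(\<lambda>r. s * r) -` E \<inter> S1 = (\<lambda>r. inverse s * r) ` E"
    using rotate_image[OF inv_mem ES] by simp
  also have "emeasure circ \<dots> = emeasure circ E" by (rule circ_invariant[OF inv_mem E])
  finally show "emeasure (distr circ circ (\<lambda>r. s * r)) E = emeasure circ E" .
qed simp

lemma circ_integral_rotate:
  fixes f :: "complex \<Rightarrow> 'b::{banach,second_countable_topology}"
  assumes "s \<in> S1" "f \<in> borel_measurable circ"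
  shows "(\<integral>r. f (s * r) \<partial>circ) = (\<integral>r. f r \<partial>circ)"
  using integral_distr[OF rotate_measurable[OF assms(1)] assms(2)] distr_rotate[OF assms(1)] by simp

lemma measurable_circ_comp:
  assumes "continuous_on S1 f" "g \<in> borel_measurable M" "\<And>x. x \<in> space M \<Longrightarrow> g x \<in> S1"
  shows "(\<lambda>x. f (g x)) \<in> borel_measurable M"
proof -
  have "g \<in> measurable M (restrict_space borel S1)"
    using assms by (intro measurable_restrict_space2) auto
  then show ?thesis
    using measurable_comp[OF _ borel_measurable_continuous_on_restrict[OF assms(1)]]
    by (simp add: comp_def)
qed

lemma id_borel_circ [measurable]: "(\<lambda>s. s) \<in> borel_measurable circ"
  by (rule continuous_circ_measurable) (rule continuous_on_id)

lemma circ_Fubini: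
  fixes F :: "complex \<Rightarrow> complex \<Rightarrow> complex"
  assumes "case_prod F \<in> borel_measurable (circ \<Otimes>\<^sub>M circ)"
    and "\<And>r s. r \<in> S1 \<Longrightarrow> s \<in> S1 \<Longrightarrow> cmod (F r s) \<le> K"
  shows "(\<integral>s. (\<integral>r. F r s \<partial>circ) \<partial>circ) = (\<integral>r. (\<integral>s. F r s \<partial>circ) \<partial>circ)"
proof (rule circ2.Fubini_integral)
  have fin: "finite_measure (circ \<Otimes>\<^sub>M circ)"
    by (rule finite_measureI)
      (simp add: space_pair_measure circ.emeasure_pair_measure_Times sets_circ_iff borel_closed circ_prob)
  show "integrable (circ \<Otimes>\<^sub>M circ) (case_prod F)"
    by (rule finite_measure.integrable_const_bound[OF fin, of _ K])
      (use assms in \<open>auto simp: space_pair_measure\<close>)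
qed

lemma S1_nonzero: "s \<in> S1 \<Longrightarrow> s \<noteq> 0"
  by auto

text \<open>Integrate \<open>f (s / r)\<close> over both variables.  By translation invariance the inner integral
  over \<open>s\<close> is the integral of \<open>f\<close>, while the inner integral over \<open>r\<close> is the integral of \<open>f\<close> composed
  with inversion; the two orders of integration agree.\<close>
lemma circ_integral_inverse:
  assumes f: "continuous_on S1 (f :: complex \<Rightarrow> complex)"
  shows "(\<integral>s. f (inverse s) \<partial>circ) = (\<integral>s. f s \<partial>circ)"
proof -
  obtain K where K: "\<And>s. s \<in> S1 \<Longrightarrow> norm (f s) \<le> K" using continuous_S1_bounded[OF f] by blast
  have fi: "continuous_on S1 (\<lambda>s. f (inverse s))"
    by (rule continuous_on_compose2[OF f]) (auto intro!: continuous_intros simp: norm_inverse)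
  have "(\<integral>s. (\<integral>r. f (s * inverse r) \<partial>circ) \<partial>circ) = (\<integral>r. (\<integral>s. f (s * inverse r) \<partial>circ) \<partial>circ)"
    by (rule circ_Fubini[of "\<lambda>r s. f (s * inverse r)" K], unfold split_beta, rule measurable_circ_comp[OF f])
      (auto simp: space_pair_measure norm_mult norm_inverse intro!: K)
  moreover have inner_r: "(\<integral>r. f (s * inverse r) \<partial>circ) = (\<integral>r. f (inverse r) \<partial>circ)" if s: "s \<in> S1" for s
  proof -
    have "inverse s \<in> S1" using s by (simp add: norm_inverse)
    from circ_integral_rotate[OF this continuous_circ_measurable[OF fi]]
    show ?thesis by simp
  qed
  moreover have inner_s: "(\<integral>s. f (s * inverse r) \<partial>circ) = (\<integral>s. f s \<partial>circ)" if r: "r \<in> S1" for r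
  proof -
    have "inverse r \<in> S1" using r by (simp add: norm_inverse)
    from circ_integral_rotate[OF this continuous_circ_measurable[OF f]]
    show ?thesis by (simp add: mult.commute)
  qed
  moreover have "(\<integral>s. (\<integral>r. f (s * inverse r) \<partial>circ) \<partial>circ) = (\<integral>s. (\<integral>r. f (inverse r) \<partial>circ) \<partial>circ)"
    by (rule Bochner_Integration.integral_cong) (simp_all add: inner_r)
  moreover have "(\<integral>r. (\<integral>s. f (s * inverse r) \<partial>circ) \<partial>circ) = (\<integral>r. (\<integral>s. f s \<partial>circ) \<partial>circ)"
    by (rule Bochner_Integration.integral_cong) (simp_all add: inner_s)
  ultimately show ?thesis by simp
qed

text \<open>The exponent is \<open>n\<close> and not the customary \<open>-n\<close>.  This relabels the coefficients and makes the
  \<open>n\<close>-th coefficient the integrated form of the character \<open>s \<mapsto> s\<^sup>n\<close>.\<close>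
definition fourier :: "(complex \<Rightarrow> complex) \<Rightarrow> int \<Rightarrow> complex" where
  "fourier f n = (\<integral>s. f s * s powi n \<partial>circ)"

lemma continuous_powi_S1 [continuous_intros]: "continuous_on S1 (\<lambda>s::complex. s powi n)"
  by (intro continuous_intros) auto

lemma norm_powi_S1: "s \<in> S1 \<Longrightarrow> cmod (s powi n) = 1"
  by (simp add: norm_power_int)

lemma cnj_S1: "s \<in> S1 \<Longrightarrow> cnj s = inverse s"
  by (auto simp: complex_eq_iff inverse_complex.simps cmod_def)

lemma cnj_powi_S1: "s \<in> S1 \<Longrightarrow> cnj (s powi m) = s powi (- m)"
  by (simp add: cnj_S1 power_int_minus power_int_inverse del: mem_sphere)

text \<open>For \<open>n \<noteq> 0\<close>, the rotation by a point whose \<open>n\<close>-th power is \<open>-1\<close> changes the sign of the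
  integrand, so the integral equals its negative.\<close>
lemma powi_orthogonal: "(\<integral>s. s powi n \<partial>circ) = (if n = 0 then 1 else 0)"
proof (cases "n = 0")
  case False
  \<comment> \<open>Half of an \<open>n\<close>-th of a full turn.\<close>
  define t where "t = ang (1 / (2 * of_int n))"
  have "t powi n = cis pi"
    using False by (simp add: t_def ang_def cis_power_int)
  then have tn: "t powi n = -1" by simp
  have t: "t \<in> S1" unfolding t_def by (rule ang_mem)
  have "(\<integral>s. s powi n \<partial>circ) = (\<integral>s. (t * s) powi n \<partial>circ)"
    using circ_integral_rotate[OF t, of "\<lambda>s. s powi n"]
    by (simp add: continuous_circ_measurable continuous_intros)
  also have "\<dots> = - (\<integral>s. s powi n \<partial>circ)"
    by (simp add: power_int_mult_distrib tn)
  finally show ?thesis using False by simp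
qed simp

lemma fourier_powi: "fourier (\<lambda>s. s powi m) n = (if m + n = 0 then 1 else 0)"
proof -
  have "fourier (\<lambda>s. s powi m) n = (\<integral>s. s powi (m + n) \<partial>circ)"
    unfolding fourier_def
    by (intro Bochner_Integration.integral_cong refl) (use S1_nonzero in \<open>simp add: power_int_add del: mem_sphere\<close>)
  then show ?thesis by (simp add: powi_orthogonal)
qed

lemma fourier_cong: "(\<And>s. s \<in> S1 \<Longrightarrow> f s = g s) \<Longrightarrow> fourier f = fourier g"
  unfolding fourier_def by (intro ext Bochner_Integration.integral_cong) auto

lemma fourier_integrable: "continuous_on S1 f \<Longrightarrow> integrable circ (\<lambda>s. f s * s powi n)"
  by (intro continuous_circ_integrable continuous_intros) auto

lemma fourier_add:
  "\<lbrakk>continuous_on S1 f; continuous_on S1 g\<rbrakk> \<Longrightarrow> fourier (\<lambda>s. f s + g s) n = fourier f n + fourier g n"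
  unfolding fourier_def by (simp add: distrib_right fourier_integrable)

lemma fourier_diff:
  "\<lbrakk>continuous_on S1 f; continuous_on S1 g\<rbrakk> \<Longrightarrow> fourier (\<lambda>s. f s - g s) n = fourier f n - fourier g n"
  unfolding fourier_def by (simp add: left_diff_distrib fourier_integrable)

lemma fourier_scale: "fourier (\<lambda>s. c * f s) n = c * fourier f n"
  unfolding fourier_def by (simp add: mult.assoc)

lemma fourier_le:
  assumes "continuous_on S1 f" "\<And>s. s \<in> S1 \<Longrightarrow> cmod (f s) \<le> K"
  shows "cmod (fourier f n) \<le> K"
  unfolding fourier_def
  by (rule circ_integral_norm_le[OF fourier_integrable[OF assms(1)]])
    (use assms norm_powi_S1 in \<open>auto simp: norm_mult norm_power_int\<close>)

lemma fourier_bounded: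
  assumes "continuous_on S1 f"
  shows "bounded (range (fourier f))"
proof -
  obtain K where "\<And>s. s \<in> S1 \<Longrightarrow> cmod (f s) \<le> K" using continuous_S1_bounded[OF assms] by blast
  then have "cmod (fourier f n) \<le> K" for n using fourier_le[OF assms] by blast
  then show ?thesis by (auto simp: bounded_iff)
qed

lemma fourier_sum:
  assumes "finite S"
  shows "fourier (\<lambda>s. \<Sum>m\<in>S. c m * s powi m) n = (if -n \<in> S then c (-n) else 0)"
proof -
  have "fourier (\<lambda>s. \<Sum>m\<in>S. c m * s powi m) n = (\<Sum>m\<in>S. c m * fourier (\<lambda>s. s powi m) n)"
    using assms
  proof (induction S)
    case (insert x S)
    have "continuous_on S1 (\<lambda>s. c x * s powi x)" "continuous_on S1 (\<lambda>s. \<Sum>m\<in>S. c m * s powi m)"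
      by (intro continuous_intros)+
    then show ?case using insert by (simp add: fourier_add fourier_scale)
  qed (simp add: fourier_def)
  also have "\<dots> = (\<Sum>m\<in>S. if m = -n then c m else 0)"
    by (intro sum.cong) (auto simp: fourier_powi)
  also have "\<dots> = (if -n \<in> S then c (-n) else 0)" using assms by simp
  finally show ?thesis .
qed

definition trig :: "(complex \<Rightarrow> complex) \<Rightarrow> bool" where
  "trig p \<longleftrightarrow> (\<exists>S c. finite S \<and> (\<forall>s\<in>S1. p s = (\<Sum>n\<in>S. c n * s powi (n::int))))"

lemma trigE:
  assumes "trig p"
  obtains S c where "finite S" "\<And>s. s \<in> S1 \<Longrightarrow> p s = (\<Sum>n\<in>S. c n * s powi (n::int))"
  using assms unfolding trig_def by blast

lemma trig_monomial: "trig (\<lambda>s. c * s powi n)"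
  unfolding trig_def by (rule exI[of _ "{n}"], rule exI[of _ "\<lambda>_. c"]) simp

lemma trig_cong: "trig p \<Longrightarrow> (\<And>s. s \<in> S1 \<Longrightarrow> q s = p s) \<Longrightarrow> trig q"
  unfolding trig_def by metis

lemma trig_add:
  assumes "trig p" "trig q" shows "trig (\<lambda>s. p s + q s)"
proof -
  obtain S c where S: "finite S" "\<And>s. s \<in> S1 \<Longrightarrow> p s = (\<Sum>n\<in>S. c n * s powi n)"
    using trigE[OF assms(1)] by blast
  obtain R d where R: "finite R" "\<And>s. s \<in> S1 \<Longrightarrow> q s = (\<Sum>n\<in>R. d n * s powi n)"
    using trigE[OF assms(2)] by blast
  have "p s + q s = (\<Sum>n\<in>S \<union> R. ((if n \<in> S then c n else 0) + (if n \<in> R then d n else 0)) * s powi n)"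
    if "s \<in> S1" for s
  proof -
    have "p s = (\<Sum>n\<in>S \<union> R. (if n \<in> S then c n else 0) * s powi n)"
      unfolding S(2)[OF that] by (rule sum.mono_neutral_cong_left) (use S R in auto)
    moreover have "q s = (\<Sum>n\<in>S \<union> R. (if n \<in> R then d n else 0) * s powi n)"
      unfolding R(2)[OF that] by (rule sum.mono_neutral_cong_left) (use S R in auto)
    ultimately show ?thesis by (simp add: distrib_right sum.distrib)
  qed
  then show ?thesis unfolding trig_def using S(1) R(1)
    by (intro exI[of _ "S \<union> R"]
        exI[of _ "\<lambda>n. (if n \<in> S then c n else 0) + (if n \<in> R then d n else 0)"]) simp
qed

lemma trig_sum: "finite A \<Longrightarrow> (\<And>a. a \<in> A \<Longrightarrow> trig (p a)) \<Longrightarrow> trig (\<lambda>s. \<Sum>a\<in>A. p a s)"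
proof (induction A rule: finite_induct)
  case empty
  then show ?case using trig_monomial[of 0 0] by simp
next
  case (insert x F)
  then show ?case using trig_add[of "p x" "\<lambda>s. \<Sum>a\<in>F. p a s"] by simp
qed

lemma trig_mult:
  assumes "trig p" "trig q" shows "trig (\<lambda>s. p s * q s)"
proof -
  obtain S c where S: "finite S" "\<And>s. s \<in> S1 \<Longrightarrow> p s = (\<Sum>n\<in>S. c n * s powi n)"
    using trigE[OF assms(1)] by blast
  obtain R d where R: "finite R" "\<And>s. s \<in> S1 \<Longrightarrow> q s = (\<Sum>n\<in>R. d n * s powi n)"
    using trigE[OF assms(2)] by blast
  have "trig (\<lambda>s. \<Sum>n\<in>S. \<Sum>m\<in>R. c n * d m * s powi (n + m))"
    by (intro trig_sum S R trig_monomial)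
  then show ?thesis
  proof (rule trig_cong)
    fix s assume s: "s \<in> S1"
    then have "s \<noteq> 0" by auto
    then show "p s * q s = (\<Sum>n\<in>S. \<Sum>m\<in>R. c n * d m * s powi (n + m))"
      by (simp add: S(2)[OF s] R(2)[OF s] sum_product power_int_add algebra_simps)
  qed
qed

text \<open>On the circle the conjugate of \<open>s\<close> is its inverse, so the real and imaginary parts of \<open>s\<close> are trigonometric
  polynomials.  This reduces density to the Stone-Weierstrass theorem for real polynomial functions.\<close>
lemma trig_real_polynomial: "real_polynomial_function g \<Longrightarrow> trig (\<lambda>s. complex_of_real (g s))"
proof (induction rule: real_polynomial_function.induct)
  case (linear f)
  interpret bounded_linear f by (rule linear)
  define a b where "a = f 1" and "b = f \<i>"
  have f: "f z = Re z * a + Im z * b" for z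
  proof -
    have "f z = f (Re z *\<^sub>R 1 + Im z *\<^sub>R \<i>)" 
      by (rule arg_cong[of _ _ f]) (simp add: complex_eq_iff)
    also have "\<dots> = Re z * a + Im z * b" by (simp only: add scaleR a_def b_def real_scaleR_def)
    finally show ?thesis .
  qed
  \<comment> \<open>With \<open>f z = a Re z + b Im z\<close>, expand \<open>Re\<close> and \<open>Im\<close> by \<open>s\<close> and its inverse.\<close>
  have "trig (\<lambda>s. (a / 2 - \<i> * b / 2) * s powi 1 + (a / 2 + \<i> * b / 2) * s powi (-1))"
    by (intro trig_add trig_monomial)
  then show ?case
  proof (rule trig_cong)
    fix s assume "s \<in> S1"
    then have "inverse s = cnj s" by (simp add: cnj_S1)
    then show "complex_of_real (f s) = (a / 2 - \<i> * b / 2) * s powi 1 + (a / 2 + \<i> * b / 2) * s powi (-1)"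
      by (simp add: f power_int_minus complex_eq_iff algebra_simps)
  qed
next
  case (const c)
  then show ?case using trig_monomial[of "of_real c" 0] by simp
next
  case (add f g)
  then show ?case using trig_add by simp
next
  case (mult f g)
  then show ?case using trig_mult by simp
qed

lemma trig_dense:
  assumes f: "continuous_on S1 f" and e: "e > 0"
  obtains p where "trig p" "\<And>s. s \<in> S1 \<Longrightarrow> cmod (f s - p s) < e"
proof -
  have c: "continuous_on S1 (\<lambda>s. Re (f s))" "continuous_on S1 (\<lambda>s. Im (f s))"
    by (intro continuous_intros f)+
  have e2: "e / 2 > 0" using e by simp
  obtain g where g: "real_polynomial_function g" "\<And>s. s \<in> S1 \<Longrightarrow> \<bar>Re (f s) - g s\<bar> < e / 2"
    by (rule Stone_Weierstrass_real_polynomial_function[OF compact_sphere c(1) e2]) blast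
  obtain k where k: "real_polynomial_function k" "\<And>s. s \<in> S1 \<Longrightarrow> \<bar>Im (f s) - k s\<bar> < e / 2"
    by (rule Stone_Weierstrass_real_polynomial_function[OF compact_sphere c(2) e2]) blast
  have "trig (\<lambda>s. of_real (g s) + \<i> * s powi 0 * of_real (k s))"
    by (intro trig_add trig_mult trig_monomial trig_real_polynomial g k)
  moreover have "cmod (f s - (of_real (g s) + \<i> * s powi 0 * of_real (k s))) < e" if "s \<in> S1" for s
    using cmod_le[of "f s - (of_real (g s) + \<i> * of_real (k s))"] g(2)[OF that] k(2)[OF that] by simp
  ultimately show ?thesis using that by blast
qed

lemma trig_continuous: "trig p \<Longrightarrow> continuous_on S1 p"
proof -
  assume "trig p"
  then obtain S c where S: "finite S" "\<And>s. s \<in> S1 \<Longrightarrow> p s = (\<Sum>n\<in>S. c n * s powi n)"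
    unfolding trig_def by blast
  have "continuous_on S1 (\<lambda>s. \<Sum>n\<in>S. c n * s powi n)" by (intro continuous_intros)
  then show "continuous_on S1 p" by (subst continuous_on_cong[OF refl S(2)])
qed

text \<open>Haar measure has full support: if \<open>g\<close> did not vanish at a point, it would not vanish on an arc, and
  an arc has positive measure.\<close>
lemma circ_AE_zero:
  assumes g: "continuous_on S1 g" and AE: "AE s in circ. g s = (0::real)" and s: "s \<in> S1"
  shows "g s = 0"
proof (rule ccontr)
  assume nz: "g s \<noteq> 0"
  obtain t where t: "0 \<le> t" "t < 1" "s = ang t" using ang_surj[OF s] .
  have gm: "g \<in> borel_measurable circ" by (rule continuous_circ_measurable[OF g])
  have "{x \<in> space circ. g x = 0} \<in> sets circ" using gm by measurable
  then have "{x \<in> space (restrict_space borel S1). g x = 0} \<in> sets (restrict_space borel S1)"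
    by (simp add: sets_circ space_restrict_space)
  then have "AE t in restrict_space lborel {0..<1}. g (ang t) = 0"
    using AE[unfolded circ_def] AE_distr_iff[OF ang_measurable', of "\<lambda>x. g x = 0"] by blast
  then have AE': "AE t in lborel. t \<in> {0..<1} \<longrightarrow> g (ang t) = 0"
    by (subst (asm) AE_restrict_space_iff) auto
  have "continuous_on UNIV (\<lambda>t. g (ang t))"
    by (rule continuous_on_compose2[OF g continuous_ang]) auto
  then have "open ((\<lambda>t. g (ang t)) -` (-{0}))"
    by (intro open_vimage) auto
  moreover have "t \<in> (\<lambda>t. g (ang t)) -` (-{0})" using nz t by simp
  ultimately obtain d where d: "d > 0" "ball t d \<subseteq> (\<lambda>t. g (ang t)) -` (-{0})"
    using open_contains_ball by metis
  define u where "u = min (t + d) 1"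
  have u: "t < u" "u \<le> 1" "{t..<u} \<subseteq> ball t d"
    using d t by (auto simp: u_def dist_real_def)
  have "AE x in lborel. x \<notin> {t..<u}"
    using AE' by eventually_elim (use u d t in force)
  then have "emeasure lborel {t..<u} = 0"
    by (subst (asm) AE_iff_measurable[where N = "{t..<u}"]) auto
  then show False using u by simp
qed

text \<open>If all coefficients vanish, \<open>f\<close> is orthogonal to every trigonometric polynomial.  Approximating the
  conjugate of \<open>f\<close> by these shows that the integral of \<open>\<bar>f\<bar>\<^sup>2\<close> is zero.\<close>
lemma fourier_inj:
  assumes f: "continuous_on S1 f" and 0: "\<And>n. fourier f n = 0" and s: "s \<in> S1"
  shows "f s = 0"
proof -
  obtain K where K: "K \<ge> 0" "\<And>s. s \<in> S1 \<Longrightarrow> cmod (f s) \<le> K" using continuous_S1_bounded[OF f] by blast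
  have cf: "continuous_on S1 (\<lambda>s. cnj (f s))" by (intro continuous_intros f)
  have orth: "(\<integral>s. f s * p s \<partial>circ) = 0" if p: "trig p" for p
  proof -
    obtain S c where S: "finite S" "\<And>s. s \<in> S1 \<Longrightarrow> p s = (\<Sum>n\<in>S. c n * s powi n)"
      using trigE[OF p] by blast
    have "(\<integral>s. f s * p s \<partial>circ) = (\<integral>s. (\<Sum>n\<in>S. c n * (f s * s powi n)) \<partial>circ)"
      by (intro Bochner_Integration.integral_cong) (auto simp: S sum_distrib_left algebra_simps)
    also have "\<dots> = (\<Sum>n\<in>S. c n * fourier f n)"
      unfolding fourier_def using fourier_integrable[OF f] by (subst Bochner_Integration.integral_sum) auto
    finally show ?thesis by (simp add: 0)
  qed
  have int: "integrable circ (\<lambda>s. f s * cnj (f s))"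
    by (intro continuous_circ_integrable continuous_intros f)
  have "cmod (\<integral>s. f s * cnj (f s) \<partial>circ) \<le> 0 + e" if e: "e > 0" for e
  proof -
    have eK: "e / (K + 1) > 0" using e K(1) by simp
    obtain p where p: "trig p" "\<And>s. s \<in> S1 \<Longrightarrow> cmod (cnj (f s) - p s) < e / (K + 1)"
      using trig_dense[OF cf eK] by blast
    have pint: "integrable circ (\<lambda>s. f s * p s)"
      by (intro continuous_circ_integrable continuous_intros f trig_continuous p)
    have "(\<integral>s. f s * cnj (f s) \<partial>circ) = (\<integral>s. f s * cnj (f s) - f s * p s \<partial>circ)"
      using orth[OF p(1)] int pint by simp
    also have "cmod \<dots> \<le> e"
    proof (rule circ_integral_norm_le)
      show "integrable circ (\<lambda>s. f s * cnj (f s) - f s * p s)" using int pint by simp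
      fix s assume s: "s \<in> S1"
      have "cmod (f s * cnj (f s) - f s * p s) = cmod (f s) * cmod (cnj (f s) - p s)"
        by (simp add: norm_mult flip: right_diff_distrib)
      also have "\<dots> \<le> (K + 1) * (e / (K + 1))"
        using K(2)[OF s] p(2)[OF s] K(1) by (intro mult_mono) auto
      also have "\<dots> = e" using K by simp
      finally show "cmod (f s * cnj (f s) - f s * p s) \<le> e" .
    qed
    finally show ?thesis by simp
  qed
  then have "(\<integral>s. f s * cnj (f s) \<partial>circ) = 0"
    using field_le_epsilon[of "cmod (\<integral>s. f s * cnj (f s) \<partial>circ)" 0] by simp
  moreover have "(\<integral>s. f s * cnj (f s) \<partial>circ) = of_real (\<integral>s. (cmod (f s))\<^sup>2 \<partial>circ)"
    by (simp add: complex_norm_square[symmetric] flip: integral_complex_of_real)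
  ultimately have 1: "(\<integral>s. (cmod (f s))\<^sup>2 \<partial>circ) = 0" by simp
  have cont: "continuous_on S1 (\<lambda>s. (cmod (f s))\<^sup>2)" by (intro continuous_intros f)
  then have "AE s in circ. (cmod (f s))\<^sup>2 = 0"
    using 1 by (subst (asm) integral_nonneg_eq_0_iff_AE) (auto intro: continuous_circ_integrable)
  then have "(cmod (f s))\<^sup>2 = 0" by (rule circ_AE_zero[OF cont _ s])
  then show ?thesis by simp
qed

definition conv :: "(complex \<Rightarrow> complex) \<Rightarrow> (complex \<Rightarrow> complex) \<Rightarrow> complex \<Rightarrow> complex" where
  "conv f g s = (\<integral>r. f r * g (inverse r * s) \<partial>circ)"

lemma continuous_translate:
  assumes g: "continuous_on S1 (g :: complex \<Rightarrow> complex)" and r: "s \<in> S1"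
  shows "continuous_on S1 (\<lambda>r. g (inverse r * s))"
  by (rule continuous_on_compose2[OF g]) (use r in \<open>auto intro!: continuous_intros simp: norm_inverse norm_mult\<close>)

text \<open>Uniform continuity of \<open>g\<close>, together with the isometry of rotations, bounds the variation of the
  integrand independently of the integration variable.\<close>
lemma continuous_conv:
  assumes f: "continuous_on S1 f" and g: "continuous_on S1 g"
  shows "continuous_on S1 (conv f g)"
proof -
  obtain K where K: "K \<ge> 0" "\<And>s. s \<in> S1 \<Longrightarrow> cmod (f s) \<le> K" using continuous_S1_bounded[OF f] by blast
  have unif: "uniformly_continuous_on S1 g" by (rule compact_uniformly_continuous[OF g]) simp
  show ?thesis
    unfolding continuous_on_iff
  proof (intro ballI allI impI)
    fix s and e :: real assume s: "s \<in> S1" and e: "e > 0"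
    have "e / (2 * (K + 1)) > 0" using e K by simp
    then obtain d where d: "d > 0"
      "\<And>x y. x \<in> S1 \<Longrightarrow> y \<in> S1 \<Longrightarrow> dist y x < d \<Longrightarrow> dist (g y) (g x) < e / (2 * (K + 1))"
      using unif unfolding uniformly_continuous_on_def by metis
    have "dist (conv f g t) (conv f g s) < e" if t: "t \<in> S1" "dist t s < d" for t
    proof -
      have int: "integrable circ (\<lambda>r. f r * g (inverse r * t))" "integrable circ (\<lambda>r. f r * g (inverse r * s))"
        using s t by (auto intro!: continuous_circ_integrable continuous_intros f continuous_translate g)
      have "dist (conv f g t) (conv f g s) = cmod (\<integral>r. f r * g (inverse r * t) - f r * g (inverse r * s) \<partial>circ)"
        using int by (simp add: conv_def dist_norm)
      also have "\<dots> \<le> (K + 1) * (e / (2 * (K + 1)))"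
      proof (rule circ_integral_norm_le)
        show "integrable circ (\<lambda>r. f r * g (inverse r * t) - f r * g (inverse r * s))" using int by simp
        fix r assume r: "r \<in> S1"
        have mem: "inverse r * t \<in> S1" "inverse r * s \<in> S1"
          using r s t by (auto simp: norm_mult norm_inverse)
        have "dist (inverse r * t) (inverse r * s) = dist t s"
          using r by (simp add: dist_norm norm_mult norm_inverse flip: right_diff_distrib)
        then have gd: "dist (g (inverse r * t)) (g (inverse r * s)) < e / (2 * (K + 1))"
          using d(2)[OF mem(2,1)] t by simp
        have "cmod (f r * g (inverse r * t) - f r * g (inverse r * s))
            = cmod (f r) * dist (g (inverse r * t)) (g (inverse r * s))"
          by (simp add: dist_norm norm_mult flip: right_diff_distrib)
        also have "\<dots> \<le> (K + 1) * (e / (2 * (K + 1)))"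
          using K(2)[OF r] gd K(1) by (intro mult_mono) auto
        finally show "cmod (f r * g (inverse r * t) - f r * g (inverse r * s)) \<le> (K + 1) * (e / (2 * (K + 1)))" .
      qed
      also have "(K + 1) * (e / (2 * (K + 1))) = e / 2"
      proof -
        have cancel: "c * (e / (2 * c)) = e / 2" if "c \<noteq> 0" for c :: real using that by simp
        show ?thesis by (rule cancel) (use K(1) in linarith)
      qed
      also have "\<dots> < e" using e by simp
      finally show ?thesis .
    qed
    then show "\<exists>d>0. \<forall>t\<in>S1. dist t s < d \<longrightarrow> dist (conv f g t) (conv f g s) < e" using d(1) by blast
  qed
qed

text \<open>Write \<open>s\<^sup>n = r\<^sup>n (s / r)\<^sup>n\<close>, exchange the integrals, and use invariance in the inner one.\<close>
lemma fourier_conv: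
  assumes f: "continuous_on S1 f" and g: "continuous_on S1 g"
  shows "fourier (conv f g) n = fourier f n * fourier g n"
proof -
  obtain K where K: "K \<ge> 0" "\<And>s. s \<in> S1 \<Longrightarrow> cmod (f s) \<le> K" using continuous_S1_bounded[OF f] by blast
  obtain L where L: "L \<ge> 0" "\<And>s. s \<in> S1 \<Longrightarrow> cmod (g s) \<le> L" using continuous_S1_bounded[OF g] by blast
  define k where "k s = g s * s powi n" for s
  have kc: "continuous_on S1 k" unfolding k_def by (intro continuous_intros g)
  have kL: "cmod (k s) \<le> L" if "s \<in> S1" for s
    using L(2)[OF that] norm_powi_S1[OF that] by (simp add: k_def norm_mult)
  have fm: "(\<lambda>r. f r * r powi n) \<in> borel_measurable circ"
    by (intro continuous_circ_measurable continuous_intros f)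
  have "fourier (conv f g) n = (\<integral>s. (\<integral>r. (f r * r powi n) * k (inverse r * s) \<partial>circ) \<partial>circ)"
    unfolding fourier_def conv_def
  proof (intro Bochner_Integration.integral_cong refl)
    fix s assume "s \<in> space circ"
    then have s: "s \<in> S1" "s \<noteq> 0" by auto
    have "(\<integral>r. f r * g (inverse r * s) \<partial>circ) * s powi n = (\<integral>r. f r * g (inverse r * s) * s powi n \<partial>circ)"
      by simp
    also have "\<dots> = (\<integral>r. (f r * r powi n) * k (inverse r * s) \<partial>circ)"
    proof (intro Bochner_Integration.integral_cong refl)
      fix r assume "r \<in> space circ"
      then have "r \<noteq> 0" by auto
      then have "s powi n = r powi n * (inverse r * s) powi n"
        by (simp add: mult.assoc[symmetric] flip: power_int_mult_distrib)
      then show "f r * g (inverse r * s) * s powi n = (f r * r powi n) * k (inverse r * s)"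
        by (simp add: k_def)
    qed
    finally show "(\<integral>r. f r * g (inverse r * s) \<partial>circ) * s powi n = (\<integral>r. (f r * r powi n) * k (inverse r * s) \<partial>circ)" .
  qed
  also have "\<dots> = (\<integral>r. (\<integral>s. (f r * r powi n) * k (inverse r * s) \<partial>circ) \<partial>circ)"
  proof (rule circ_Fubini[of _ "K * L"])
    have km: "(\<lambda>x. k (inverse (fst x) * snd x)) \<in> borel_measurable (circ \<Otimes>\<^sub>M circ)"
      by (rule measurable_circ_comp[OF kc]) (auto simp: space_pair_measure norm_mult norm_inverse)
    have "(\<lambda>x. f (fst x) * fst x powi n) \<in> borel_measurable (circ \<Otimes>\<^sub>M circ)"
      using measurable_comp[OF measurable_fst fm] by (simp add: comp_def)
    then have "(\<lambda>x. (f (fst x) * fst x powi n) * k (inverse (fst x) * snd x)) \<in> borel_measurable (circ \<Otimes>\<^sub>M circ)"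
      using km by (rule borel_measurable_times)
    then show "case_prod (\<lambda>r s. (f r * r powi n) * k (inverse r * s)) \<in> borel_measurable (circ \<Otimes>\<^sub>M circ)"
      by (simp add: split_beta)
    fix r s assume rs: "r \<in> S1" "s \<in> S1"
    then have "cmod (f r) \<le> K" "cmod (r powi n) = 1" "cmod (k (inverse r * s)) \<le> L"
      by (auto intro!: K kL simp: norm_mult norm_inverse norm_power_int)
    then show "cmod ((f r * r powi n) * k (inverse r * s)) \<le> K * L"
      using K(1) by (simp add: norm_mult mult_mono)
  qed
  also have "\<dots> = (\<integral>r. (f r * r powi n) * fourier g n \<partial>circ)"
  proof (intro Bochner_Integration.integral_cong refl)
    fix r assume "r \<in> space circ"
    then have "inverse r \<in> S1" by (simp add: norm_inverse)
    then have "(\<integral>s. k (inverse r * s) \<partial>circ) = fourier g n"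
      using circ_integral_rotate[of "inverse r" k] continuous_circ_measurable[OF kc]
      by (simp add: fourier_def k_def)
    then show "(\<integral>s. (f r * r powi n) * k (inverse r * s) \<partial>circ) = (f r * r powi n) * fourier g n"
      by simp
  qed
  also have "\<dots> = fourier f n * fourier g n" by (simp add: fourier_def)
  finally show ?thesis .
qed

lemma fourier_involution:
  assumes f: "continuous_on S1 f"
  shows "fourier (\<lambda>s. cnj (f (inverse s))) n = cnj (fourier f n)"
proof -
  have c: "continuous_on S1 (\<lambda>s. cnj (f s * s powi n))" by (intro continuous_intros f)
  have "fourier (\<lambda>s. cnj (f (inverse s))) n = (\<integral>s. cnj (f (inverse s) * inverse s powi n) \<partial>circ)"
    unfolding fourier_def
  proof (intro Bochner_Integration.integral_cong refl)
    fix s assume "s \<in> space circ"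
    then have "cnj s = inverse s" by (simp add: cnj_S1)
    then have "cnj (inverse s) = s" by (metis complex_cnj_cnj)
    then show "cnj (f (inverse s)) * s powi n = cnj (f (inverse s) * inverse s powi n)" by simp
  qed
  also have "\<dots> = (\<integral>s. cnj (f s * s powi n) \<partial>circ)"
    by (rule circ_integral_inverse[OF c])
  also have "\<dots> = cnj (fourier f n)" unfolding fourier_def by (rule Bochner_Integration.integral_cnj)
  finally show ?thesis .
qed

section \<open>Square-summable families\<close>

lemma ell2I:
  assumes "\<And>F. finite F \<Longrightarrow> (\<Sum>x\<in>F. (cmod (\<xi> x))\<^sup>2) \<le> K"
  shows "\<xi> \<in> ell2"
  unfolding ell2_def
  by (intro CollectI nonneg_bdd_above_summable_on) (auto simp: bdd_above_def intro!: assms)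

lemma ell2_norm_nonneg: "0 \<le> ell2_norm \<xi>"
  unfolding ell2_norm_def by (intro real_sqrt_ge_zero infsum_nonneg) simp

lemma ell2_norm_sq: "(ell2_norm \<xi>)\<^sup>2 = (\<Sum>\<^sub>\<infinity>x. (cmod (\<xi> x))\<^sup>2)"
  unfolding ell2_norm_def by (intro real_sqrt_pow2 infsum_nonneg) simp

lemma ell2_finite_sum_le: "\<xi> \<in> ell2 \<Longrightarrow> finite F \<Longrightarrow> (\<Sum>x\<in>F. (cmod (\<xi> x))\<^sup>2) \<le> (ell2_norm \<xi>)\<^sup>2"
  unfolding ell2_norm_sq by (intro finite_sum_le_infsum) (auto simp: ell2_def)

lemma ell2_norm_leI:
  assumes "\<And>F. finite F \<Longrightarrow> (\<Sum>x\<in>F. (cmod (\<xi> x))\<^sup>2) \<le> K\<^sup>2" and K: "0 \<le> K"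
  shows "ell2_norm \<xi> \<le> K"
proof -
  have "\<xi> \<in> ell2" by (rule ell2I[OF assms(1)])
  then have "(ell2_norm \<xi>)\<^sup>2 \<le> K\<^sup>2"
    unfolding ell2_norm_sq by (intro infsum_le_finite_sums) (auto simp: ell2_def assms(1))
  then show ?thesis using K by (rule power2_le_imp_le)
qed

lemma L2_set_le_ell2_norm:
  "\<xi> \<in> ell2 \<Longrightarrow> finite F \<Longrightarrow> L2_set (\<lambda>x. cmod (\<xi> x)) F \<le> ell2_norm \<xi>"
  unfolding L2_set_def using ell2_finite_sum_le[of \<xi> F] ell2_norm_nonneg[of \<xi>] by (simp add: real_le_lsqrt)

lemma ell2_coord_le: "\<xi> \<in> ell2 \<Longrightarrow> cmod (\<xi> x) \<le> ell2_norm \<xi>"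
  using L2_set_le_ell2_norm[of \<xi> "{x}"] by simp

lemma ell2_add:
  assumes "\<xi> \<in> ell2" "\<eta> \<in> ell2"
  shows "(\<lambda>x. \<xi> x + \<eta> x) \<in> ell2" and "ell2_norm (\<lambda>x. \<xi> x + \<eta> x) \<le> ell2_norm \<xi> + ell2_norm \<eta>"
proof -
  have *: "(\<Sum>x\<in>F. (cmod (\<xi> x + \<eta> x))\<^sup>2) \<le> (ell2_norm \<xi> + ell2_norm \<eta>)\<^sup>2" if F: "finite F" for F
  proof -
    have "L2_set (\<lambda>x. cmod (\<xi> x + \<eta> x)) F \<le> L2_set (\<lambda>x. cmod (\<xi> x) + cmod (\<eta> x)) F"
      by (intro L2_set_mono norm_triangle_ineq) auto
    also have "\<dots> \<le> L2_set (\<lambda>x. cmod (\<xi> x)) F + L2_set (\<lambda>x. cmod (\<eta> x)) F"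
      by (rule L2_set_triangle_ineq)
    also have "\<dots> \<le> ell2_norm \<xi> + ell2_norm \<eta>"
      by (intro add_mono L2_set_le_ell2_norm assms F)
    finally show ?thesis unfolding L2_set_def by (simp add: real_sqrt_le_iff sqrt_le_D)
  qed
  show "(\<lambda>x. \<xi> x + \<eta> x) \<in> ell2" by (rule ell2I[OF *])
  show "ell2_norm (\<lambda>x. \<xi> x + \<eta> x) \<le> ell2_norm \<xi> + ell2_norm \<eta>"
    by (rule ell2_norm_leI[OF *]) (simp_all add: ell2_norm_nonneg)
qed

lemma ell2_norm_scale: "ell2_norm (\<lambda>x. c * \<xi> x) = cmod c * ell2_norm \<xi>"
proof -
  have "(\<Sum>\<^sub>\<infinity>x. (cmod (c * \<xi> x))\<^sup>2) = (cmod c)\<^sup>2 * (\<Sum>\<^sub>\<infinity>x. (cmod (\<xi> x))\<^sup>2)"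
    by (simp add: norm_mult power_mult_distrib infsum_cmult_right')
  then show ?thesis by (simp add: ell2_norm_def real_sqrt_mult)
qed

lemma ell2_scale: "\<xi> \<in> ell2 \<Longrightarrow> (\<lambda>x. c * \<xi> x) \<in> ell2"
  unfolding ell2_def by (simp add: norm_mult power_mult_distrib summable_on_cmult_right)

lemma ell2_zero: "(\<lambda>x. 0) \<in> ell2"
  by (rule ell2I[of _ 0]) simp

lemma ell2_norm_zero [simp]: "ell2_norm (\<lambda>x. 0) = 0"
  by (simp add: ell2_norm_def)

lemma ell2_diff:
  assumes "\<xi> \<in> ell2" "\<eta> \<in> ell2"
  shows "(\<lambda>x. \<xi> x - \<eta> x) \<in> ell2" and "ell2_norm (\<lambda>x. \<xi> x - \<eta> x) \<le> ell2_norm \<xi> + ell2_norm \<eta>"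
  using ell2_add[OF assms(1) ell2_scale[OF assms(2), of "-1"]] ell2_norm_scale[of "-1" \<eta>] by simp_all

definition ell2_dist :: "('x \<Rightarrow> complex) \<Rightarrow> ('x \<Rightarrow> complex) \<Rightarrow> real" where
  "ell2_dist = (\<lambda>\<xi> \<eta>. if \<xi> \<in> ell2 \<and> \<eta> \<in> ell2 then ell2_norm (\<lambda>x. \<xi> x - \<eta> x) else 0)"

lemma ell2_metric: "Metric_space ell2 ell2_dist"
proof
  fix \<xi> \<eta> :: "'x \<Rightarrow> complex"
  show "0 \<le> ell2_dist \<xi> \<eta>" by (simp add: ell2_dist_def ell2_norm_nonneg)
  show "ell2_dist \<xi> \<eta> = ell2_dist \<eta> \<xi>" by (simp add: ell2_dist_def ell2_norm_def norm_minus_commute)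
next
  fix \<xi> \<eta> :: "'x \<Rightarrow> complex" assume m: "\<xi> \<in> ell2" "\<eta> \<in> ell2"
  show "ell2_dist \<xi> \<eta> = 0 \<longleftrightarrow> \<xi> = \<eta>"
  proof
    assume "ell2_dist \<xi> \<eta> = 0"
    then have "cmod (\<xi> x - \<eta> x) \<le> 0" for x
      using ell2_coord_le[OF ell2_diff(1)[OF m], of x] m by (simp add: ell2_dist_def)
    then show "\<xi> = \<eta>" by (intro ext) simp
  qed (use m in \<open>simp add: ell2_dist_def\<close>)
next
  fix \<xi> \<eta> \<zeta> :: "'x \<Rightarrow> complex" assume m: "\<xi> \<in> ell2" "\<eta> \<in> ell2" "\<zeta> \<in> ell2"
  show "ell2_dist \<xi> \<zeta> \<le> ell2_dist \<xi> \<eta> + ell2_dist \<eta> \<zeta>"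
    using ell2_add(2)[OF ell2_diff(1)[OF m(1,2)] ell2_diff(1)[OF m(2,3)]] m by (simp add: ell2_dist_def)
qed

interpretation ell2: Metric_space ell2 ell2_dist
  by (rule ell2_metric)

lemma ell2_topology_eq: "ell2_topology = ell2.mtopology"
  by (simp add: ell2_topology_def ell2_dist_def)

lemma ell2_inner_has_sum:
  assumes "\<xi> \<in> ell2" "\<eta> \<in> ell2"
  shows "((\<lambda>x. \<xi> x * cnj (\<eta> x)) has_sum ell2_inner \<xi> \<eta>) UNIV"
    and "cmod (ell2_inner \<xi> \<eta>) \<le> ell2_norm \<xi> * ell2_norm \<eta>"
proof -
  have *: "(\<Sum>x\<in>F. cmod (\<xi> x * cnj (\<eta> x))) \<le> ell2_norm \<xi> * ell2_norm \<eta>" if F: "finite F" for F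
  proof -
    have "(\<Sum>x\<in>F. cmod (\<xi> x * cnj (\<eta> x))) \<le> L2_set (\<lambda>x. cmod (\<xi> x)) F * L2_set (\<lambda>x. cmod (\<eta> x)) F"
      using L2_set_mult_ineq[of "\<lambda>x. cmod (\<xi> x)" "\<lambda>x. cmod (\<eta> x)" F] by (simp add: norm_mult)
    also have "\<dots> \<le> ell2_norm \<xi> * ell2_norm \<eta>"
      by (intro mult_mono L2_set_le_ell2_norm assms F ell2_norm_nonneg L2_set_nonneg)
    finally show ?thesis .
  qed
  have abs: "(\<lambda>x. cmod (\<xi> x * cnj (\<eta> x))) summable_on UNIV"
    by (rule nonneg_bdd_above_summable_on) (auto simp: bdd_above_def intro!: *)
  show "((\<lambda>x. \<xi> x * cnj (\<eta> x)) has_sum ell2_inner \<xi> \<eta>) UNIV"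
    unfolding ell2_inner_def by (rule has_sum_infsum[OF abs_summable_summable[OF abs]])
  have "cmod (ell2_inner \<xi> \<eta>) \<le> (\<Sum>\<^sub>\<infinity>x. cmod (\<xi> x * cnj (\<eta> x)))"
    unfolding ell2_inner_def by (rule norm_infsum_bound[OF abs])
  also have "\<dots> \<le> ell2_norm \<xi> * ell2_norm \<eta>"
    by (rule infsum_le_finite_sums[OF abs *])
  finally show "cmod (ell2_inner \<xi> \<eta>) \<le> ell2_norm \<xi> * ell2_norm \<eta>" .
qed

lemmas ell2_Cauchy_Schwarz = ell2_inner_has_sum(2)

lemma ell2_inner_add_left:
  assumes "\<xi> \<in> ell2" "\<eta> \<in> ell2" "\<zeta> \<in> ell2"
  shows "ell2_inner (\<lambda>x. \<xi> x + \<eta> x) \<zeta> = ell2_inner \<xi> \<zeta> + ell2_inner \<eta> \<zeta>"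
proof -
  have "((\<lambda>x. (\<xi> x + \<eta> x) * cnj (\<zeta> x)) has_sum ell2_inner \<xi> \<zeta> + ell2_inner \<eta> \<zeta>) UNIV"
    using has_sum_add[OF ell2_inner_has_sum(1)[OF assms(1,3)] ell2_inner_has_sum(1)[OF assms(2,3)]]
    by (simp add: distrib_right)
  then show ?thesis unfolding ell2_inner_def by (rule infsumI)
qed

lemma ell2_inner_scale_left: "ell2_inner (\<lambda>x. c * \<xi> x) \<eta> = c * ell2_inner \<xi> \<eta>"
  unfolding ell2_inner_def by (simp add: mult.assoc infsum_cmult_right')

lemma ell2_inner_diff_left:
  assumes "\<xi> \<in> ell2" "\<eta> \<in> ell2" "\<zeta> \<in> ell2"
  shows "ell2_inner (\<lambda>x. \<xi> x - \<eta> x) \<zeta> = ell2_inner \<xi> \<zeta> - ell2_inner \<eta> \<zeta>"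
  using ell2_inner_add_left[OF assms(1) ell2_scale[OF assms(2), of "-1"] assms(3)]
    ell2_inner_scale_left[of "-1" \<eta> \<zeta>] by simp

lemma ell2_inner_cnj: "ell2_inner \<xi> \<eta> = cnj (ell2_inner \<eta> \<xi>)"
  unfolding ell2_inner_def by (simp add: mult.commute flip: infsum_cnj)

lemma ell2_inner_diff_right:
  assumes "\<xi> \<in> ell2" "\<eta> \<in> ell2" "\<zeta> \<in> ell2"
  shows "ell2_inner \<zeta> (\<lambda>x. \<xi> x - \<eta> x) = ell2_inner \<zeta> \<xi> - ell2_inner \<zeta> \<eta>"
  using ell2_inner_diff_left[OF assms] by (simp add: ell2_inner_cnj[of \<zeta>])

lemma ell2_inner_self:
  assumes "\<xi> \<in> ell2"
  shows "ell2_inner \<xi> \<xi> = of_real ((ell2_norm \<xi>)\<^sup>2)"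
proof -
  have "ell2_inner \<xi> \<xi> = (\<Sum>\<^sub>\<infinity>x. of_real ((cmod (\<xi> x))\<^sup>2))"
    unfolding ell2_inner_def by (simp only: complex_norm_square)
  also have "\<dots> = of_real ((ell2_norm \<xi>)\<^sup>2)"
    unfolding ell2_norm_sq using assms
    by (intro infsumI has_sum_of_real has_sum_infsum) (simp add: ell2_def)
  finally show ?thesis .
qed

lemma ell2_sum:
  assumes "\<And>n. n \<in> S \<Longrightarrow> \<xi> n \<in> ell2"
  shows "(\<lambda>x. \<Sum>n\<in>S. c n * \<xi> n x) \<in> ell2"
  using assms
proof (induction S rule: infinite_finite_induct)
  case (insert n S)
  then show ?case using ell2_add(1)[OF ell2_scale[of "\<xi> n" "c n"]] by simp
qed (simp_all add: ell2_zero)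

lemma ell2_inner_sum_left:
  assumes "\<And>n. n \<in> S \<Longrightarrow> \<xi> n \<in> ell2" "\<zeta> \<in> ell2"
  shows "ell2_inner (\<lambda>x. \<Sum>n\<in>S. c n * \<xi> n x) \<zeta> = (\<Sum>n\<in>S. c n * ell2_inner (\<xi> n) \<zeta>)"
  using assms
proof (induction S rule: infinite_finite_induct)
  case (insert n S)
  have "ell2_inner (\<lambda>x. c n * \<xi> n x + (\<Sum>n\<in>S. c n * \<xi> n x)) \<zeta>
      = ell2_inner (\<lambda>x. c n * \<xi> n x) \<zeta> + ell2_inner (\<lambda>x. \<Sum>n\<in>S. c n * \<xi> n x) \<zeta>"
    using insert.prems by (intro ell2_inner_add_left ell2_scale ell2_sum) auto
  then show ?case using insert by (simp add: ell2_inner_scale_left)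
qed (simp_all add: ell2_inner_def)

text \<open>Vectors of finite support are dense; the remainder is displayed so that it can be fed into the Cauchy-Schwarz
  inequality.\<close>
lemma ell2_tail:
  assumes "\<zeta> \<in> ell2" "e > 0"
  obtains F where "finite F" "(\<lambda>x. if x \<in> F then 0 else \<zeta> x) \<in> ell2"
    "ell2_norm (\<lambda>x. if x \<in> F then 0 else \<zeta> x) \<le> e"
proof -
  have sum: "(\<lambda>x. (cmod (\<zeta> x))\<^sup>2) summable_on UNIV" using assms by (simp add: ell2_def)
  have "e\<^sup>2 > 0" using assms by simp
  then obtain F where F: "finite F"
    "dist (\<Sum>x\<in>F. (cmod (\<zeta> x))\<^sup>2) (\<Sum>\<^sub>\<infinity>x. (cmod (\<zeta> x))\<^sup>2) \<le> e\<^sup>2"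
    using infsum_finite_approximation[OF sum] by blast
  have *: "(\<Sum>x\<in>H. (cmod (if x \<in> F then 0 else \<zeta> x))\<^sup>2) \<le> e\<^sup>2" if H: "finite H" for H
  proof -
    have "(\<Sum>x\<in>H. (cmod (if x \<in> F then 0 else \<zeta> x))\<^sup>2) = (\<Sum>x\<in>H - F. (cmod (\<zeta> x))\<^sup>2)"
      by (rule sum.mono_neutral_cong_right) (use H in auto)
    also have "\<dots> = (\<Sum>x\<in>(H - F) \<union> F. (cmod (\<zeta> x))\<^sup>2) - (\<Sum>x\<in>F. (cmod (\<zeta> x))\<^sup>2)"
      by (subst sum.union_disjoint) (use H F in auto)
    also have "\<dots> \<le> e\<^sup>2"
      using ell2_finite_sum_le[OF assms(1), of "(H - F) \<union> F"] F H
      by (simp add: dist_real_def ell2_norm_sq)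
    finally show ?thesis .
  qed
  show ?thesis
    by (rule that[OF F(1) ell2I[OF *] ell2_norm_leI[OF *]]) (use assms in auto)
qed

lemma continuous_map_ell2_scale:
  assumes c: "continuous_on S1 c" and \<xi>: "\<xi> \<in> ell2"
  shows "continuous_map (top_of_set S1) ell2_topology (\<lambda>s x. c s * \<xi> x)"
  unfolding ell2_topology_eq ell2.continuous_map_to_metric
proof (intro ballI allI impI)
  fix s and e :: real assume s: "s \<in> topspace (top_of_set S1)" and e: "0 < e"
  have "e / (ell2_norm \<xi> + 1) > 0" using e ell2_norm_nonneg[of \<xi>] by simp
  define U where "U = {t \<in> S1. c t \<in> ball (c s) (e / (ell2_norm \<xi> + 1))}"
  have "openin (top_of_set S1) U"
    using continuous_openin_preimage_gen[OF c open_ball, of "c s" "e / (ell2_norm \<xi> + 1)"]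
    by (simp add: U_def vimage_def Int_def)
  moreover have "s \<in> U" using s \<open>e / (ell2_norm \<xi> + 1) > 0\<close> by (simp add: U_def)
  moreover have "(\<lambda>x. c t * \<xi> x) \<in> ell2.mball (\<lambda>x. c s * \<xi> x) e" if t: "t \<in> U" for t
  proof -
    have "ell2_norm (\<lambda>x. c s * \<xi> x - c t * \<xi> x) = cmod (c s - c t) * ell2_norm \<xi>"
      using ell2_norm_scale[of "c s - c t" \<xi>] by (simp add: left_diff_distrib)
    also have "\<dots> \<le> cmod (c s - c t) * (ell2_norm \<xi> + 1)" by (simp add: mult_left_mono)
    also have "\<dots> < e"
      using t ell2_norm_nonneg[of \<xi>] by (simp add: U_def dist_norm pos_less_divide_eq)
    finally show ?thesis
      using \<xi> unfolding ell2.in_mball by (simp add: ell2_scale ell2_dist_def)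
  qed
  ultimately show "\<exists>U. openin (top_of_set S1) U \<and> s \<in> U \<and>
      (\<forall>t\<in>U. (\<lambda>x. c t * \<xi> x) \<in> ell2.mball (\<lambda>x. c s * \<xi> x) e)" by blast
qed

section \<open>Stationary curves in a Hilbert space\<close>

text \<open>The orbit \<open>s \<mapsto> u\<^sub>s \<eta>\<close> of a vector under a unitary representation of the circle is stationary.
  Norm estimates for integrated forms depend on the inner products along the orbit only, so the representation
  itself does not appear.\<close>
locale stationary =
  fixes w :: "complex \<Rightarrow> 'x \<Rightarrow> complex" and N :: real
  assumes w_mem: "s \<in> S1 \<Longrightarrow> w s \<in> ell2"
    and w_norm: "s \<in> S1 \<Longrightarrow> ell2_norm (w s) \<le> N"
    and w_cont: "continuous_map (top_of_set S1) ell2_topology w"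
    and w_stat: "\<lbrakk>r \<in> S1; s \<in> S1; t \<in> S1\<rbrakk> \<Longrightarrow> ell2_inner (w (r * s)) (w (r * t)) = ell2_inner (w s) (w t)"
begin

lemma N_nonneg: "0 \<le> N"
  using w_norm[of 1] ell2_norm_nonneg[of "w 1"] by simp

lemma w_lipschitz_cont:
  fixes g :: "('x \<Rightarrow> complex) \<Rightarrow> complex"
  assumes "\<And>\<xi> \<eta>. \<xi> \<in> ell2 \<Longrightarrow> \<eta> \<in> ell2 \<Longrightarrow> cmod (g \<xi> - g \<eta>) \<le> K * ell2_norm (\<lambda>x. \<xi> x - \<eta> x)"
  shows "continuous_on S1 (\<lambda>s. g (w s))"
  unfolding continuous_on_iff
proof (intro ballI allI impI)
  fix s and e :: real assume s: "s \<in> S1" and e: "0 < e"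
  have "e / (\<bar>K\<bar> + 1) > 0" using e by simp
  then obtain U where U: "openin (top_of_set S1) U" "s \<in> U"
    "\<And>t. t \<in> U \<Longrightarrow> w t \<in> ell2.mball (w s) (e / (\<bar>K\<bar> + 1))"
    using w_cont s unfolding ell2_topology_eq ell2.continuous_map_to_metric by (metis topspace_euclidean_subtopology)
  obtain d where d: "d > 0" "\<And>t. t \<in> S1 \<Longrightarrow> dist t s < d \<Longrightarrow> t \<in> U"
    using U(1,2) unfolding openin_euclidean_subtopology_iff by metis
  have "dist (g (w t)) (g (w s)) < e" if t: "t \<in> S1" "dist t s < d" for t
  proof -
    have "ell2_norm (\<lambda>x. w s x - w t x) < e / (\<bar>K\<bar> + 1)"
      using U(3)[OF d(2)[OF t]] unfolding ell2.in_mball by (auto simp: ell2_dist_def)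
    then have "(\<bar>K\<bar> + 1) * ell2_norm (\<lambda>x. w s x - w t x) < e" by (simp add: field_simps)
    moreover have "cmod (g (w s) - g (w t)) \<le> (\<bar>K\<bar> + 1) * ell2_norm (\<lambda>x. w s x - w t x)"
      by (rule order_trans[OF assms[OF w_mem[OF s] w_mem[OF t(1)]]])
        (intro mult_right_mono ell2_norm_nonneg, simp)
    ultimately show ?thesis by (simp add: dist_norm norm_minus_commute)
  qed
  then show "\<exists>d>0. \<forall>t\<in>S1. dist t s < d \<longrightarrow> dist (g (w t)) (g (w s)) < e" using d(1) by blast
qed

lemma w_coord_cont: "continuous_on S1 (\<lambda>s. w s x)"
  by (rule w_lipschitz_cont[where g = "\<lambda>\<xi>. \<xi> x" and K = 1])
    (use ell2_coord_le[OF ell2_diff(1)] in simp)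

lemma w_inner_cont:
  assumes "\<zeta> \<in> ell2"
  shows "continuous_on S1 (\<lambda>s. ell2_inner (w s) \<zeta>)"
  by (rule w_lipschitz_cont[where g = "\<lambda>\<xi>. ell2_inner \<xi> \<zeta>" and K = "ell2_norm \<zeta>"])
    (use ell2_Cauchy_Schwarz[OF ell2_diff(1) assms] assms in \<open>simp add: ell2_inner_diff_left mult.commute\<close>)

text \<open>The vector-valued integral of \<open>g\<close> against the curve, taken coordinatewise; \<open>inner_V\<close> below shows that it is
  also the weak integral.\<close>
definition V :: "(complex \<Rightarrow> complex) \<Rightarrow> 'x \<Rightarrow> complex" where
  "V g x = (\<integral>s. g s * w s x \<partial>circ)"

lemma circ_Jensen:
  assumes h: "continuous_on S1 (h :: complex \<Rightarrow> complex)"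
  shows "(cmod (\<integral>s. h s \<partial>circ))\<^sup>2 \<le> (\<integral>s. (cmod (h s))\<^sup>2 \<partial>circ)"
proof -
  define m where "m = (\<integral>s. cmod (h s) \<partial>circ)"
  have int: "integrable circ (\<lambda>s. cmod (h s))" "integrable circ (\<lambda>s. (cmod (h s))\<^sup>2)"
    by (intro continuous_circ_integrable continuous_intros h)+
  have "0 \<le> (\<integral>s. (cmod (h s) - m)\<^sup>2 \<partial>circ)" by (rule Bochner_Integration.integral_nonneg) simp
  also have "\<dots> = (\<integral>s. (cmod (h s))\<^sup>2 + m\<^sup>2 - 2 * m * cmod (h s) \<partial>circ)"
    by (simp add: power2_diff mult.commute mult.left_commute)
  also have "\<dots> = (\<integral>s. (cmod (h s))\<^sup>2 \<partial>circ) + m\<^sup>2 - 2 * m * m"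
    using int by (simp add: m_def)
  finally have "m\<^sup>2 \<le> (\<integral>s. (cmod (h s))\<^sup>2 \<partial>circ)" by (simp add: power2_eq_square)
  moreover have "cmod (\<integral>s. h s \<partial>circ) \<le> m" unfolding m_def by (rule integral_norm_bound)
  ultimately show ?thesis by (meson norm_ge_zero order_trans power_mono)
qed

text \<open>Jensen's inequality in each coordinate, summed over finitely many coordinates.  This crude estimate by
  the supremum of \<open>g\<close> makes the integral depend continuously on \<open>g\<close>.\<close>
lemma V_bound:
  assumes g: "continuous_on S1 g" and K: "0 \<le> K" "\<And>s. s \<in> S1 \<Longrightarrow> cmod (g s) \<le> K"
  shows "V g \<in> ell2" and "ell2_norm (V g) \<le> K * N"
proof -
  have c: "continuous_on S1 (\<lambda>s. g s * w s x)" for x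
    by (intro continuous_intros g w_coord_cont)
  have *: "(\<Sum>x\<in>F. (cmod (V g x))\<^sup>2) \<le> (K * N)\<^sup>2" if F: "finite F" for F
  proof -
    have int: "integrable circ (\<lambda>s. (cmod (g s * w s x))\<^sup>2)" for x
      by (intro continuous_circ_integrable continuous_intros c)
    have "(\<Sum>x\<in>F. (cmod (V g x))\<^sup>2) \<le> (\<Sum>x\<in>F. \<integral>s. (cmod (g s * w s x))\<^sup>2 \<partial>circ)"
      unfolding V_def by (intro sum_mono circ_Jensen c)
    also have "\<dots> = (\<integral>s. (\<Sum>x\<in>F. (cmod (g s * w s x))\<^sup>2) \<partial>circ)"
      using int by (subst Bochner_Integration.integral_sum) auto
    also have "\<dots> \<le> norm (\<integral>s. (\<Sum>x\<in>F. (cmod (g s * w s x))\<^sup>2) \<partial>circ)" by simp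
    also have "\<dots> \<le> (K * N)\<^sup>2"
    proof (rule circ_integral_norm_le)
      show "integrable circ (\<lambda>s. \<Sum>x\<in>F. (cmod (g s * w s x))\<^sup>2)" using int by simp
      fix s assume s: "s \<in> S1"
      have "(\<Sum>x\<in>F. (cmod (g s * w s x))\<^sup>2) = (cmod (g s))\<^sup>2 * (\<Sum>x\<in>F. (cmod (w s x))\<^sup>2)"
        by (simp add: norm_mult power_mult_distrib sum_distrib_left)
      also have "\<dots> \<le> K\<^sup>2 * N\<^sup>2"
      proof (intro mult_mono)
        show "(cmod (g s))\<^sup>2 \<le> K\<^sup>2" using K(2)[OF s] by (simp add: power_mono)
        have "(\<Sum>x\<in>F. (cmod (w s x))\<^sup>2) \<le> (ell2_norm (w s))\<^sup>2"
          by (rule ell2_finite_sum_le[OF w_mem[OF s] F])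
        also have "\<dots> \<le> N\<^sup>2" using w_norm[OF s] ell2_norm_nonneg by (rule power_mono)
        finally show "(\<Sum>x\<in>F. (cmod (w s x))\<^sup>2) \<le> N\<^sup>2" .
      qed (auto intro: sum_nonneg)
      finally show "norm (\<Sum>x\<in>F. (cmod (g s * w s x))\<^sup>2) \<le> (K * N)\<^sup>2"
        by (simp add: power_mult_distrib sum_nonneg)
    qed
    finally show ?thesis .
  qed
  show "V g \<in> ell2" by (rule ell2I[OF *])
  show "ell2_norm (V g) \<le> K * N" by (rule ell2_norm_leI[OF *]) (use K N_nonneg in auto)
qed

lemma V_mem: "continuous_on S1 g \<Longrightarrow> V g \<in> ell2"
  using V_bound(1) continuous_S1_bounded by metis

text \<open>For a vector \<open>\<zeta>\<close> of finite support the sum is finite and commutes with the integral.  In general,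
  the tail of \<open>\<zeta>\<close> contributes at most a multiple of its norm on either side.\<close>
lemma inner_V:
  assumes g: "continuous_on S1 g" and \<zeta>: "\<zeta> \<in> ell2"
  shows "ell2_inner (V g) \<zeta> = (\<integral>s. g s * ell2_inner (w s) \<zeta> \<partial>circ)"
proof -
  obtain K where K: "K \<ge> 0" "\<And>s. s \<in> S1 \<Longrightarrow> cmod (g s) \<le> K" using continuous_S1_bounded[OF g] by blast
  let ?R = "\<integral>s. g s * ell2_inner (w s) \<zeta> \<partial>circ"
  have "cmod (ell2_inner (V g) \<zeta> - ?R) \<le> 0 + e" if e: "e > 0" for e
  proof -
    have "e / (2 * (K * N) + 1) > 0" using e K N_nonneg by (simp add: add_nonneg_pos)
    then obtain F where F: "finite F" and tail0: "(\<lambda>x. if x \<in> F then 0 else \<zeta> x) \<in> ell2"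
      "ell2_norm (\<lambda>x. if x \<in> F then 0 else \<zeta> x) \<le> e / (2 * (K * N) + 1)"
      using ell2_tail[OF \<zeta>] by metis
    define \<tau> where "\<tau> = (\<lambda>x. if x \<in> F then 0 else \<zeta> x)"
    have tail: "\<tau> \<in> ell2" "ell2_norm \<tau> \<le> e / (2 * (K * N) + 1)"
      using tail0 by (simp_all add: \<tau>_def)
    have split: "ell2_inner \<xi> \<zeta> = (\<Sum>x\<in>F. \<xi> x * cnj (\<zeta> x)) + ell2_inner \<xi> \<tau>" if \<xi>: "\<xi> \<in> ell2" for \<xi>
    proof -
      have "((\<lambda>x. \<xi> x * cnj (if x \<in> F then \<zeta> x else 0)) has_sum (\<Sum>x\<in>F. \<xi> x * cnj (\<zeta> x))) UNIV"
        by (rule has_sum_cong_neutral[THEN iffD1, OF _ _ _ has_sum_finite[OF F]]) auto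
      from has_sum_add[OF this ell2_inner_has_sum(1)[OF \<xi> tail(1)]]
      have "((\<lambda>x. \<xi> x * cnj (\<zeta> x)) has_sum (\<Sum>x\<in>F. \<xi> x * cnj (\<zeta> x)) + ell2_inner \<xi> \<tau>) UNIV"
        by (rule has_sum_cong[THEN iffD1, rotated]) (auto simp: \<tau>_def)
      then show ?thesis unfolding ell2_inner_def[of \<xi> \<zeta>] by (rule infsumI)
    qed
    have c1: "continuous_on S1 (\<lambda>s. g s * w s x * cnj (\<zeta> x))" for x
      by (intro continuous_intros g w_coord_cont)
    have c2: "continuous_on S1 (\<lambda>s. g s * ell2_inner (w s) \<tau>)"
      by (intro continuous_intros g w_inner_cont tail)
    have "?R = (\<integral>s. (\<Sum>x\<in>F. g s * w s x * cnj (\<zeta> x)) + g s * ell2_inner (w s) \<tau> \<partial>circ)"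
      by (intro Bochner_Integration.integral_cong refl)
        (simp add: split[OF w_mem] distrib_left sum_distrib_left mult.assoc)
    also have "\<dots> = (\<Sum>x\<in>F. \<integral>s. g s * w s x * cnj (\<zeta> x) \<partial>circ) + (\<integral>s. g s * ell2_inner (w s) \<tau> \<partial>circ)"
      using continuous_circ_integrable[OF c1] continuous_circ_integrable[OF c2]
      by (subst Bochner_Integration.integral_add) auto
    also have "(\<Sum>x\<in>F. \<integral>s. g s * w s x * cnj (\<zeta> x) \<partial>circ) = (\<Sum>x\<in>F. V g x * cnj (\<zeta> x))"
      by (simp add: V_def)
    finally have "ell2_inner (V g) \<zeta> - ?R = ell2_inner (V g) \<tau> - (\<integral>s. g s * ell2_inner (w s) \<tau> \<partial>circ)"
      using split[OF V_mem[OF g]] by simp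
    also have "cmod \<dots> \<le> cmod (ell2_inner (V g) \<tau>) + cmod (\<integral>s. g s * ell2_inner (w s) \<tau> \<partial>circ)"
      by (rule norm_triangle_ineq4)
    also have "\<dots> \<le> (K * N) * ell2_norm \<tau> + (K * N) * ell2_norm \<tau>"
    proof (rule add_mono)
      show "cmod (ell2_inner (V g) \<tau>) \<le> (K * N) * ell2_norm \<tau>"
        by (rule order_trans[OF ell2_Cauchy_Schwarz[OF V_mem[OF g] tail(1)]
              mult_right_mono[OF V_bound(2)[OF g K] ell2_norm_nonneg]])
      show "cmod (\<integral>s. g s * ell2_inner (w s) \<tau> \<partial>circ) \<le> (K * N) * ell2_norm \<tau>"
      proof (rule circ_integral_norm_le[OF continuous_circ_integrable[OF c2]])
        fix s assume s: "s \<in> S1"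
        have "cmod (ell2_inner (w s) \<tau>) \<le> N * ell2_norm \<tau>"
          by (rule order_trans[OF ell2_Cauchy_Schwarz[OF w_mem[OF s] tail(1)]
                mult_right_mono[OF w_norm[OF s] ell2_norm_nonneg]])
        then have "cmod (g s) * cmod (ell2_inner (w s) \<tau>) \<le> K * (N * ell2_norm \<tau>)"
          using K(2)[OF s] K(1) by (intro mult_mono) auto
        then show "cmod (g s * ell2_inner (w s) \<tau>) \<le> (K * N) * ell2_norm \<tau>"
          by (simp add: norm_mult mult.assoc)
      qed
    qed
    also have "\<dots> = (2 * (K * N)) * ell2_norm \<tau>" by simp
    also have "\<dots> \<le> (2 * (K * N) + 1) * ell2_norm \<tau>"
      by (intro mult_right_mono ell2_norm_nonneg) simp
    also have "\<dots> \<le> e"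
      using tail(2) K N_nonneg by (simp add: pos_le_divide_eq add_nonneg_pos mult.commute)
    finally show ?thesis by simp
  qed
  then show ?thesis using field_le_epsilon[of "cmod (ell2_inner (V g) \<zeta> - ?R)" 0] by simp
qed

text \<open>The component of \<open>w 1\<close> in the spectral subspace of a character of the circle.\<close>
definition mode :: "int \<Rightarrow> 'x \<Rightarrow> complex" where
  "mode n = V (\<lambda>s. s powi n)"

lemma mode_mem: "mode n \<in> ell2"
  unfolding mode_def by (intro V_mem continuous_intros)

text \<open>Translating the integration variable by \<open>s\<close> and using stationarity extracts the factor \<open>s\<^sup>m\<close>.\<close>
lemma inner_mode_w:
  assumes s: "s \<in> S1"
  shows "ell2_inner (mode m) (w s) = s powi m * ell2_inner (mode m) (w 1)"
proof -
  have 1: "(1::complex) \<in> S1" by simp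
  have c: "continuous_on S1 (\<lambda>t. t powi m * ell2_inner (w t) (w s))"
    by (intro continuous_intros w_inner_cont w_mem s)
  have "ell2_inner (mode m) (w s) = (\<integral>t. t powi m * ell2_inner (w t) (w s) \<partial>circ)"
    unfolding mode_def by (intro inner_V continuous_intros w_mem s)
  also have "\<dots> = (\<integral>t. (s * t) powi m * ell2_inner (w (s * t)) (w s) \<partial>circ)"
    using circ_integral_rotate[OF s continuous_circ_measurable[OF c]] by simp
  also have "\<dots> = (\<integral>t. s powi m * (t powi m * ell2_inner (w t) (w 1)) \<partial>circ)"
  proof (intro Bochner_Integration.integral_cong refl)
    fix t assume "t \<in> space circ"
    then have "ell2_inner (w (s * t)) (w s) = ell2_inner (w t) (w 1)"
      using w_stat[OF s _ 1, of t] by simp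
    then show "(s * t) powi m * ell2_inner (w (s * t)) (w s) = s powi m * (t powi m * ell2_inner (w t) (w 1))"
      by (simp add: power_int_mult_distrib)
  qed
  also have "\<dots> = s powi m * (\<integral>t. t powi m * ell2_inner (w t) (w 1) \<partial>circ)" by simp
  also have "(\<integral>t. t powi m * ell2_inner (w t) (w 1) \<partial>circ) = ell2_inner (mode m) (w 1)"
    unfolding mode_def by (intro inner_V[symmetric] continuous_intros w_mem 1)
  finally show ?thesis .
qed

text \<open>Integrating the previous lemma against \<open>s\<^sup>n\<close> leaves the integral of \<open>s\<^bsup>n - m\<^esup>\<close>: different
  components are orthogonal, and the square of the norm of a component is its inner product with \<open>w 1\<close>.\<close>
lemma inner_mode:
  "ell2_inner (mode n) (mode m) = (if n = m then cnj (ell2_inner (mode m) (w 1)) else 0)"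
proof -
  have "ell2_inner (mode n) (mode m) = (\<integral>s. s powi n * ell2_inner (w s) (mode m) \<partial>circ)"
    unfolding mode_def[of n] by (intro inner_V continuous_intros mode_mem)
  also have "\<dots> = (\<integral>s. cnj (ell2_inner (mode m) (w 1)) * s powi (n - m) \<partial>circ)"
  proof (intro Bochner_Integration.integral_cong refl)
    fix s assume "s \<in> space circ"
    then have s: "s \<in> S1" "s \<noteq> 0" by auto
    have "ell2_inner (w s) (mode m) = s powi (- m) * cnj (ell2_inner (mode m) (w 1))"
      unfolding ell2_inner_cnj[of "w s"] inner_mode_w[OF s(1)] by (simp add: cnj_powi_S1[OF s(1)] del: power_int_minus complex_cnj_power_int)
    then show "s powi n * ell2_inner (w s) (mode m) = cnj (ell2_inner (mode m) (w 1)) * s powi (n - m)"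
      using s(2) by (simp add: power_int_add[symmetric])
  qed
  also have "\<dots> = (if n = m then cnj (ell2_inner (mode m) (w 1)) else 0)"
    by (simp add: powi_orthogonal)
  finally show ?thesis .
qed

lemma inner_mode_w1: "ell2_inner (mode n) (w 1) = of_real ((ell2_norm (mode n))\<^sup>2)"
  using inner_mode[of n n] ell2_inner_self[OF mode_mem, of n]
  by (metis complex_cnj_cnj complex_cnj_complex_of_real)

lemma norm_mode_sum:
  assumes "finite S"
  shows "(ell2_norm (\<lambda>x. \<Sum>n\<in>S. c n * mode n x))\<^sup>2 = (\<Sum>n\<in>S. (cmod (c n))\<^sup>2 * (ell2_norm (mode n))\<^sup>2)"
proof -
  let ?\<xi> = "\<lambda>x. \<Sum>n\<in>S. c n * mode n x"
  have mem: "?\<xi> \<in> ell2" by (intro ell2_sum mode_mem)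
  have 1: "ell2_inner ?\<xi> (mode m) = c m * of_real ((ell2_norm (mode m))\<^sup>2)" if "m \<in> S" for m
  proof -
    have "ell2_inner ?\<xi> (mode m) = (\<Sum>n\<in>S. c n * ell2_inner (mode n) (mode m))"
      by (intro ell2_inner_sum_left mode_mem)
    also have "\<dots> = (\<Sum>n\<in>S. if n = m then c m * of_real ((ell2_norm (mode m))\<^sup>2) else 0)"
      by (intro sum.cong refl) (simp add: inner_mode inner_mode_w1)
    finally show ?thesis using that assms by simp
  qed
  have "ell2_inner ?\<xi> ?\<xi> = (\<Sum>n\<in>S. c n * ell2_inner (mode n) ?\<xi>)"
    by (intro ell2_inner_sum_left mode_mem mem)
  also have "\<dots> = (\<Sum>n\<in>S. of_real ((cmod (c n))\<^sup>2 * (ell2_norm (mode n))\<^sup>2))"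
    by (intro sum.cong refl) (simp add: ell2_inner_cnj[of _ ?\<xi>] 1 complex_norm_square[symmetric] flip: mult.assoc)
  finally have "of_real ((ell2_norm ?\<xi>)\<^sup>2) = (of_real (\<Sum>n\<in>S. (cmod (c n))\<^sup>2 * (ell2_norm (mode n))\<^sup>2) :: complex)"
    by (simp only: ell2_inner_self[OF mem] of_real_sum)
  then show ?thesis by (simp only: of_real_eq_iff)
qed

text \<open>Expand the square of the distance from \<open>w 1\<close> to the sum of its components.\<close>
lemma Bessel:
  assumes "finite S"
  shows "(\<Sum>n\<in>S. (ell2_norm (mode n))\<^sup>2) \<le> N\<^sup>2"
proof -
  let ?g = "\<lambda>x. \<Sum>n\<in>S. 1 * mode n x" and ?B = "\<Sum>n\<in>S. (ell2_norm (mode n))\<^sup>2"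
  have w1: "w 1 \<in> ell2" by (rule w_mem) simp
  have g: "?g \<in> ell2" by (intro ell2_sum mode_mem)
  have gw: "ell2_inner ?g (w 1) = of_real ?B"
    by (subst ell2_inner_sum_left) (simp_all add: mode_mem w1 inner_mode_w1)
  have gg: "ell2_inner ?g ?g = of_real ?B"
    unfolding ell2_inner_self[OF g] using norm_mode_sum[OF assms, of "\<lambda>_. 1"] by simp
  have "ell2_inner (\<lambda>x. w 1 x - ?g x) (\<lambda>x. w 1 x - ?g x)
      = of_real ((ell2_norm (w 1))\<^sup>2) - of_real ?B - (of_real ?B - of_real ?B)"
    using w1 g gw gg ell2_inner_cnj[of "w 1" ?g]
    by (simp only: ell2_inner_diff_left ell2_inner_diff_right ell2_diff ell2_inner_self[OF w1] complex_cnj_complex_of_real)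
  then have "of_real ((ell2_norm (\<lambda>x. w 1 x - ?g x))\<^sup>2) = (of_real ((ell2_norm (w 1))\<^sup>2 - ?B) :: complex)"
    unfolding ell2_inner_self[OF ell2_diff(1)[OF w1 g]] by simp
  then have "(ell2_norm (\<lambda>x. w 1 x - ?g x))\<^sup>2 = (ell2_norm (w 1))\<^sup>2 - ?B"
    by (simp only: of_real_eq_iff)
  then have "?B \<le> (ell2_norm (w 1))\<^sup>2" by (smt (verit) zero_le_power2)
  also have "\<dots> \<le> N\<^sup>2" by (intro power_mono w_norm ell2_norm_nonneg) simp
  finally show ?thesis .
qed

text \<open>The integral of a trigonometric polynomial is the combination of the components with its coefficients, so
  Pythagoras and Bessel's inequality apply.\<close>
lemma V_trig:
  assumes p: "trig p" and M: "0 \<le> M" "\<And>n. cmod (fourier p n) \<le> M"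
  shows "ell2_norm (V p) \<le> M * N"
proof -
  obtain S c where S: "finite S" "\<And>s. s \<in> S1 \<Longrightarrow> p s = (\<Sum>n\<in>S. c n * s powi n)"
    using trigE[OF p] by blast
  have cM: "cmod (c n) \<le> M" if "n \<in> S" for n
    using M(2)[of "-n"] fourier_cong[OF S(2)] that by (simp add: fourier_sum[OF S(1)])
  have "V p = (\<lambda>x. \<Sum>n\<in>S. c n * mode n x)"
  proof
    fix x
    have int: "integrable circ (\<lambda>s. c n * (s powi n * w s x))" for n
      by (intro continuous_circ_integrable continuous_intros w_coord_cont)
    have "V p x = (\<integral>s. (\<Sum>n\<in>S. c n * (s powi n * w s x)) \<partial>circ)"
      unfolding V_def
      by (intro Bochner_Integration.integral_cong refl) (simp add: S(2) sum_distrib_right mult.assoc)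
    also have "\<dots> = (\<Sum>n\<in>S. c n * mode n x)"
      using int by (subst Bochner_Integration.integral_sum) (auto simp: mode_def V_def)
    finally show "V p x = (\<Sum>n\<in>S. c n * mode n x)" .
  qed
  then have "(ell2_norm (V p))\<^sup>2 = (\<Sum>n\<in>S. (cmod (c n))\<^sup>2 * (ell2_norm (mode n))\<^sup>2)"
    by (simp add: norm_mode_sum[OF S(1)])
  also have "\<dots> \<le> (\<Sum>n\<in>S. M\<^sup>2 * (ell2_norm (mode n))\<^sup>2)"
    by (intro sum_mono mult_right_mono power_mono cM) auto
  also have "\<dots> \<le> M\<^sup>2 * N\<^sup>2"
    using Bessel[OF S(1)] by (simp add: mult_left_mono flip: sum_distrib_left)
  finally have "(ell2_norm (V p))\<^sup>2 \<le> (M * N)\<^sup>2" by (simp add: power_mult_distrib)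
  then show ?thesis by (rule power2_le_imp_le) (use M(1) N_nonneg in simp)
qed

text \<open>Approximate \<open>f\<close> uniformly within \<open>d\<close> by a trigonometric polynomial.  Its coefficients are at most
  \<open>M + d\<close>, and the integral of the difference is at most \<open>d * N\<close>.\<close>
theorem V_norm_le:
  assumes f: "continuous_on S1 f" and M: "\<And>n. cmod (fourier f n) \<le> M"
  shows "ell2_norm (V f) \<le> M * N"
proof -
  have M0: "0 \<le> M" using M[of 0] norm_ge_zero[of "fourier f 0"] by linarith
  have "ell2_norm (V f) \<le> M * N + e" if e: "e > 0" for e
  proof -
    \<comment> \<open>The total error is \<open>2 * N * d\<close>; the summand \<open>1\<close> covers the case \<open>N = 0\<close>.\<close>
    define d where "d = e / (2 * N + 1)"
    have d: "d > 0" using e N_nonneg by (simp add: d_def)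
    obtain p where p: "trig p" "\<And>s. s \<in> S1 \<Longrightarrow> cmod (f s - p s) < d" using trig_dense[OF f d] by blast
    have pc: "continuous_on S1 p" by (rule trig_continuous[OF p(1)])
    have fp: "continuous_on S1 (\<lambda>s. f s - p s)" by (intro continuous_intros f pc)
    have fp_le: "cmod (f s - p s) \<le> d" if "s \<in> S1" for s using p(2)[OF that] by simp
    have "cmod (fourier p n) \<le> M + d" for n
      using fourier_le[OF fp fp_le, of n] fourier_diff[OF f pc, of n] M[of n]
        norm_triangle_ineq4[of "fourier f n" "fourier f n - fourier p n"] by simp
    then have Vp: "ell2_norm (V p) \<le> (M + d) * N"
      using p(1) M0 d by (intro V_trig) auto
    have Vfp: "ell2_norm (V (\<lambda>s. f s - p s)) \<le> d * N" by (intro V_bound(2) fp fp_le) (use d in auto)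
    have "V f = (\<lambda>x. V p x + V (\<lambda>s. f s - p s) x)"
    proof
      fix x
      have "integrable circ (\<lambda>s. f s * w s x)" "integrable circ (\<lambda>s. p s * w s x)"
        by (intro continuous_circ_integrable continuous_intros f pc w_coord_cont)+
      then show "V f x = V p x + V (\<lambda>s. f s - p s) x" by (simp add: V_def left_diff_distrib)
    qed
    then have "ell2_norm (V f) \<le> ell2_norm (V p) + ell2_norm (V (\<lambda>s. f s - p s))"
      using ell2_add(2)[OF V_mem[OF pc] V_mem[OF fp]] by simp
    also have "\<dots> \<le> (M + d) * N + d * N" using Vp Vfp by simp
    also have "\<dots> = M * N + d * (2 * N)" by (simp add: algebra_simps)
    also have "\<dots> \<le> M * N + d * (2 * N + 1)" using d by simp
    also have "d * (2 * N + 1) = e" using N_nonneg by (simp add: d_def)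
    finally show ?thesis .
  qed
  then show ?thesis by (rule field_le_epsilon)
qed

end

section \<open>Crossed products of the complex numbers by the circle\<close>

text \<open>Both coefficient algebras, the complex numbers and the continuous part of their ultrapower, are
  copies of the complex numbers with trivial action, but over different types.  The crossed product is computed
  for such a copy once and for all.\<close>
locale complex_copy =
  fixes B :: "'b star_alg" and k :: "complex \<Rightarrow> 'b" and \<beta> :: "complex \<Rightarrow> 'b \<Rightarrow> 'b"
  assumes k_inj: "inj k"
    and k_carrier: "carrier B = range k"
    and k_add: "aadd B (k c) (k d) = k (c + d)"
    and k_zero: "azero B = k 0"
    and k_mult: "amult B (k c) (k d) = k (c * d)"
    and k_scale: "ascale B c (k d) = k (c * d)"
    and k_star: "astar B (k c) = k (cnj c)"
    and k_norm: "anorm B (k c) = cmod c"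
    and k_act: "s \<in> S1 \<Longrightarrow> \<beta> s (k c) = k c"
begin

definition ki :: "'b \<Rightarrow> complex" where "ki = inv_into UNIV k"

lemma ki_k [simp]: "ki (k c) = c"
  by (simp add: ki_def k_inj)

lemma k_ki: "b \<in> carrier B \<Longrightarrow> k (ki b) = b"
  by (auto simp: k_carrier)

lemma k_mem [simp]: "k c \<in> carrier B"
  by (simp add: k_carrier)

lemma function_alg_ki: "function_alg B (\<lambda>b (_::unit). ki b)"
proof
  show "inj_on (\<lambda>b (_::unit). ki b) (carrier B)"
    by (rule inj_onI) (metis k_ki)
qed (auto simp: k_carrier k_add k_zero k_mult k_scale k_star k_norm sup_norm_def)

interpretation B: function_alg B "\<lambda>b (_::unit). ki b"
  by (rule function_alg_ki)

lemma dist_k: "adist B (k c) (k d) = dist c d"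
  by (simp add: B.dist_eq sup_norm_def dist_norm)

lemma continuous_map_k_iff:
  "continuous_map (top_of_set S1) (atopology B) (\<lambda>s. k (g s)) \<longleftrightarrow> continuous_on S1 g"
proof -
  have "continuous_map (top_of_set S1) (atopology B) (\<lambda>s. k (g s)) \<longleftrightarrow>
      (\<forall>s\<in>S1. \<forall>e>0. \<exists>U. openin (top_of_set S1) U \<and> s \<in> U \<and> (\<forall>t\<in>U. dist (g s) (g t) < e))"
    unfolding atopology_def B.M.continuous_map_to_metric by (simp add: dist_k del: mem_sphere)
  also have "\<dots> \<longleftrightarrow> continuous_map (top_of_set S1) Met_TC.mtopology g"
    unfolding Met_TC.continuous_map_to_metric by (simp add: del: mem_sphere)
  finally show ?thesis by simp
qed

definition coeff_fun :: "(complex \<Rightarrow> 'b) \<Rightarrow> complex \<Rightarrow> complex" where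
  "coeff_fun f s = ki (f s)"

definition lift :: "(complex \<Rightarrow> complex) \<Rightarrow> complex \<Rightarrow> 'b" where
  "lift g = (\<lambda>s\<in>S1. k (g s))"

lemma coeff_lift: "s \<in> S1 \<Longrightarrow> coeff_fun (lift g) s = g s"
  by (simp add: coeff_fun_def lift_def)

lemma lift_cong: "(\<And>s. s \<in> S1 \<Longrightarrow> g s = g' s) \<Longrightarrow> lift g = lift g'"
  unfolding lift_def by (rule restrict_ext) simp

abbreviation C_c :: "(complex \<Rightarrow> 'b) set" where
  "C_c \<equiv> Cc circle (atopology B) (azero B)"

text \<open>The support condition is automatic, as the circle is compact.\<close>
lemma Cc_mem_iff:
  "f \<in> C_c \<longleftrightarrow> f \<in> extensional S1 \<and> continuous_map (top_of_set S1) (atopology B) f"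
proof -
  have "compactin (top_of_set S1) (top_of_set S1 closure_of X)" for X
    by (rule closedin_compact_space) (simp_all add: compact_space_subtopology)
  then show ?thesis by (simp add: Cc_def)
qed

lemma lift_mem: "continuous_on S1 g \<Longrightarrow> lift g \<in> C_c"
  unfolding Cc_mem_iff lift_def
  by (auto intro: continuous_map_eq[of _ _ "\<lambda>s. k (g s)"] simp: continuous_map_k_iff)

lemma Cc_values: "f \<in> C_c \<Longrightarrow> s \<in> S1 \<Longrightarrow> f s = k (coeff_fun f s)"
  unfolding Cc_mem_iff coeff_fun_def
  by (metis B.topspace_atopology continuous_map_image_subset_topspace image_subset_iff k_ki
      topspace_euclidean_subtopology)

lemma lift_coeff: "f \<in> C_c \<Longrightarrow> f = lift (coeff_fun f)"
  using Cc_values[of f] unfolding Cc_mem_iff lift_def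
  by (intro extensionalityI[of f S1]) auto

lemma coeff_continuous: "f \<in> C_c \<Longrightarrow> continuous_on S1 (coeff_fun f)"
proof -
  assume f: "f \<in> C_c"
  then have "continuous_map (top_of_set S1) (atopology B) (\<lambda>s. k (coeff_fun f s))"
    unfolding Cc_mem_iff using Cc_values[OF f] by (auto intro: continuous_map_eq)
  then show ?thesis by (simp add: continuous_map_k_iff)
qed

lemma fourier_coeff_lift: "fourier (coeff_fun (lift g)) = fourier g"
  by (rule fourier_cong) (rule coeff_lift)

text \<open>The operator \<open>\<pi> (k 1)\<close> is a projection that commutes with \<open>u\<close>.  Hence the integrated form maps \<open>\<xi>\<close> to the integral
  of the scalar function \<open>coeff_fun f\<close> against the orbit of \<open>\<eta> = \<pi> (k 1) \<xi>\<close>, and \<open>\<eta>\<close> is no longer than \<open>\<xi>\<close>.\<close>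
lemma integrated_form_le:
  fixes \<pi> :: "'b \<Rightarrow> 'x op" and u :: "complex \<Rightarrow> 'x op"
  assumes rep: "covariant_rep circle B \<beta> \<pi> u" and f: "f \<in> C_c" and \<xi>: "\<xi> \<in> ell2"
    and M: "\<And>n. cmod (fourier (coeff_fun f) n) \<le> M"
  shows "ell2_norm (integrated_form circ \<pi> u f \<xi>) \<le> M * ell2_norm \<xi>"
proof -
  note R = rep[unfolded covariant_rep_def circle_simps]
  have bounded_op_mem: "S \<zeta> \<in> ell2" if "bounded_op S" "\<zeta> \<in> ell2" for S :: "'x op" and \<zeta>
    using that(1)[unfolded bounded_op_def, THEN conjunct1] that(2) by (rule funcset_mem)
  have pi_mem: "\<pi> b \<zeta> \<in> ell2" if "b \<in> carrier B" "\<zeta> \<in> ell2" for b \<zeta>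
    using R[THEN conjunct1] that bounded_op_mem by simp
  have pi_scale: "\<pi> (ascale B c b) \<zeta> = (\<lambda>x. c * \<pi> b \<zeta> x)" if "b \<in> carrier B" "\<zeta> \<in> ell2" for c b \<zeta>
    using R[THEN conjunct2, THEN conjunct2, THEN conjunct1] that by simp
  have pi_mult: "\<pi> (amult B a b) \<zeta> = \<pi> a (\<pi> b \<zeta>)" if "a \<in> carrier B" "b \<in> carrier B" "\<zeta> \<in> ell2" for a b \<zeta>
    using R[THEN conjunct2, THEN conjunct2, THEN conjunct2, THEN conjunct1] that by simp
  have pi_star: "ell2_inner (\<pi> (astar B b) \<zeta>) \<eta> = ell2_inner \<zeta> (\<pi> b \<eta>)"
    if "b \<in> carrier B" "\<zeta> \<in> ell2" "\<eta> \<in> ell2" for b \<zeta> \<eta>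
    using R[THEN conjunct2, THEN conjunct2, THEN conjunct2, THEN conjunct2, THEN conjunct1] that by simp
  note U = R[THEN conjunct2, THEN conjunct2, THEN conjunct2, THEN conjunct2, THEN conjunct2, THEN conjunct1]
  have u_mem: "u s \<zeta> \<in> ell2" if "s \<in> S1" "\<zeta> \<in> ell2" for s \<zeta>
    using bspec[OF U that(1), THEN conjunct1] that(2) by (rule bounded_op_mem)
  have u_inner: "ell2_inner (u s \<zeta>) (u s \<eta>) = ell2_inner \<zeta> \<eta>"
    if "s \<in> S1" "\<zeta> \<in> ell2" "\<eta> \<in> ell2" for s \<zeta> \<eta>
    using bspec[OF U that(1), THEN conjunct2, THEN conjunct2] that by simp
  have u_mult: "u (s * t) \<zeta> = u s (u t \<zeta>)" if "s \<in> S1" "t \<in> S1" "\<zeta> \<in> ell2" for s t \<zeta>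
    using R[THEN conjunct2, THEN conjunct2, THEN conjunct2, THEN conjunct2, THEN conjunct2, THEN conjunct2, THEN conjunct1] that by simp
  have u_cont: "continuous_map (top_of_set S1) ell2_topology (\<lambda>s. u s \<zeta>)" if "\<zeta> \<in> ell2" for \<zeta>
    using R[THEN conjunct2, THEN conjunct2, THEN conjunct2, THEN conjunct2, THEN conjunct2, THEN conjunct2, THEN conjunct2, THEN conjunct1] that by simp
  have cov: "\<pi> (\<beta> s b) (u s \<zeta>) = u s (\<pi> b \<zeta>)" if "s \<in> S1" "b \<in> carrier B" "\<zeta> \<in> ell2" for s b \<zeta>
    using R[THEN conjunct2, THEN conjunct2, THEN conjunct2, THEN conjunct2, THEN conjunct2, THEN conjunct2, THEN conjunct2, THEN conjunct2] that by simp
  define \<eta> where "\<eta> = \<pi> (k 1) \<xi>"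
  have \<eta>: "\<eta> \<in> ell2" unfolding \<eta>_def by (intro pi_mem \<xi> k_mem)
  have "ell2_norm \<eta> \<le> ell2_norm \<xi>"
  proof -
    have "ell2_inner \<eta> \<eta> = ell2_inner \<xi> (\<pi> (k 1) \<eta>)"
      using pi_star[OF k_mem \<xi> \<eta>, of 1] by (simp add: k_star \<eta>_def)
    also have "\<pi> (k 1) \<eta> = \<eta>"
      using pi_mult[OF k_mem k_mem \<xi>, of 1 1] by (simp add: k_mult \<eta>_def)
    finally have "(ell2_norm \<eta>)\<^sup>2 = cmod (ell2_inner \<xi> \<eta>)"
      unfolding ell2_inner_self[OF \<eta>] using norm_of_real[of "(ell2_norm \<eta>)\<^sup>2", where 'a = complex]
      by simp
    also have "\<dots> \<le> ell2_norm \<xi> * ell2_norm \<eta>" by (rule ell2_Cauchy_Schwarz[OF \<xi> \<eta>])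
    finally show ?thesis
      using ell2_norm_nonneg[of \<eta>] ell2_norm_nonneg[of \<xi>]
      by (cases "ell2_norm \<eta> = 0") (simp_all add: power2_eq_square)
  qed
  have "stationary (\<lambda>s. u s \<eta>) (ell2_norm \<eta>)"
  proof
    fix s assume s: "s \<in> S1"
    show "u s \<eta> \<in> ell2" by (rule u_mem[OF s \<eta>])
    have "(ell2_norm (u s \<eta>))\<^sup>2 = (ell2_norm \<eta>)\<^sup>2"
      using u_inner[OF s \<eta> \<eta>] unfolding ell2_inner_self[OF \<eta>] ell2_inner_self[OF u_mem[OF s \<eta>]]
      by (simp only: of_real_eq_iff)
    then show "ell2_norm (u s \<eta>) \<le> ell2_norm \<eta>"
      using power2_le_imp_le[OF _ ell2_norm_nonneg] by (metis order_refl)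
  next
    show "continuous_map (top_of_set S1) ell2_topology (\<lambda>s. u s \<eta>)" by (rule u_cont[OF \<eta>])
    show "ell2_inner (u (r * s) \<eta>) (u (r * t) \<eta>) = ell2_inner (u s \<eta>) (u t \<eta>)"
      if "r \<in> S1" "s \<in> S1" "t \<in> S1" for r s t
      using that by (simp add: u_mult[OF _ _ \<eta>] u_inner u_mem[OF _ \<eta>] del: mem_sphere)
  qed
  then interpret W: stationary "\<lambda>s. u s \<eta>" "ell2_norm \<eta>" .
  have "integrated_form circ \<pi> u f \<xi> = W.V (coeff_fun f)"
  proof
    fix x
    show "integrated_form circ \<pi> u f \<xi> x = W.V (coeff_fun f) x"
      unfolding integrated_form_def W.V_def
    proof (intro Bochner_Integration.integral_cong refl)
      fix s assume "s \<in> space circ"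
      then have s: "s \<in> S1" by simp
      have "\<pi> (f s) (u s \<xi>) = \<pi> (ascale B (coeff_fun f s) (k 1)) (u s \<xi>)"
        using Cc_values[OF f s] by (simp add: k_scale)
      also have "\<dots> = (\<lambda>x. coeff_fun f s * \<pi> (\<beta> s (k 1)) (u s \<xi>) x)"
        using pi_scale[OF k_mem u_mem[OF s \<xi>]] k_act[OF s] by simp
      also have "\<pi> (\<beta> s (k 1)) (u s \<xi>) = u s \<eta>"
        unfolding \<eta>_def by (rule cov[OF s k_mem \<xi>])
      finally show "\<pi> (f s) (u s \<xi>) x = coeff_fun f s * u s \<eta> x" by simp
    qed
  qed
  then have "ell2_norm (integrated_form circ \<pi> u f \<xi>) \<le> M * ell2_norm \<eta>"
    using W.V_norm_le[OF coeff_continuous[OF f] M] by simp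
  also have "\<dots> \<le> M * ell2_norm \<xi>"
    using \<open>ell2_norm \<eta> \<le> ell2_norm \<xi>\<close> M[of 0] norm_ge_zero[of "fourier (coeff_fun f) 0"]
    by (intro mult_left_mono) linarith+
  finally show ?thesis .
qed

text \<open>A character of the circle acts on any Hilbert space by scalars; its integrated form is
  multiplication by a Fourier coefficient.\<close>
lemma scalar_covariant_rep:
  "covariant_rep circle B \<beta> (\<lambda>b \<xi> x. ki b * \<xi> x) (\<lambda>s \<xi> (x::'x). s powi n * \<xi> x)"
proof -
  have bop: "bounded_op (\<lambda>\<xi> (x::'x). c * \<xi> x)" for c
    unfolding bounded_op_def
    by (auto simp: ell2_scale ell2_norm_scale algebra_simps intro!: exI[of _ "cmod c"])
  have inner: "ell2_inner (\<lambda>x::'x. cnj c * \<xi> x) \<eta> = ell2_inner \<xi> (\<lambda>x. c * \<eta> x)" for c \<xi> \<eta>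
  proof -
    have "ell2_inner \<xi> (\<lambda>x. c * \<eta> x) = cnj (c * ell2_inner \<eta> \<xi>)"
      by (subst ell2_inner_cnj) (simp only: ell2_inner_scale_left)
    also have "\<dots> = cnj c * ell2_inner \<xi> \<eta>" by (simp add: ell2_inner_cnj[of \<xi> \<eta>])
    finally show ?thesis by (simp only: ell2_inner_scale_left)
  qed
  have unitary: "(\<lambda>\<xi> (x::'x). s powi n * \<xi> x) ` ell2 = ell2"
    "ell2_inner (\<lambda>x::'x. s powi n * \<xi> x) (\<lambda>x. s powi n * \<eta> x) = ell2_inner \<xi> \<eta>" if s: "s \<in> S1" for s \<xi> \<eta>
  proof -
    have nz: "s powi n * s powi (-n) = 1" using s S1_nonzero[OF s] by (simp flip: power_int_add)
    show "(\<lambda>\<xi> (x::'x). s powi n * \<xi> x) ` ell2 = ell2"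
    proof (intro equalityI subsetI)
      fix \<xi> :: "'x \<Rightarrow> complex" assume "\<xi> \<in> ell2"
      then have "(\<lambda>x. s powi (-n) * \<xi> x) \<in> ell2" by (rule ell2_scale)
      moreover have "\<xi> = (\<lambda>x. s powi n * (s powi (-n) * \<xi> x))"
        using nz by (simp flip: mult.assoc)
      ultimately show "\<xi> \<in> (\<lambda>\<xi> (x::'x). s powi n * \<xi> x) ` ell2" 
        by (rule rev_image_eqI[where f = "\<lambda>\<xi> x. s powi n * \<xi> x"])
    qed (auto intro: ell2_scale)
    have "cnj (s powi n) * s powi n = 1"
      using complex_norm_square[of "s powi n"] norm_powi_S1[OF s, of n] by (simp add: mult.commute)
    then show "ell2_inner (\<lambda>x::'x. s powi n * \<xi> x) (\<lambda>x. s powi n * \<eta> x) = ell2_inner \<xi> \<eta>"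
      by (simp add: inner[symmetric] flip: mult.assoc)
  qed
  show ?thesis
    unfolding covariant_rep_def circle_simps
    using bop inner unitary
    by (auto simp: k_carrier k_add k_mult k_scale k_star k_act power_int_mult_distrib
          mult.assoc mult.left_commute distrib_right
        simp del: complex_cnj_mult
        intro!: continuous_map_ell2_scale continuous_intros)
qed

lemma op_norm_scalar_ge: "cmod c \<le> op_norm (\<lambda>\<xi> (x::'x). c * \<xi> x)"
proof -
  \<comment> \<open>A unit vector, on which the scalar operator attains its norm.\<close>
  define \<delta> :: "'x \<Rightarrow> complex" where "\<delta> = (\<lambda>x. if x = undefined then 1 else 0)"
  have fin: "(\<Sum>x\<in>F. (cmod (\<delta> x))\<^sup>2) \<le> 1\<^sup>2" if "finite F" for F
  proof -
    have "(\<Sum>x\<in>F. (cmod (\<delta> x))\<^sup>2) = (\<Sum>x\<in>F. if x = undefined then 1 else 0)"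
      by (intro sum.cong) (auto simp: \<delta>_def)
    then show ?thesis using that by simp
  qed
  have \<delta>: "\<delta> \<in> ell2" "ell2_norm \<delta> \<le> 1"
    by (rule ell2I[OF fin], assumption, rule ell2_norm_leI[OF fin], simp_all)
  then have 1: "ell2_norm \<delta> = 1" using ell2_coord_le[OF \<delta>(1), of undefined] by (simp add: \<delta>_def)
  have "bdd_above {ell2_norm (\<lambda>x. c * \<xi> x) | \<xi> :: 'x \<Rightarrow> complex. \<xi> \<in> ell2 \<and> ell2_norm \<xi> \<le> 1}"
    by (auto simp: bdd_above_def ell2_norm_scale intro!: exI[of _ "cmod c"] mult_left_le)
  then have "ell2_norm (\<lambda>x. c * \<delta> x) \<le> op_norm (\<lambda>\<xi> (x::'x). c * \<xi> x)"
    unfolding op_norm_def using \<delta> by (intro cSup_upper) auto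
  then show ?thesis by (simp add: ell2_norm_scale 1)
qed

lemma universal_norm_eq:
  assumes f: "f \<in> C_c"
  shows "universal_norm circle circ B \<beta> f = sup_norm (fourier (coeff_fun f))"
proof -
  let ?M = "sup_norm (fourier (coeff_fun f))"
  let ?N = "{op_norm (integrated_form circ \<pi> u f) |
      (\<pi> :: 'b \<Rightarrow> (complex \<Rightarrow> 'b) op) (u :: complex \<Rightarrow> (complex \<Rightarrow> 'b) op). covariant_rep circle B \<beta> \<pi> u}"
  have bd: "bounded (range (fourier (coeff_fun f)))"
    by (rule fourier_bounded[OF coeff_continuous[OF f]])
  have le: "cmod (fourier (coeff_fun f) n) \<le> ?M" for n by (rule sup_norm_ge[OF bd])
  have upper: "y \<le> ?M" if "y \<in> ?N" for y
  proof -
    obtain \<pi> :: "'b \<Rightarrow> (complex \<Rightarrow> 'b) op" and u :: "complex \<Rightarrow> (complex \<Rightarrow> 'b) op"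
      where rep: "covariant_rep circle B \<beta> \<pi> u" and y: "y = op_norm (integrated_form circ \<pi> u f)"
      using \<open>y \<in> ?N\<close> by blast
    show ?thesis unfolding y op_norm_def
    proof (rule cSup_least)
      show "{ell2_norm (integrated_form circ \<pi> u f \<xi>) |\<xi>. \<xi> \<in> ell2 \<and> ell2_norm \<xi> \<le> 1} \<noteq> {}"
        using ell2_zero ell2_norm_zero by (metis (mono_tags, lifting) empty_iff mem_Collect_eq zero_le_one)
      fix z assume "z \<in> {ell2_norm (integrated_form circ \<pi> u f \<xi>) |\<xi>. \<xi> \<in> ell2 \<and> ell2_norm \<xi> \<le> 1}"
      then obtain \<xi> where \<xi>: "\<xi> \<in> ell2" "ell2_norm \<xi> \<le> 1" and z: "z = ell2_norm (integrated_form circ \<pi> u f \<xi>)"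
        by blast
      have "z \<le> ?M * ell2_norm \<xi>" unfolding z by (rule integrated_form_le[OF rep f \<xi>(1) le])
      also have "\<dots> \<le> ?M" using \<xi>(2) sup_norm_nonneg[OF bd] by (rule mult_left_le)
      finally show "z \<le> ?M" .
    qed
  qed
  have lower: "cmod (fourier (coeff_fun f) n) \<le> Sup ?N" for n
  proof -
    let ?\<pi> = "\<lambda>b \<xi> (x :: complex \<Rightarrow> 'b). ki b * \<xi> x" and ?u = "\<lambda>s \<xi> (x :: complex \<Rightarrow> 'b). s powi n * \<xi> x"
    have "integrated_form circ ?\<pi> ?u f = (\<lambda>\<xi> x. fourier (coeff_fun f) n * \<xi> x)"
      unfolding integrated_form_def fourier_def coeff_fun_def by (simp flip: mult.assoc)
    then have "cmod (fourier (coeff_fun f) n) \<le> op_norm (integrated_form circ ?\<pi> ?u f)"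
      by (simp add: op_norm_scalar_ge)
    also have "\<dots> \<le> Sup ?N"
      using scalar_covariant_rep[of n] upper
      by (intro cSup_upper) (blast, auto simp: bdd_above_def)
    finally show ?thesis .
  qed
  have "Sup ?N \<le> ?M"
    using scalar_covariant_rep[of 0] by (intro cSup_least upper) blast
  moreover have "?M \<le> Sup ?N" by (rule sup_norm_le[OF lower])
  ultimately show ?thesis unfolding universal_norm_def by (rule antisym)
qed

text \<open>A functional is determined by its value at \<open>k 1\<close>, so it commutes with the scalar integral;
  the functional \<open>ki\<close> shows that no other element has this property.\<close>
lemma alg_integral_k:
  assumes h: "\<And>r. r \<in> S1 \<Longrightarrow> h r = k (\<phi> r)"
  shows "alg_integral B circ h = k (\<integral>r. \<phi> r \<partial>circ)"
  unfolding alg_integral_def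
proof (rule the_equality)
  show "k (\<integral>r. \<phi> r \<partial>circ) \<in> carrier B \<and>
      (\<forall>\<psi>\<in>bounded_functionals B. \<psi> (k (\<integral>r. \<phi> r \<partial>circ)) = (\<integral>s. \<psi> (h s) \<partial>circ))"
  proof (intro conjI ballI k_mem)
    fix \<psi> assume "\<psi> \<in> bounded_functionals B"
    then have scale: "\<psi> (ascale B c (k 1)) = c * \<psi> (k 1)" for c
      unfolding bounded_functionals_def using k_mem[of 1] by blast
    have \<psi>: "\<psi> (k c) = c * \<psi> (k 1)" for c
      using scale[of c] unfolding k_scale mult_1_right .
    have "(\<integral>s. \<psi> (h s) \<partial>circ) = (\<integral>s. \<phi> s * \<psi> (k 1) \<partial>circ)"
      by (intro Bochner_Integration.integral_cong refl) (simp add: h \<psi>[of "\<phi> _"])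
    then show "\<psi> (k (\<integral>r. \<phi> r \<partial>circ)) = (\<integral>s. \<psi> (h s) \<partial>circ)"
      by (simp add: \<psi>[of "\<integral>r. \<phi> r \<partial>circ"])
  qed
next
  fix b assume b: "b \<in> carrier B \<and> (\<forall>\<psi>\<in>bounded_functionals B. \<psi> b = (\<integral>s. \<psi> (h s) \<partial>circ))"
  have "ki \<in> bounded_functionals B"
    unfolding bounded_functionals_def by (auto simp: k_carrier k_add k_scale k_norm intro!: exI[of _ 1])
  then have "ki b = (\<integral>s. ki (h s) \<partial>circ)" using b by blast
  also have "\<dots> = (\<integral>s. \<phi> s \<partial>circ)"
    by (intro Bochner_Integration.integral_cong refl) (simp add: h)
  finally show "b = k (\<integral>r. \<phi> r \<partial>circ)" using b k_ki by metis
qed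

abbreviation CA :: "(complex \<Rightarrow> 'b) star_alg" where
  "CA \<equiv> conv_alg circle circ B \<beta>"

lemma CA_carrier: "carrier CA = C_c"
  by (simp add: conv_alg_def)

lemma CA_zero: "azero CA = lift (\<lambda>s. 0)"
  by (simp add: conv_alg_def lift_def k_zero)

lemma CA_add: "f \<in> C_c \<Longrightarrow> g \<in> C_c \<Longrightarrow> aadd CA f g = lift (\<lambda>s. coeff_fun f s + coeff_fun g s)"
  unfolding conv_alg_def lift_def
  by (auto intro!: restrict_ext simp: Cc_values k_add simp del: mem_sphere)

lemma CA_scale: "f \<in> C_c \<Longrightarrow> ascale CA c f = lift (\<lambda>s. c * coeff_fun f s)"
  unfolding conv_alg_def lift_def
  by (auto intro!: restrict_ext simp: Cc_values k_scale simp del: mem_sphere)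

lemma CA_star: 
  assumes "f \<in> C_c" shows "astar CA f = lift (\<lambda>s. cnj (coeff_fun f (inverse s)))"
proof -
  have "\<beta> s (astar B (f (inv\<^bsub>circle\<^esub> s))) = k (cnj (coeff_fun f (inverse s)))" if s: "s \<in> S1" for s
  proof -
    have "inverse s \<in> S1" using s by (simp add: norm_inverse)
    then show ?thesis using circle_inv[OF s] by (simp add: Cc_values[OF assms] k_star k_act[OF s] del: mem_sphere)
  qed
  then show ?thesis unfolding conv_alg_def lift_def by (auto intro!: restrict_ext simp del: mem_sphere)
qed

lemma CA_mult:
  assumes "f \<in> C_c" "g \<in> C_c"
  shows "amult CA f g = lift (conv (coeff_fun f) (coeff_fun g))"
proof -
  have "alg_integral B circ (\<lambda>r. amult B (f r) (\<beta> r (g (inv\<^bsub>circle\<^esub> r * s))))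
      = k (conv (coeff_fun f) (coeff_fun g) s)" if s: "s \<in> S1" for s
    unfolding conv_def
  proof (rule alg_integral_k)
    fix r assume r: "r \<in> S1"
    have "inverse r * s \<in> S1" using r s by (simp add: norm_inverse norm_mult)
    then show "amult B (f r) (\<beta> r (g (inv\<^bsub>circle\<^esub> r * s))) = k (coeff_fun f r * coeff_fun g (inverse r * s))"
      by (simp add: circle_inv[OF r] Cc_values[OF assms(1) r] Cc_values[OF assms(2)] k_act[OF r] k_mult del: mem_sphere)
  qed
  then show ?thesis unfolding conv_alg_def lift_def by (auto intro!: restrict_ext simp del: mem_sphere)
qed

lemma CA_function_alg: "function_alg CA (\<lambda>f. fourier (coeff_fun f))"
proof
  show "inj_on (\<lambda>f. fourier (coeff_fun f)) (carrier CA)"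
  proof (rule inj_onI, unfold CA_carrier)
    fix f g assume fg: "f \<in> C_c" "g \<in> C_c" and eq: "fourier (coeff_fun f) = fourier (coeff_fun g)"
    have "coeff_fun f s - coeff_fun g s = 0" if "s \<in> S1" for s
    proof (rule fourier_inj[OF _ _ that])
      show "continuous_on S1 (\<lambda>s. coeff_fun f s - coeff_fun g s)"
        by (intro continuous_intros coeff_continuous fg)
      show "fourier (\<lambda>s. coeff_fun f s - coeff_fun g s) n = 0" for n
        by (simp add: fourier_diff coeff_continuous fg eq)
    qed
    then have "lift (coeff_fun f) = lift (coeff_fun g)" by (intro lift_cong) simp
    then show "f = g" using fg lift_coeff by metis
  qed
  show "azero CA \<in> carrier CA" by (simp add: CA_carrier CA_zero lift_mem)
  show "fourier (coeff_fun (azero CA)) = (\<lambda>i. 0)"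
    by (simp add: CA_zero fourier_coeff_lift fun_eq_iff) (simp add: fourier_def)
  show "bounded (range (fourier (coeff_fun f)))" if "f \<in> carrier CA" for f
    using that by (simp add: CA_carrier fourier_bounded coeff_continuous)
  show "anorm CA f = sup_norm (fourier (coeff_fun f))" if "f \<in> carrier CA" for f
    using that universal_norm_eq[of f] by (simp add: CA_carrier) (simp add: conv_alg_def)
  fix f g :: "complex \<Rightarrow> 'b"
  assume f: "f \<in> carrier CA"
  then have fc: "continuous_on S1 (coeff_fun f)" by (simp add: CA_carrier coeff_continuous)
  show "ascale CA c f \<in> carrier CA" for c
    using f by (simp add: CA_carrier CA_scale lift_mem continuous_intros fc)
  show "fourier (coeff_fun (ascale CA c f)) = (\<lambda>n. c * fourier (coeff_fun f) n)" for c
    using f by (simp add: CA_carrier CA_scale fourier_coeff_lift fun_eq_iff fourier_scale)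
  have fi: "continuous_on S1 (\<lambda>s. coeff_fun f (inverse s))"
    by (rule continuous_on_compose2[OF fc]) (auto intro!: continuous_intros simp: norm_inverse)
  show "astar CA f \<in> carrier CA"
    using f by (simp add: CA_carrier CA_star lift_mem continuous_intros fi)
  show "fourier (coeff_fun (astar CA f)) = (\<lambda>n. cnj (fourier (coeff_fun f) n))"
    using f by (simp add: CA_carrier CA_star fourier_coeff_lift fun_eq_iff fourier_involution[OF fc])
  assume g: "g \<in> carrier CA"
  then have gc: "continuous_on S1 (coeff_fun g)" by (simp add: CA_carrier coeff_continuous)
  show "aadd CA f g \<in> carrier CA"
    using f g by (simp add: CA_carrier CA_add lift_mem continuous_intros fc gc)
  show "fourier (coeff_fun (aadd CA f g)) = (\<lambda>n. fourier (coeff_fun f) n + fourier (coeff_fun g) n)"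
    using f g by (simp add: CA_carrier CA_add fourier_coeff_lift fun_eq_iff fourier_add[OF fc gc])
  show "amult CA f g \<in> carrier CA"
    using f g by (simp add: CA_carrier CA_mult lift_mem continuous_conv fc gc)
  show "fourier (coeff_fun (amult CA f g)) = (\<lambda>n. fourier (coeff_fun f) n * fourier (coeff_fun g) n)"
    using f g by (simp add: CA_carrier CA_mult fourier_coeff_lift fun_eq_iff fourier_conv[OF fc gc])
qed

lemma CA_image: "(\<lambda>f. fourier (coeff_fun f)) ` carrier CA = {fourier g | g. continuous_on S1 g}"
proof (intro Set.set_eqI iffI)
  fix a assume "a \<in> {fourier g | g. continuous_on S1 g}"
  then obtain g where "continuous_on S1 g" "a = fourier g" by blast
  then show "a \<in> (\<lambda>f. fourier (coeff_fun f)) ` carrier CA"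
    unfolding CA_carrier by (metis fourier_coeff_lift image_eqI lift_mem)
qed (auto simp: CA_carrier coeff_continuous)

end

section \<open>The dual group of the circle\<close>

text \<open>A character is not zero, so it has a coefficient of some order \<open>n\<close> that is not zero.  By translation invariance
  this coefficient is multiplied by \<open>\<gamma> s * s\<^sup>n\<close>, which therefore equals one.\<close>
lemma character_is_power:
  assumes \<gamma>: "\<gamma> \<in> characters circle"
  obtains m where "\<And>s. s \<in> S1 \<Longrightarrow> \<gamma> s = s powi m"
proof -
  have mult: "\<gamma> (s * t) = \<gamma> s * \<gamma> t" if "s \<in> S1" "t \<in> S1" for s t
    using \<gamma> that unfolding characters_def by simp
  have norm: "cmod (\<gamma> s) = 1" if "s \<in> S1" for s
    using \<gamma> that unfolding characters_def by simp
  have cont: "continuous_on S1 \<gamma>"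
    using \<gamma> unfolding characters_def by simp
  obtain n where n: "fourier \<gamma> n \<noteq> 0"
    using fourier_inj[OF cont, of 1] norm[of 1] by (metis dist_0_norm mem_sphere norm_one norm_zero zero_neq_one)
  have "\<gamma> s = s powi (- n)" if s: "s \<in> S1" for s
  proof -
    have c: "continuous_on S1 (\<lambda>r. \<gamma> r * r powi n)" by (intro continuous_intros cont)
    have "fourier \<gamma> n = (\<integral>r. \<gamma> (s * r) * (s * r) powi n \<partial>circ)"
      unfolding fourier_def using circ_integral_rotate[OF s continuous_circ_measurable[OF c]] by simp
    also have "\<dots> = (\<integral>r. (\<gamma> s * s powi n) * (\<gamma> r * r powi n) \<partial>circ)"
      by (intro Bochner_Integration.integral_cong refl)
        (use s in \<open>simp add: mult power_int_mult_distrib del: mem_sphere\<close>)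
    also have "\<dots> = (\<gamma> s * s powi n) * fourier \<gamma> n" by (simp add: fourier_def)
    finally have "\<gamma> s * s powi n = 1" using n by simp
    then show ?thesis by (simp add: power_int_minus inverse_eq_divide field_simps) (metis mult_eq_0_iff zero_neq_one nonzero_eq_divide_eq mult.commute)
  qed
  then show ?thesis using that by blast
qed

text \<open>As long as \<open>w\<close> is within distance one of \<open>1\<close> on the circle, \<open>\<bar>w + 1\<bar>\<^sup>2 \<ge> 3\<close>, so squaring expands the distance to \<open>1\<close> by
  a factor of at least \<open>\<surd>3\<close>.  Iterated squares of \<open>z \<noteq> 1\<close> would leave the disc.\<close>
lemma small_powers_trivial:
  fixes z :: complex
  assumes norm: "cmod z = 1" and small: "\<And>k. cmod (z ^ k - 1) < 1"
  shows "z = 1"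
proof (rule ccontr)
  assume "z \<noteq> 1"
  have step: "(cmod (w\<^sup>2 - 1))\<^sup>2 \<ge> 3 * (cmod (w - 1))\<^sup>2" if w: "cmod w = 1" "cmod (w - 1) < 1" for w
  proof -
    have w1: "(Re w)\<^sup>2 + (Im w)\<^sup>2 = 1" using w(1) by (simp add: cmod_def)
    have "(cmod (w - 1))\<^sup>2 < 1" using w(2) by (simp add: abs_square_less_1)
    moreover have "(cmod (w - 1))\<^sup>2 = 2 - 2 * Re w" "(cmod (w + 1))\<^sup>2 = 2 + 2 * Re w"
      using w1 by (simp_all add: cmod_power2 power2_diff power2_sum)
    ultimately have "(cmod (w + 1))\<^sup>2 \<ge> 3" by linarith
    moreover have "w\<^sup>2 - 1 = (w + 1) * (w - 1)" by (simp add: power2_eq_square algebra_simps)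
    ultimately show ?thesis by (simp add: norm_mult power_mult_distrib mult_right_mono)
  qed
  have grow: "(cmod (z ^ (2 ^ k) - 1))\<^sup>2 \<ge> 3 ^ k * (cmod (z - 1))\<^sup>2" for k
  proof (induction k)
    case (Suc k)
    have "3 ^ Suc k * (cmod (z - 1))\<^sup>2 \<le> 3 * (cmod (z ^ (2 ^ k) - 1))\<^sup>2" using Suc by simp
    also have "\<dots> \<le> (cmod ((z ^ (2 ^ k))\<^sup>2 - 1))\<^sup>2"
      by (rule step) (use norm small in \<open>simp_all add: norm_power\<close>)
    also have "(z ^ (2 ^ k))\<^sup>2 = z ^ (2 ^ Suc k)" by (simp add: power_mult[symmetric] mult.commute)
    finally show ?case .
  qed simp
  have "(cmod (z - 1))\<^sup>2 > 0" using \<open>z \<noteq> 1\<close> by simp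
  then obtain k where "1 / (cmod (z - 1))\<^sup>2 < 3 ^ k"
    using real_arch_pow[of 3 "1 / (cmod (z - 1))\<^sup>2"] by auto
  then have "1 < 3 ^ k * (cmod (z - 1))\<^sup>2" using \<open>(cmod (z - 1))\<^sup>2 > 0\<close> by (simp add: field_simps)
  also have "\<dots> \<le> (cmod (z ^ (2 ^ k) - 1))\<^sup>2" by (rule grow)
  finally have "1 < (cmod (z ^ (2 ^ k) - 1))\<^sup>2" .
  moreover have "(cmod (z ^ (2 ^ k) - 1))\<^sup>2 < 1" using small[of "2 ^ k"] by (simp add: abs_square_less_1)
  ultimately show False by simp
qed

text \<open>The powers of the quotient at \<open>s\<close> are the quotients at the powers of \<open>s\<close>, so they all stay close to one.\<close>
lemma characters_close_eq:
  assumes \<gamma>: "\<gamma> \<in> characters circle" and \<delta>: "\<delta> \<in> characters circle"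
    and close: "\<And>s. s \<in> S1 \<Longrightarrow> cmod (\<gamma> s - \<delta> s) < 1"
  shows "\<gamma> = \<delta>"
proof -
  obtain m where m: "\<And>s. s \<in> S1 \<Longrightarrow> \<gamma> s = s powi m" using character_is_power[OF \<gamma>] by blast
  obtain n where n: "\<And>s. s \<in> S1 \<Longrightarrow> \<delta> s = s powi n" using character_is_power[OF \<delta>] by blast
  have "\<gamma> s = \<delta> s" if s: "s \<in> S1" for s
  proof -
    define z where "z = s powi (m - n)"
    have "cmod (z ^ k - 1) < 1" for k
    proof -
      have sk: "s ^ k \<in> S1" "s ^ k \<noteq> 0" using s by (auto simp: norm_power)
      have zk: "z ^ k = (s ^ k) powi (m - n)"
        by (simp add: z_def power_int_power power_int_power' mult.commute)
      have "(s ^ k) powi m - (s ^ k) powi n = (s ^ k) powi n * (z ^ k - 1)"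
        unfolding zk using sk(2) by (simp add: right_diff_distrib flip: power_int_add)
      then have "cmod (\<gamma> (s ^ k) - \<delta> (s ^ k)) = cmod (z ^ k - 1)"
        using norm_powi_S1[OF sk(1), of n] by (simp add: m[OF sk(1)] n[OF sk(1)] norm_mult)
      then show ?thesis using close[OF sk(1)] by simp
    qed
    moreover have "cmod z = 1" unfolding z_def by (rule norm_powi_S1[OF s])
    ultimately have "z = 1" by (intro small_powers_trivial)
    then have "s powi m = s powi n"
      using S1_nonzero[OF s] by (simp add: z_def power_int_diff)
    then show ?thesis by (simp add: m[OF s] n[OF s])
  qed
  moreover have "\<gamma> \<in> extensional S1" "\<delta> \<in> extensional S1"
    using \<gamma> \<delta> by (simp_all add: characters_def)
  ultimately show ?thesis by (intro extensionalityI[of \<gamma> S1])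
qed

text \<open>The empty compact set imposes no condition, so the set of all characters is itself a subbasic open set.\<close>
lemma topspace_dual_circle: "topspace (dual_space circle) = characters circle"
proof -
  have "characters circle \<in> {{\<gamma> \<in> characters circle. \<gamma> ` K \<subseteq> U} | K U. compactin (gtop circle) K \<and> open U}"
    by (intro CollectI exI[of _ "{}"]) auto
  then show ?thesis unfolding dual_space_def by (simp add: topology_generated_by_topspace) blast
qed

text \<open>Cover the circle by finitely many arcs on which \<open>\<gamma>\<close> varies by less than one half.  Characters
  whose values on each arc lie in the disc of radius one half around the value of \<open>\<gamma>\<close> at its centre
  have distance less than one from \<open>\<gamma>\<close>, hence equal \<open>\<gamma>\<close>.\<close>
lemma dual_circle_discrete:
  assumes \<gamma>: "\<gamma> \<in> characters circle"
  shows "openin (dual_space circle) {\<gamma>}"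
proof -
  have cont: "continuous_on S1 \<gamma>"
    using \<gamma> unfolding characters_def by simp
  have "uniformly_continuous_on S1 \<gamma>" by (rule compact_uniformly_continuous[OF cont]) simp
  then obtain d where d: "d > 0" "\<And>s t. s \<in> S1 \<Longrightarrow> t \<in> S1 \<Longrightarrow> dist t s < d \<Longrightarrow> dist (\<gamma> t) (\<gamma> s) < 1 / 2"
    unfolding uniformly_continuous_on_def by (metis zero_less_divide_1_iff zero_less_numeral)
  obtain C where C: "finite C" "C \<subseteq> S1" "S1 \<subseteq> (\<Union>c\<in>C. ball c (d / 2))"
  proof -
    have "compact S1" by simp
    then obtain C' where "C' \<subseteq> S1" "finite C'" "S1 \<subseteq> (\<Union>c\<in>C'. ball c (d / 2))"
    proof (rule compactE_image)
      show "S1 \<subseteq> (\<Union>c\<in>S1. ball c (d / 2))" using d(1) by force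
    qed auto
    then show ?thesis using that by blast
  qed
  define K where "K c = S1 \<inter> cball c (d / 2)" for c
  define W where "W c = {\<delta> \<in> characters circle. \<delta> ` K c \<subseteq> ball (\<gamma> c) (1 / 2)}" for c
  have "compactin (gtop circle) (K c)" for c
    unfolding K_def by (auto simp: compactin_subtopology intro: compact_Int_closed)
  then have W_open: "openin (dual_space circle) (W c)" for c
    unfolding dual_space_def W_def by (intro topology_generated_by_Basis) blast
  have "(\<Inter>c\<in>C. W c) \<inter> characters circle = {\<gamma>}"
  proof (intro equalityI subsetI)
    fix \<delta> assume \<delta>: "\<delta> \<in> (\<Inter>c\<in>C. W c) \<inter> characters circle"
    have "cmod (\<delta> s - \<gamma> s) < 1" if s: "s \<in> S1" for s
    proof -
      obtain c where c: "c \<in> C" "s \<in> ball c (d / 2)" using C(3) s by blast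
      have "s \<in> K c" using c s by (simp add: K_def)
      moreover have "\<delta> ` K c \<subseteq> ball (\<gamma> c) (1 / 2)" using \<delta> c(1) by (auto simp: W_def)
      ultimately have "\<delta> s \<in> ball (\<gamma> c) (1 / 2)" by blast
      then have "dist (\<gamma> c) (\<delta> s) < 1 / 2" by (simp only: mem_ball)
      moreover have "dist s c < d" using c(2) d(1) by (simp add: dist_commute)
      then have "dist (\<gamma> s) (\<gamma> c) < 1 / 2" using d(2)[of c s] s C(2) c(1) by blast
      ultimately have "dist (\<gamma> s) (\<delta> s) < 1"
        using dist_triangle[of "\<gamma> s" "\<delta> s" "\<gamma> c"] by linarith
      then show ?thesis by (simp add: dist_norm norm_minus_commute)
    qed
    then show "\<delta> \<in> {\<gamma>}" using characters_close_eq[of \<delta> \<gamma>] \<delta> \<gamma> by blast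
  next
    fix \<delta> assume "\<delta> \<in> {\<gamma>}"
    moreover have "\<gamma> \<in> W c" if c: "c \<in> C" for c
    proof -
      have "dist (\<gamma> c) (\<gamma> s) < 1 / 2" if "s \<in> K c" for s
      proof -
        have "s \<in> S1" "dist s c < d" using that d(1) by (auto simp: K_def dist_commute)
        then show ?thesis using d(2)[of c s] C(2) c by (simp add: dist_commute subset_iff del: mem_sphere)
      qed
      then show ?thesis using \<gamma> by (auto simp: W_def)
    qed
    ultimately show "\<delta> \<in> (\<Inter>c\<in>C. W c) \<inter> characters circle" using \<gamma> by blast
  qed
  moreover have "openin (dual_space circle) ((\<Inter>c\<in>C. W c) \<inter> characters circle)"
  proof (cases "C = {}")
    case True
    then show ?thesis using topspace_dual_circle by (metis Int_UNIV_left INT_empty openin_topspace)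
  next
    case False
    then have "openin (dual_space circle) (\<Inter>c\<in>C. W c)"
      using C(1) W_open by (intro openin_INT2) auto
    then show ?thesis using topspace_dual_circle by (metis openin_Int openin_topspace)
  qed
  ultimately show ?thesis by simp
qed

lemma continuous_map_dual_circle:
  assumes "\<And>\<gamma>. \<gamma> \<in> characters circle \<Longrightarrow> f \<gamma> \<in> topspace Y"
  shows "continuous_map (dual_space circle) Y f"
proof -
  have "openin (dual_space circle) X" if X: "X \<subseteq> characters circle" for X
  proof -
    have "openin (dual_space circle) (\<Union>\<gamma>\<in>X. {\<gamma>})"
      using X dual_circle_discrete by (intro openin_Union) blast
    then show ?thesis by simp
  qed
  then show ?thesis using assms by (auto simp: continuous_map_def topspace_dual_circle)
qed

section \<open>The ultrapower of the complex numbers\<close>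

definition Calg :: "complex star_alg" where
  "Calg = \<lparr>carrier = UNIV, aadd = (+), azero = 0, amult = (*), ascale = (*), astar = cnj, anorm = cmod\<rparr>"

lemma Calg_simps [simp]:
  "carrier Calg = UNIV" "aadd Calg = (+)" "azero Calg = 0" "amult Calg = (*)"
  "ascale Calg = (*)" "astar Calg = cnj" "anorm Calg = cmod"
  by (simp_all add: Calg_def)

lemma adist_Calg: "adist Calg = dist"
  by (simp add: fun_eq_iff adist_def dist_norm)

lemma cstar_algebra_Calg: "cstar_algebra Calg"
proof (rule cstar_algebra.intro)
  show "comm_group \<lparr>carrier = carrier Calg, monoid.mult = aadd Calg, one = azero Calg\<rparr>" (is "comm_group ?G")
  proof (rule comm_groupI)
    show "\<exists>y\<in>carrier ?G. y \<otimes>\<^bsub>?G\<^esub> x = \<one>\<^bsub>?G\<^esub>" for x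
      by (auto intro: exI[of _ "- x"])
  qed auto
  show "Metric_space.mcomplete (carrier Calg) (adist Calg)"
    by (simp add: adist_Calg mcomplete_iff_complete complete_UNIV)
  show "anorm Calg (amult Calg (astar Calg x) x) = (anorm Calg x)\<^sup>2" for x
    by (simp add: norm_mult power2_eq_square)
qed (auto simp: algebra_simps norm_mult norm_triangle_ineq)

abbreviation trivial_action :: "complex \<Rightarrow> complex \<Rightarrow> complex" where
  "trivial_action \<equiv> \<lambda>s c. c"

lemma cont_action_trivial: "cont_action circle Calg trivial_action"
  by (auto simp: cont_action_def star_hom_def bij_betw_def atopology_def adist_Calg)

lemma complex_copy_Calg: "complex_copy Calg (\<lambda>c. c) trivial_action"
  by unfold_locales auto

lemma function_alg_Calg: "function_alg Calg (\<lambda>c (_::unit). c)"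
  by unfold_locales (auto simp: inj_on_def fun_eq_iff sup_norm_def)

text \<open>By compactness the sequence has a cluster point along \<open>\<omega>\<close>, and a cluster point along an ultrafilter is a limit.\<close>
lemma ultrafilter_limit:
  fixes x :: "nat \<Rightarrow> complex"
  assumes \<omega>: "free_ultrafilter \<omega>" and x: "\<And>n. cmod (x n) \<le> K"
  obtains L where "(x \<longlongrightarrow> L) \<omega>"
proof -
  have nb: "filtermap x \<omega> \<noteq> bot" using \<omega> by (simp add: free_ultrafilter_def filtermap_bot_iff)
  have "compact (cball (0::complex) K)" by simp
  moreover have "eventually (\<lambda>z. z \<in> cball 0 K) (filtermap x \<omega>)"
    using x by (simp add: eventually_filtermap)
  ultimately obtain L where L: "inf (nhds L) (filtermap x \<omega>) \<noteq> bot"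
    using nb unfolding compact_filter by blast
  have "(x \<longlongrightarrow> L) \<omega>"
  proof (rule topological_tendstoI)
    fix S assume S: "open S" "L \<in> S"
    show "\<forall>\<^sub>F n in \<omega>. x n \<in> S"
    proof (rule ccontr)
      assume "\<not> (\<forall>\<^sub>F n in \<omega>. x n \<in> S)"
      then have "\<forall>\<^sub>F n in \<omega>. x n \<notin> S" using \<omega> unfolding free_ultrafilter_def by blast
      then have "\<forall>\<^sub>F z in filtermap x \<omega>. z \<notin> S" by (simp add: eventually_filtermap)
      moreover have "\<forall>\<^sub>F z in nhds L. z \<in> S" using S by (rule eventually_nhds_in_open)
      ultimately have "\<forall>\<^sub>F z in inf (nhds L) (filtermap x \<omega>). False"
        unfolding eventually_inf by (metis (mono_tags, lifting))
      then show False using L by (simp add: trivial_limit_def)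
    qed
  qed
  then show ?thesis using that by blast
qed

lemma linf_Calg: "x \<in> carrier (linf Calg) \<longleftrightarrow> (\<exists>K. \<forall>n. cmod (x n) \<le> K)"
  by (auto simp: linf_def bdd_above_def)

lemma uclass_Calg_eq_iff:
  assumes "x \<in> carrier (linf Calg)" "y \<in> carrier (linf Calg)"
  shows "uclass \<omega> Calg x = uclass \<omega> Calg y \<longleftrightarrow> ((\<lambda>n. dist (x n) (y n)) \<longlongrightarrow> 0) \<omega>"
proof -
  interpret C: function_alg Calg "\<lambda>c (_::unit). c" by (rule function_alg_Calg)
  interpret Q: seq_quotient Calg "\<lambda>c (_::unit). c" "linf Calg" "null_ideal \<omega> Calg" \<omega>
    by (rule C.ultrapower_quotient)
  show ?thesis
    using Q.coset_eq_iff[OF assms] by (simp add: uclass_def Q.sim_def adist_Calg)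
qed

lemma uclass_Calg_const:
  assumes "x \<in> carrier (linf Calg)" "(x \<longlongrightarrow> L) \<omega>"
  shows "uclass \<omega> Calg x = uclass \<omega> Calg (\<lambda>_. L)"
  by (subst uclass_Calg_eq_iff)
    (use assms in \<open>auto simp: linf_Calg tendsto_dist_iff[symmetric] intro!: exI[of _ "cmod L"]\<close>)

abbreviation Ult :: "nat filter \<Rightarrow> (nat \<Rightarrow> complex) set star_alg" where
  "Ult \<omega> \<equiv> continuous_part \<omega> (gtop circle) Calg trivial_action"

text \<open>Each class contains exactly one constant sequence, that of the limit along \<open>\<omega>\<close>.  The quotient norm is attained at it, since a limit
  is bounded by the supremum.\<close>
lemma complex_copy_ultrapower:
  assumes \<omega>: "free_ultrafilter \<omega>"
  shows "complex_copy (Ult \<omega>)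
    (\<lambda>c. uclass \<omega> Calg (\<lambda>_. c)) (ultra_action \<omega> Calg trivial_action)"
proof -
  let ?k = "\<lambda>c. uclass \<omega> Calg (\<lambda>_. c)"
  interpret C: function_alg Calg "\<lambda>c (_::unit). c" by (rule function_alg_Calg)
  interpret Q: seq_quotient Calg "\<lambda>c (_::unit). c" "linf Calg" "null_ideal \<omega> Calg" \<omega>
    by (rule C.ultrapower_quotient)
  interpret L: function_alg "linf Calg" "\<lambda>x p. (\<lambda>c (_::unit). c) (x (fst p)) (snd p)"
    by (rule C.linf_function_alg)
  have nb: "\<omega> \<noteq> bot" using \<omega> by (simp add: free_ultrafilter_def)
  have const: "(\<lambda>_. c) \<in> carrier (linf Calg)" for c by (auto simp: linf_Calg)
  have cp: "aadd (Ult \<omega>) = aadd (quot (linf Calg) (null_ideal \<omega> Calg))"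
    "azero (Ult \<omega>) = azero (quot (linf Calg) (null_ideal \<omega> Calg))"
    "amult (Ult \<omega>) = amult (quot (linf Calg) (null_ideal \<omega> Calg))"
    "ascale (Ult \<omega>) = ascale (quot (linf Calg) (null_ideal \<omega> Calg))"
    "astar (Ult \<omega>) = astar (quot (linf Calg) (null_ideal \<omega> Calg))"
    "anorm (Ult \<omega>) = anorm (quot (linf Calg) (null_ideal \<omega> Calg))"
    by (simp_all add: continuous_part_def ultrapower_def)
  show ?thesis
  proof
    show "inj ?k"
      by (rule injI) (simp add: uclass_Calg_eq_iff const tendsto_const_iff nb)
    have "carrier (Ult \<omega>) = uclass \<omega> Calg ` carrier (linf Calg)"
      by (auto simp: continuous_part_def)
    also have "\<dots> = range ?k"
    proof (intro equalityI subsetI)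
      fix X assume "X \<in> uclass \<omega> Calg ` carrier (linf Calg)"
      then obtain x where x: "x \<in> carrier (linf Calg)" "X = uclass \<omega> Calg x" by blast
      then obtain K where "\<And>n. cmod (x n) \<le> K" by (auto simp: linf_Calg)
      then obtain L where "(x \<longlongrightarrow> L) \<omega>" using ultrafilter_limit[OF \<omega>] by blast
      then show "X \<in> range ?k" using uclass_Calg_const[OF x(1)] x(2) by blast
    qed (use const in blast)
    finally show "carrier (Ult \<omega>) = range ?k" .
    fix c d
    show "aadd (Ult \<omega>) (?k c) (?k d) = ?k (c + d)"
      unfolding cp uclass_def using Q.quot_add[OF const const] by simp
    show "azero (Ult \<omega>) = ?k 0"
      unfolding cp uclass_def using Q.quot_zero by simp
    show "amult (Ult \<omega>) (?k c) (?k d) = ?k (c * d)"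
      unfolding cp uclass_def using Q.quot_mult[OF const const] by simp
    show "ascale (Ult \<omega>) c (?k d) = ?k (c * d)"
      unfolding cp uclass_def using Q.quot_scale[OF const] by simp
    show "astar (Ult \<omega>) (?k c) = ?k (cnj c)"
      unfolding cp uclass_def using Q.quot_star[OF const] by simp
    show "ultra_action \<omega> Calg trivial_action s (?k c) = ?k c" for s
      unfolding ultra_action_def uclass_def by (rule Q.UN_coset_eq) (use const in simp_all)
    have ge: "cmod c \<le> anorm (linf Calg) x" if "x \<in> ?k c" for x
    proof -
      have x: "x \<in> carrier (linf Calg)" and sim: "((\<lambda>n. dist c (x n)) \<longlongrightarrow> 0) \<omega>"
        using that Q.coset_iff[OF const] by (simp_all add: uclass_def Q.sim_def adist_Calg)
      have "((\<lambda>n. cmod (x n)) \<longlongrightarrow> cmod c) \<omega>"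
        using sim by (intro tendsto_norm) (simp add: tendsto_dist_iff[of x] dist_commute)
      moreover have "cmod (x n) \<le> anorm (linf Calg) x" for n
        using L.cmod_h_le[OF x, of "(n, ())"] by simp
      ultimately show ?thesis using nb by (intro tendsto_upperbound) auto
    qed
    have mem: "(\<lambda>_. c) \<in> ?k c" using Q.coset_iff[OF const] const by (simp add: uclass_def Q.sim_refl)
    have "(INF x\<in>?k c. anorm (linf Calg) x) = cmod c"
    proof (rule antisym)
      have "(INF x\<in>?k c. anorm (linf Calg) x) \<le> anorm (linf Calg) (\<lambda>_. c)"
        using ge by (intro cINF_lower mem) (auto simp: bdd_below_def)
      then show "(INF x\<in>?k c. anorm (linf Calg) x) \<le> cmod c" by (simp add: linf_def)
      show "cmod c \<le> (INF x\<in>?k c. anorm (linf Calg) x)"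
        using mem ge by (intro cINF_greatest) auto
    qed
    then show "anorm (Ult \<omega>) (?k c) = cmod c"
      unfolding cp by (simp add: quot_def)
  qed
qed

section \<open>The canonical embedding and its range\<close>

text \<open>Multiplication by the character \<open>s \<mapsto> s\<^bsup>-m\<^esup>\<close> shifts the Fourier coefficients by \<open>m\<close>, which preserves their
  supremum.\<close>
lemma (in complex_copy) dual_action_bounds:
  assumes \<gamma>: "\<gamma> \<in> characters circle" and X: "X \<in> carrier (crossed_product circle circ B \<beta>)"
  shows "dual_action circle circ B \<beta> \<gamma> X \<in> carrier (crossed_product circle circ B \<beta>)"
    and "anorm (crossed_product circle circ B \<beta>) (dual_action circle circ B \<beta> \<gamma> X)
      \<le> anorm (crossed_product circle circ B \<beta>) X"
proof -
  interpret CA: function_alg CA "\<lambda>f. fourier (coeff_fun f)" by (rule CA_function_alg)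
  obtain m where m: "\<And>s. s \<in> S1 \<Longrightarrow> \<gamma> s = s powi m" using character_is_power[OF \<gamma>] by blast
  let ?F = "\<lambda>f. \<lambda>s\<in>carrier circle. ascale B (cnj (\<gamma> s)) (f s)"
  have F: "?F f = lift (\<lambda>s. s powi (- m) * coeff_fun f s)" if "f \<in> C_c" for f
    unfolding lift_def circle_simps
  proof (rule restrict_ext)
    fix s assume s: "s \<in> S1"
    show "ascale B (cnj (\<gamma> s)) (f s) = k (s powi (- m) * coeff_fun f s)"
      by (simp only: m[OF s] Cc_values[OF that s] k_scale cnj_powi_S1[OF s])
  qed
  have F_mem: "?F f \<in> carrier CA" if "f \<in> carrier CA" for f
    using that unfolding CA_carrier F[OF that[unfolded CA_carrier]]
    by (intro lift_mem continuous_intros coeff_continuous)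
  have F_fourier: "fourier (coeff_fun (?F f)) n = fourier (coeff_fun f) (n - m)" if "f \<in> carrier CA" for f n
    unfolding F[OF that[unfolded CA_carrier]] fourier_coeff_lift
    unfolding fourier_def
  proof (intro Bochner_Integration.integral_cong refl)
    fix s assume "s \<in> space circ"
    then have "s powi (n - m) = s powi (- m) * s powi n"
      using S1_nonzero[of s] by (simp flip: power_int_add)
    then show "s powi (- m) * coeff_fun f s * s powi n = coeff_fun f s * s powi (n - m)" by simp
  qed
  have F_dist: "adist CA (?F f) (?F g) \<le> adist CA f g" if fg: "f \<in> carrier CA" "g \<in> carrier CA" for f g
    by (rule CA.dist_leI[OF F_mem[OF fg(1)] F_mem[OF fg(2)]])
      (simp only: F_fourier[OF fg(1)] F_fourier[OF fg(2)] CA.cmod_h_diff_le[OF fg])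
  have F_norm: "anorm CA (?F f) \<le> anorm CA f" if f: "f \<in> carrier CA" for f
    by (rule CA.norm_leI[OF F_mem[OF f]]) (simp only: F_fourier[OF f] CA.cmod_h_le[OF f])
  note X' = X[unfolded crossed_product_def]
  show "dual_action circle circ B \<beta> \<gamma> X \<in> carrier (crossed_product circle circ B \<beta>)"
    unfolding dual_action_def crossed_product_def
    using F_mem F_dist F_norm X' by (rule CA.completion_map_norm_le(1))
  show "anorm (crossed_product circle circ B \<beta>) (dual_action circle circ B \<beta> \<gamma> X)
      \<le> anorm (crossed_product circle circ B \<beta>) X"
    unfolding dual_action_def crossed_product_def
    using F_mem F_dist F_norm X' by (rule CA.completion_map_norm_le(2))
qed

lemma (in complex_copy) elem_eq:
  "elem circle circ B \<beta> (k c) f = completion_incl CA (lift (\<lambda>s. f s * c))"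
  by (simp add: elem_def lift_def k_scale)

context
  fixes \<omega> :: "nat filter"
  assumes \<omega>: "free_ultrafilter \<omega>"
begin

interpretation A: complex_copy Calg "\<lambda>c. c" trivial_action
  by (rule complex_copy_Calg)

interpretation FA: function_alg A.CA "\<lambda>f. fourier (A.coeff_fun f)"
  by (rule A.CA_function_alg)

abbreviation KA where "KA \<equiv> completion A.CA"

interpretation KA: function_alg KA FA.hbar
  by (rule FA.completion_function_alg)

interpretation U: seq_quotient KA FA.hbar "linf KA"
  "null_ideal \<omega> KA" \<omega>
  by (rule KA.ultrapower_quotient)

interpretation B: complex_copy "Ult \<omega>"
  "\<lambda>c. uclass \<omega> Calg (\<lambda>_. c)" "ultra_action \<omega> Calg trivial_action"
  by (rule complex_copy_ultrapower[OF \<omega>])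

interpretation FB: function_alg B.CA "\<lambda>f. fourier (B.coeff_fun f)"
  by (rule B.CA_function_alg)

abbreviation KB where "KB \<equiv> completion B.CA"

interpretation KB: function_alg KB FB.hbar
  by (rule FB.completion_function_alg)

text \<open>The two crossed products are represented by the same set of functions on the integers, and \<open>transfer\<close> matches
  the elements with equal functions.\<close>
definition transfer :: "(nat \<Rightarrow> complex \<Rightarrow> (nat \<Rightarrow> complex) set) set \<Rightarrow> (nat \<Rightarrow> complex \<Rightarrow> complex) set" where
  "transfer X = inv_into (carrier KA) FA.hbar (FB.hbar X)"

text \<open>The canonical embedding \<open>\<Phi>\<close>.\<close>
definition diag :: "(nat \<Rightarrow> complex \<Rightarrow> (nat \<Rightarrow> complex) set) set \<Rightarrow> (nat \<Rightarrow> (nat \<Rightarrow> complex \<Rightarrow> complex) set) set" where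
  "diag X = uclass \<omega> KA (\<lambda>_. transfer X)"

lemma transfer:
  assumes "X \<in> carrier KB"
  shows "transfer X \<in> carrier KA" and "FA.hbar (transfer X) = FB.hbar X"
proof -
  have "FB.hbar ` carrier KB = FA.hbar ` carrier KA"
    unfolding FA.hbar_image_completion FB.hbar_image_completion A.CA_image B.CA_image ..
  then have X: "FB.hbar X \<in> FA.hbar ` carrier KA" using assms by blast
  show "transfer X \<in> carrier KA" unfolding transfer_def by (rule inv_into_into[OF X])
  show "FA.hbar (transfer X) = FB.hbar X" unfolding transfer_def by (rule f_inv_into_f[OF X])
qed

lemma transfer_eqI:
  assumes "X \<in> carrier KB" "Y \<in> carrier KA" "FA.hbar Y = FB.hbar X"
  shows "transfer X = Y"
  by (rule KA.eqI[OF transfer(1)[OF assms(1)] assms(2)]) (simp only: transfer(2)[OF assms(1)] assms(3))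

lemma const_mem: "Y \<in> carrier KA \<Longrightarrow> (\<lambda>_. Y) \<in> carrier (linf KA)"
  unfolding KA.linf_carrier by blast

text \<open>On a discrete dual group the orbit of every bounded sequence is continuous; it only has to be seen
  that the orbit consists of bounded sequences.\<close>
lemma continuous_part_of_cp_carrier:
  "carrier (continuous_part_of_cp \<omega> circle circ Calg trivial_action)
    = uclass \<omega> KA ` carrier (linf KA)"
proof -
  interpret L: function_alg "linf KA" "\<lambda>x p. FA.hbar (x (fst p)) (snd p)"
    by (rule KA.linf_function_alg)
  have "continuous_map (dual_space circle) (atopology (linf KA))
      (\<lambda>\<gamma> n. dual_action circle circ Calg trivial_action \<gamma> (y n))"
    if y: "y \<in> carrier (linf KA)" for y
  proof (rule continuous_map_dual_circle, unfold L.topspace_atopology)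
    fix \<gamma> assume \<gamma>: "\<gamma> \<in> characters circle"
    obtain K where yK: "\<And>n. y n \<in> carrier KA" "\<And>n. anorm KA (y n) \<le> K"
      using y unfolding KA.linf_carrier by blast
    note da = A.dual_action_bounds[OF \<gamma>, unfolded crossed_product_def, OF yK(1)]
    show "(\<lambda>n. dual_action circle circ Calg trivial_action \<gamma> (y n)) \<in> carrier (linf KA)"
      unfolding KA.linf_carrier using da(1) order_trans[OF da(2) yK(2)] by blast
  qed
  then show ?thesis
    unfolding continuous_part_of_cp_def continuous_part_def crossed_product_def by auto
qed

lemma diag_star_hom:
  "star_hom KB (ultrapower \<omega> KA) diag"
  unfolding star_hom_def
proof (intro conjI ballI allI funcsetI)
  fix X assume X: "X \<in> carrier KB"
  note tX = transfer[OF X]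
  show "diag X \<in> carrier (ultrapower \<omega> KA)"
    unfolding ultrapower_def U.quot_carrier diag_def uclass_def using const_mem[OF tX(1)] by blast
  show "diag (ascale KB c X) = ascale (ultrapower \<omega> KA) c (diag X)" for c
  proof -
    have "transfer (ascale KB c X) = ascale KA c (transfer X)"
      by (rule transfer_eqI[OF KB.scale_closed[OF X] KA.scale_closed[OF tX(1)]])
        (simp only: KA.h_scale[OF tX(1)] KB.h_scale[OF X] tX(2))
    then show ?thesis
      unfolding ultrapower_def diag_def uclass_def U.quot_scale[OF const_mem[OF tX(1)]] by simp
  qed
  show "diag (astar KB X) = astar (ultrapower \<omega> KA) (diag X)"
  proof -
    have "transfer (astar KB X) = astar KA (transfer X)"
      by (rule transfer_eqI[OF KB.star_closed[OF X] KA.star_closed[OF tX(1)]])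
        (simp only: KA.h_star[OF tX(1)] KB.h_star[OF X] tX(2))
    then show ?thesis
      unfolding ultrapower_def diag_def uclass_def U.quot_star[OF const_mem[OF tX(1)]] by simp
  qed
  fix Y assume Y: "Y \<in> carrier KB"
  note tY = transfer[OF Y]
  show "diag (aadd KB X Y) = aadd (ultrapower \<omega> KA) (diag X) (diag Y)"
  proof -
    have "transfer (aadd KB X Y) = aadd KA (transfer X) (transfer Y)"
      by (rule transfer_eqI[OF KB.add_closed[OF X Y] KA.add_closed[OF tX(1) tY(1)]])
        (simp only: KA.h_add[OF tX(1) tY(1)] KB.h_add[OF X Y] tX(2) tY(2))
    then show ?thesis
      unfolding ultrapower_def diag_def uclass_def
        U.quot_add[OF const_mem[OF tX(1)] const_mem[OF tY(1)]] by simp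
  qed
  show "diag (amult KB X Y) = amult (ultrapower \<omega> KA) (diag X) (diag Y)"
  proof -
    have "transfer (amult KB X Y) = amult KA (transfer X) (transfer Y)"
      by (rule transfer_eqI[OF KB.mult_closed[OF X Y] KA.mult_closed[OF tX(1) tY(1)]])
        (simp only: KA.h_mult[OF tX(1) tY(1)] KB.h_mult[OF X Y] tX(2) tY(2))
    then show ?thesis
      unfolding ultrapower_def diag_def uclass_def
        U.quot_mult[OF const_mem[OF tX(1)] const_mem[OF tY(1)]] by simp
  qed
qed

lemma \<omega>_nontrivial: "\<omega> \<noteq> bot"
  using \<omega> by (simp add: free_ultrafilter_def)

lemma diag_inj: "inj_on diag (carrier KB)"
proof (rule inj_onI)
  fix X Y assume X: "X \<in> carrier KB" and Y: "Y \<in> carrier KB"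
    and eq: "diag X = diag Y"
  note tX = transfer[OF X] and tY = transfer[OF Y]
  have "U.sim (\<lambda>_. transfer X) (\<lambda>_. transfer Y)"
    using eq U.coset_eq_iff[OF const_mem[OF tX(1)] const_mem[OF tY(1)]]
    by (simp add: diag_def uclass_def)
  then have "adist KA (transfer X) (transfer Y) = 0"
    unfolding U.sim_def by (simp add: tendsto_const_iff \<omega>_nontrivial)
  then have "transfer X = transfer Y" using tX(1) tY(1) by simp
  then have "FB.hbar X = FB.hbar Y" using tX tY by metis
  then show "X = Y" by (intro KB.eqI[OF X Y]) (simp only:)
qed

text \<open>If \<open>a\<close> tends to \<open>L\<close> along \<open>\<omega>\<close>, its class is the scalar \<open>L\<close>, so that the left-hand side is the class of the constant sequence
  \<open>L f\<close>; the distance of \<open>a\<^sub>n f\<close> from it is at most \<open>\<bar>a\<^sub>n - L\<bar>\<close> times the supremum of \<open>\<bar>f\<bar>\<close>.\<close>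
lemma diag_elem:
  assumes a: "a \<in> carrier (linf Calg)" and f: "f \<in> Cc circle euclidean 0"
  shows "diag (elem circle circ (Ult \<omega>)
        (ultra_action \<omega> Calg trivial_action) (uclass \<omega> Calg a) f)
    = uclass \<omega> KA (\<lambda>n. elem circle circ Calg trivial_action (a n) f)"
proof -
  have fc: "continuous_on S1 f" using f by (simp add: Cc_def)
  obtain K where K: "\<And>n. cmod (a n) \<le> K" using a by (auto simp: linf_Calg)
  then obtain L where L: "(a \<longlongrightarrow> L) \<omega>" using ultrafilter_limit[OF \<omega>] by blast
  obtain M where M: "0 \<le> M" "\<And>s. s \<in> S1 \<Longrightarrow> cmod (f s) \<le> M" using continuous_S1_bounded[OF fc] by blast
  have gc: "continuous_on S1 (\<lambda>s. f s * c)" for c by (intro continuous_intros fc)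
  let ?g = "\<lambda>c s. f s * c"
  let ?E = "\<lambda>c. completion_incl A.CA (A.lift (?g c))"
  have A_mem: "A.lift (?g c) \<in> carrier A.CA" for c unfolding A.CA_carrier by (rule A.lift_mem[OF gc])
  have B_mem: "B.lift (?g c) \<in> carrier B.CA" for c unfolding B.CA_carrier by (rule B.lift_mem[OF gc])
  have hA: "FA.hbar (?E c) = fourier (?g c)" for c
    by (simp only: FA.hbar_completion_incl[OF A_mem] A.fourier_coeff_lift)
  have hB: "FB.hbar (completion_incl B.CA (B.lift (?g c))) = fourier (?g c)" for c
    by (simp only: FB.hbar_completion_incl[OF B_mem] B.fourier_coeff_lift)
  have mem: "?E c \<in> carrier KA" for c
    by (rule FA.completion_incl_closed[OF A_mem])
  have four: "fourier (?g c) m = c * fourier f m" for c m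
    using fourier_scale[of c f m] by (simp add: mult.commute)
  have "transfer (completion_incl B.CA (B.lift (?g L))) = ?E L"
    by (rule transfer_eqI[OF FB.completion_incl_closed[OF B_mem] mem]) (simp only: hA hB)
  moreover have "elem circle circ (Ult \<omega>)
      (ultra_action \<omega> Calg trivial_action) (uclass \<omega> Calg a) f = completion_incl B.CA (B.lift (?g L))"
    unfolding uclass_Calg_const[OF a L] by (rule B.elem_eq)
  moreover have "uclass \<omega> KA (\<lambda>_. ?E L) = uclass \<omega> KA (\<lambda>n. ?E (a n))"
  proof -
    have four_le: "cmod (fourier f m) \<le> M" for m by (rule fourier_le[OF fc M(2)])
    have seq: "(\<lambda>n. ?E (a n)) \<in> carrier (linf KA)"
    proof -
      have "anorm KA (?E (a n)) \<le> K * M" for n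
      proof (rule KA.norm_leI[OF mem])
        fix m
        have "0 \<le> K" using K[of n] norm_ge_zero[of "a n"] by linarith
        then show "cmod (FA.hbar (?E (a n)) m) \<le> K * M"
          unfolding hA four norm_mult using K[of n] four_le[of m] by (intro mult_mono) auto
      qed
      then show ?thesis unfolding KA.linf_carrier using mem by blast
    qed
    have "U.sim (\<lambda>_. ?E L) (\<lambda>n. ?E (a n))"
    proof (rule U.simI)
      have "((\<lambda>n. dist (a n) L) \<longlongrightarrow> 0) \<omega>" using L by (rule tendsto_dist_iff[THEN iffD1])
      then show "((\<lambda>n. dist (a n) L * M) \<longlongrightarrow> 0) \<omega>" by (rule tendsto_mult_left_zero)
      fix n
      show "adist KA (?E L) (?E (a n)) \<le> dist (a n) L * M"
      proof (rule KA.dist_leI[OF mem mem])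
        fix m
        have "cmod (L * fourier f m - a n * fourier f m) = dist (a n) L * cmod (fourier f m)"
          by (simp add: dist_norm norm_minus_commute norm_mult flip: left_diff_distrib)
        also have "\<dots> \<le> dist (a n) L * M" by (intro mult_left_mono four_le) simp
        finally show "cmod (FA.hbar (?E L) m
            - FA.hbar (?E (a n)) m) \<le> dist (a n) L * M"
          unfolding hA four .
      qed
    qed
    then show ?thesis unfolding uclass_def using U.coset_eq_iff[OF const_mem[OF mem] seq] by blast
  qed
  ultimately show ?thesis unfolding diag_def A.elem_eq by simp
qed

text \<open>The witness is the sequence of the characters \<open>s \<mapsto> s\<^sup>n\<close>.  If it were equivalent to a constant sequence,
  two different members would be closer than one half to the same element; but their Fourier coefficients of
  order \<open>-n\<close> differ by one.\<close>
lemma diag_range: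
  "diag ` carrier KB \<subset> uclass \<omega> KA ` carrier (linf KA)"
proof (rule psubsetI)
  show "diag ` carrier KB \<subseteq> uclass \<omega> KA ` carrier (linf KA)"
    unfolding diag_def using const_mem transfer(1) by blast
  define e where "e n = completion_incl A.CA (A.lift (\<lambda>s. s powi int n))" for n
  have e_mem: "A.lift (\<lambda>s. s powi int n) \<in> carrier A.CA" for n
    unfolding A.CA_carrier by (intro A.lift_mem continuous_intros)
  have e: "e n \<in> carrier KA" for n
    unfolding e_def by (rule FA.completion_incl_closed[OF e_mem])
  have he: "FA.hbar (e n) m = (if int n + m = 0 then 1 else 0)" for n m
    unfolding e_def FA.hbar_completion_incl[OF e_mem] A.fourier_coeff_lift by (rule fourier_powi)
  have "anorm KA (e n) \<le> 1" for n
    by (rule KA.norm_leI[OF e]) (simp add: he)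
  then have e_linf: "e \<in> carrier (linf KA)"
    unfolding KA.linf_carrier using e by blast
  have "uclass \<omega> KA e \<notin> diag ` carrier KB"
  proof
    assume "uclass \<omega> KA e \<in> diag ` carrier KB"
    then obtain X where X: "X \<in> carrier KB" and eq: "uclass \<omega> KA e = diag X"
      by blast
    note tX = transfer(1)[OF X]
    have "U.sim e (\<lambda>_. transfer X)"
      using eq U.coset_eq_iff[OF e_linf const_mem[OF tX]] unfolding diag_def uclass_def by blast
    then have ev: "\<forall>\<^sub>F n in \<omega>. adist KA (e n) (transfer X) < 1 / 2"
      unfolding U.sim_def by (rule order_tendstoD(2)) simp
    then obtain n where n: "adist KA (e n) (transfer X) < 1 / 2"
      using eventually_happens'[OF \<omega>_nontrivial] by blast
    have "\<forall>\<^sub>F m in \<omega>. m \<noteq> n" using \<omega> by (simp add: free_ultrafilter_def)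
    then have "\<forall>\<^sub>F m in \<omega>. m \<noteq> n \<and> adist KA (e m) (transfer X) < 1 / 2"
      using ev by (rule eventually_conj)
    then obtain m where m: "m \<noteq> n" "adist KA (e m) (transfer X) < 1 / 2"
      using eventually_happens'[OF \<omega>_nontrivial] by blast
    have "1 = cmod (FA.hbar (e n) (- int n) - FA.hbar (e m) (- int n))"
      using m(1) by (simp add: he)
    also have "\<dots> \<le> adist KA (e n) (e m)" by (rule KA.cmod_h_diff_le[OF e e])
    also have "\<dots> \<le> adist KA (e n) (transfer X) + adist KA (e m) (transfer X)"
      by (rule KA.M.triangle'[OF e tX e])
    also have "\<dots> < 1" using n m(2) by simp
    finally show False by simp
  qed
  then show "diag ` carrier KB \<noteq> uclass \<omega> KA ` carrier (linf KA)"
    using e_linf by blast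
qed

lemma canonical_embedding_diag: "canonical_embedding \<omega> circle circ Calg trivial_action diag"
  unfolding canonical_embedding_def cp_of_continuous_part_def crossed_product_def
  using diag_star_hom diag_inj diag_elem by blast

lemma diag_range_psubset:
  "diag ` carrier (cp_of_continuous_part \<omega> circle circ Calg trivial_action)
    \<subset> carrier (continuous_part_of_cp \<omega> circle circ Calg trivial_action)"
  unfolding continuous_part_of_cp_carrier cp_of_continuous_part_def crossed_product_def
  by (rule diag_range)

end

theorem theorem4p2:
  fixes \<omega> :: "nat filter"
  assumes "free_ultrafilter \<omega>"
  shows "\<exists>(G :: complex top_group) (\<mu> :: complex measure) (A :: complex star_alg)
            (\<alpha> :: complex \<Rightarrow> complex \<Rightarrow> complex) \<Phi>.
           sc_lca_group G \<and> haar_measure G \<mu> \<and>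
           cstar_algebra A \<and> cont_action G A \<alpha> \<and>
           canonical_embedding \<omega> G \<mu> A \<alpha> \<Phi> \<and>
           \<Phi> ` carrier (cp_of_continuous_part \<omega> G \<mu> A \<alpha>)
             \<subset> carrier (continuous_part_of_cp \<omega> G \<mu> A \<alpha>)"
  using circle_sc_lca_group circ_haar cstar_algebra_Calg cont_action_trivial
    canonical_embedding_diag[OF assms] diag_range_psubset[OF assms] by blast

end
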